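(* For every integer $n\ge2$, $$2<\mathrm C_n<2n\arctan\frac1{n-1}.$$ Moreover, $\mathrm C_n$ is strictly decreasing in $n$ (for $n\geq 2$).
   Context: For formal noncommuting variables $X_1,\dots,X_n$, $\Gamma(X_1,\dots,X_n)$ is the formal noncommutative power series of $\log\big((\exp X_1)\cdots(\exp X_n)\big)$ with the coefficient of each monomial replaced by its absolute value. For $x_i\in[0,+\infty)$, $\Gamma_{\mathrm{real}}(x_1,\dots,x_n)\in[0,+\infty]$ is the value of this series with $x_i$ substituted for $X_i$. For $n\ge2$, $\mathrm C_n=\min\{x_1+\dots+x_n: x_1,\dots,x_n\in[0,+\infty),\ \Gamma_{\mathrm{real}}(x_1,\dots,x_n)=+\infty\}$ (the cumulative convergence radius of the Baker–Campbell–Hausdorff expansion with $n$ terms in Banach algebras). *)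

theory Defs
  imports "HOL-Analysis.Analysis"
begin

text \<open>
  A formal power series with real coefficients in noncommuting variables indexed by \<^typ>\<open>'a\<close>
  is represented by its coefficient function; a monomial is the word (list) of its variables.
\<close>

type_synonym 'a ncfps = "'a list \<Rightarrow> real"

definition nc_one :: "'a ncfps" where
  "nc_one w = (if w = [] then 1 else 0)"

definition nc_var :: "'a \<Rightarrow> 'a ncfps" where
  "nc_var a w = (if w = [a] then 1 else 0)"

definition nc_mult :: "'a ncfps \<Rightarrow> 'a ncfps \<Rightarrow> 'a ncfps" where
  "nc_mult f g w = (\<Sum>i\<le>length w. f (take i w) * g (drop i w))"

primrec nc_power :: "'a ncfps \<Rightarrow> nat \<Rightarrow> 'a ncfps" where
  "nc_power f 0 = nc_one"
| "nc_power f (Suc k) = nc_mult f (nc_power f k)"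

text \<open>
  The exponential is meant for series with constant term 0 and the logarithm for series with
  constant term 1. Then the series of coefficients below have only finitely many nonzero
  terms, by the lemma \<open>nc_power_eq_0\<close>.
\<close>

definition nc_exp :: "'a ncfps \<Rightarrow> 'a ncfps" where
  "nc_exp f w = (\<Sum>k. nc_power f k w / fact k)"

definition nc_log :: "'a ncfps \<Rightarrow> 'a ncfps" where
  "nc_log f w = (\<Sum>k. (- 1) ^ k / real (Suc k) * nc_power (\<lambda>v. f v - nc_one v) (Suc k) w)"

lemma nc_power_eq_0:
  assumes "f [] = 0" and "length w < k"
  shows "nc_power f k w = 0"
  using assms(2)
proof (induction k arbitrary: w)
  case (Suc k)
  have "f (take i w) * nc_power f k (drop i w) = 0" if "i \<le> length w" for i
  proof (cases "i = 0")
    case True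
    then show ?thesis using assms(1) by simp
  next
    case False
    then have "length (drop i w) < k" using Suc.prems that by auto
    then show ?thesis using Suc.IH by simp
  qed
  then show ?case by (auto simp: nc_mult_def intro!: sum.neutral)
qed simp

definition bch :: "nat \<Rightarrow> nat ncfps" where
  "bch n = nc_log (foldr nc_mult (map (\<lambda>i. nc_exp (nc_var i)) [1..<Suc n]) nc_one)"

definition Gamma_abs :: "nat \<Rightarrow> nat ncfps" where
  "Gamma_abs n w = \<bar>bch n w\<bar>"

definition Gamma_real :: "nat \<Rightarrow> (nat \<Rightarrow> real) \<Rightarrow> ennreal" where
  "Gamma_real n x =
    (\<Sum>\<^sub>\<infinity>w\<in>lists {1..n}. ennreal (Gamma_abs n w * prod_list (map x w)))"

definition divergence_sums :: "nat \<Rightarrow> real set" where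
  "divergence_sums n =
    {(\<Sum>i=1..n. x i) | x. (\<forall>i\<in>{1..n}. 0 \<le> x i) \<and> Gamma_real n x = \<infinity>}"

text \<open>
  The set of sums is infinite, so its minimum is rendered by \<^const>\<open>Least\<close> rather
  than \<^const>\<open>Min\<close>.
\<close>

definition cum_radius :: "nat \<Rightarrow> real" where
  "cum_radius n = (LEAST s. s \<in> divergence_sums n)"

end

(*
  Writing log A as the integral over t from 0 to 1 of (A - 1) / (1 + t (A - 1)), the coefficient of a word
  in log (exp X_1 ... exp X_n) is the integral of (1 - t)^asc (- t)^des times a product over the runs of the
  word, where a run of length m contributes the m-th coefficient g_m(t) of (e^x - 1) / (1 - t + t e^x).
  Replacing everything by absolute values under the integral gives a sum over words that can be
  evaluated as a quotient with an explicit denominator D(t, x), built from r_i = sum_m |g_m(t)| x_i^m.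

  If D(t, x) > 0 for all t, the series converges. Conversely, where D first vanishes, choosing signs
  adapted to the critical t turns the series into an integral with a non-integrable singularity, so it
  diverges. Hence the radius is the minimum of x_1 + ... + x_n over {D(t, x) <= 0 for some t}, which is
  attained by compactness.

  The lower bound 2 comes from the differential inequality r' <= 1 + |1 - 2t| r + t (1 - t) r^2, obtained
  from the Riccati equation for the g_m. The upper bound comes from x_1 = ... = x_n, where t = 1/2 gives
  r = 2 tan (x/2), and t close to 1/2 is strictly better. For monotonicity, one letter of a minimizer is
  split into two halves, which makes D strictly negative.
*)

theory Submission
  imports Defs "HOL-Complex_Analysis.Complex_Analysis"
begin

section \<open>Denominator and numerator of the word series\<close>

text \<open>\<open>Gamma_abs\<close> is the absolute value of an integral over t, whereas the
  tractable majorant integrates absolute values. The two differ, because the run coefficients change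
  sign with t; only the boundary of divergence has to agree. It does because (1 - t)^asc (- t)^des
  keeps its sign on [0,1], so a sign pattern can be frozen at one critical t. As the pattern is
  itself a product over runs and steps, the signed sum is again a quotient N / d of the same shape.
  Away from the critical t only a lower bound of N / d is required, and it rests on N > 0 at all
  zeros of d. Everything takes place where all x_i < \<pi>: the one-letter series have radius at
  least \<pi> for every t in [0,1], and exactly \<pi> at t = 1/2. The explicit point for the upper
  bound has total 2 n arctan(1 / (n - 1)) \<le> \<pi>, with equality at n = 2, so the strict
  inequality is also what keeps the minimizer inside this region.\<close>

text \<open>
  Give a word in the letters \<open>1, \<dots>, n\<close> the product of \<open>r i\<close> over its runs, of \<open>s\<close> over the ascents
  and of \<open>t\<close> over the descents between consecutive runs. For \<open>s + t = 1\<close> and \<open>q = s t\<close> the sum of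
  all words is \<open>word_num / word_den\<close>; the column \<open>(word_den, word_num)\<close> is the product of the commuting matrices
  \<open>I + r i J\<close>, where \<open>J\<close> has rows \<open>(0, - q)\<close> and \<open>(1, 1)\<close>, applied to \<open>(1, 0)\<close>.
\<close>

fun word_den :: "real \<Rightarrow> (nat \<Rightarrow> real) \<Rightarrow> nat \<Rightarrow> real"
  and word_num :: "real \<Rightarrow> (nat \<Rightarrow> real) \<Rightarrow> nat \<Rightarrow> real" where
  "word_den q r 0 = 1"
| "word_num q r 0 = 0"
| "word_den q r (Suc k) = word_den q r k - q * r (Suc k) * word_num q r k"
| "word_num q r (Suc k) = word_num q r k + r (Suc k) * (word_num q r k + word_den q r k)"

lemma word_den_word_num_cong:
  assumes "\<And>i. i \<in> {1..n} \<Longrightarrow> r i = r' i"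
  shows "word_den q r n = word_den q r' n" "word_num q r n = word_num q r' n"
  using assms by (induction n) auto

lemma word_den_zero [simp]: "word_den 0 r n = 1"
  by (induction n) auto

text \<open>For q = s t and s + t = 1 the row vector (1, t) is a left eigenvector of J with
  eigenvalue t, so each factor I + r i J multiplies this combination by 1 + t * r i.\<close>

lemma word_den_add_word_num:
  assumes "s + t = 1"
  shows "word_den (s * t) r n + t * word_num (s * t) r n = (\<Prod>i=1..n. 1 + t * r i)"
proof (induction n)
  case (Suc n)
  have "d - s * t * x * m + t * (m + x * (m + d)) = (d + t * m) * (1 + t * x)" for d m x
    using assms by algebra
  then show ?case using Suc by simp
qed simp

lemma word_den_add_rnum':
  assumes "s + t = 1"
  shows "word_den (s * t) r n + s * word_num (s * t) r n = (\<Prod>i=1..n. 1 + s * r i)"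
  using word_den_add_word_num[of t s r n] assms by (simp add: ac_simps)

text \<open>Eliminating \<open>word_den\<close>, which may be negative, leaves a recursion that has
  no subtraction when s, t and r are nonnegative; the comparisons below go through it.\<close>

lemma word_num_Suc_prod:
  assumes "s + t = 1"
  shows "word_num (s * t) r (Suc n)
    = word_num (s * t) r n * (1 + s * r (Suc n)) + r (Suc n) * (\<Prod>i=1..n. 1 + t * r i)"
proof -
  have "m + x * (m + d) = m * (1 + s * x) + x * (d + t * m)" for d m x
    using assms by algebra
  then show ?thesis
    unfolding word_den_add_word_num[OF assms, symmetric] word_num.simps .
qed

lemma abs_one_plus_mult_le:
  fixes t :: real
  assumes "\<bar>a\<bar> \<le> b" "0 \<le> t"
  shows "\<bar>1 + t * a\<bar> \<le> 1 + t * b"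
proof -
  have "\<bar>1 + t * a\<bar> \<le> 1 + t * \<bar>a\<bar>"
    using abs_triangle_ineq[of 1 "t * a"] assms(2) by (simp add: abs_mult)
  then show ?thesis using mult_left_mono[OF assms] by linarith
qed

text \<open>The sign change in the recursion of \<open>word_den\<close> blocks a direct comparison.
  First \<open>word_num\<close> is dominated through its subtraction-free recursion; then
  \<open>word_den\<close> decreases because more is subtracted from it.\<close>

lemma word_den_mono:
  assumes "s + t = 1" "0 \<le> s" "0 \<le> t" and le: "\<And>i. i \<in> {1..n} \<Longrightarrow> \<bar>\<rho> i\<bar> \<le> r i"
  shows "\<bar>word_num (s * t) \<rho> n\<bar> \<le> word_num (s * t) r n \<and> word_den (s * t) r n \<le> word_den (s * t) \<rho> n"
  using le
proof (induction n)
  case (Suc n)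
  have IH: "\<bar>word_num (s * t) \<rho> n\<bar> \<le> word_num (s * t) r n" "word_den (s * t) r n \<le> word_den (s * t) \<rho> n"
    using Suc by auto
  have P: "\<bar>\<Prod>i=1..n. 1 + t * \<rho> i\<bar> \<le> (\<Prod>i=1..n. 1 + t * r i)"
    unfolding abs_prod
  proof (rule prod_mono, safe)
    fix i assume "i \<in> {1..n}"
    then show "\<bar>1 + t * \<rho> i\<bar> \<le> 1 + t * r i"
      using Suc.prems assms(3) by (intro abs_one_plus_mult_le) auto
  qed simp
  have r: "\<bar>\<rho> (Suc n)\<bar> \<le> r (Suc n)" using Suc.prems by simp
  have "\<bar>word_num (s * t) \<rho> n * (1 + s * \<rho> (Suc n))\<bar> \<le> word_num (s * t) r n * (1 + s * r (Suc n))"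
    unfolding abs_mult
  proof (rule mult_mono[OF IH(1)])
    show "\<bar>1 + s * \<rho> (Suc n)\<bar> \<le> 1 + s * r (Suc n)"
      using r assms(2) by (rule abs_one_plus_mult_le)
  qed (use IH in auto)
  moreover have "\<bar>\<rho> (Suc n) * (\<Prod>i=1..n. 1 + t * \<rho> i)\<bar> \<le> r (Suc n) * (\<Prod>i=1..n. 1 + t * r i)"
    unfolding abs_mult by (rule mult_mono[OF r P]) (use r in auto)
  ultimately have "\<bar>word_num (s * t) \<rho> (Suc n)\<bar> \<le> word_num (s * t) r (Suc n)"
    unfolding word_num_Suc_prod[OF assms(1)] by linarith
  moreover have "\<bar>\<rho> (Suc n) * word_num (s * t) \<rho> n\<bar> \<le> r (Suc n) * word_num (s * t) r n"
    unfolding abs_mult by (rule mult_mono[OF r IH(1)]) (use r in auto)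
  then have "(s * t) * (\<rho> (Suc n) * word_num (s * t) \<rho> n) \<le> (s * t) * (r (Suc n) * word_num (s * t) r n)"
    using assms(2,3) by (intro mult_left_mono) auto
  then have "word_den (s * t) r (Suc n) \<le> word_den (s * t) \<rho> (Suc n)"
    using IH(2) by (simp add: mult.assoc)
  ultimately show ?case by blast
qed simp

lemma word_num_ge:
  assumes "s + t = 1" "0 \<le> s" "0 \<le> t" and le: "\<And>i. i \<in> {1..n} \<Longrightarrow> 0 \<le> r i" and "j \<in> {1..n}"
  shows "r j \<le> word_num (s * t) r n"
  using le assms(5)
proof (induction n)
  case (Suc n)
  have N: "0 \<le> word_num (s * t) r n"
    using word_den_mono[of s t n r r] assms(1-3) Suc.prems(1) by auto
  have r: "0 \<le> r (Suc n)" using Suc.prems by auto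
  have P: "1 \<le> (\<Prod>i=1..n. 1 + t * r i)"
    by (rule prod_ge_1) (use assms(3) Suc.prems(1) in auto)
  have 1: "word_num (s * t) r n \<le> word_num (s * t) r n * (1 + s * r (Suc n))"
    using N r assms(2) by (simp add: algebra_simps)
  have 2: "r (Suc n) \<le> r (Suc n) * (\<Prod>i=1..n. 1 + t * r i)"
    using P r by (metis mult.right_neutral mult_left_mono)
  show ?case
  proof (cases "j = Suc n")
    case True
    then show ?thesis using 1 2 N unfolding word_num_Suc_prod[OF assms(1)] True by linarith
  next
    case False
    then have "r j \<le> word_num (s * t) r n" using Suc by auto
    then show ?thesis unfolding word_num_Suc_prod[OF assms(1)] using 1 2 r by linarith
  qed
qed simp

text \<open>Strictness for \<open>word_den\<close> needs a second positive letter: with a single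
  nonzero letter \<open>word_den\<close> is constantly 1. Later this excludes negative entries at a
  zero of the denominator.\<close>

lemma word_den_strict_mono:
  assumes st: "s + t = 1" "0 < s" "0 < t" and le: "\<And>i. i \<in> {1..n} \<Longrightarrow> \<bar>\<rho> i\<bar> \<le> r i"
    and j: "j \<in> {1..n}" "\<bar>\<rho> j\<bar> < r j"
  shows "\<bar>word_num (s * t) \<rho> n\<bar> < word_num (s * t) r n
    \<and> (\<forall>i\<in>{1..n}. i \<noteq> j \<longrightarrow> 0 < r i \<longrightarrow> word_den (s * t) r n < word_den (s * t) \<rho> n)"
  using le j(1)
proof (induction n)
  case (Suc n)
  have st0: "0 \<le> s" "0 \<le> t" using st by auto
  have M: "\<bar>word_num (s * t) \<rho> n\<bar> \<le> word_num (s * t) r n" "word_den (s * t) r n \<le> word_den (s * t) \<rho> n"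
    using word_den_mono[OF st(1) st0, of n \<rho> r] Suc.prems(1) by auto
  have rS: "\<bar>\<rho> (Suc n)\<bar> \<le> r (Suc n)" using Suc.prems by simp
  have r0: "0 \<le> r i" if "i \<in> {1..n}" for i using Suc.prems(1)[of i] that by (simp add: order.trans[OF abs_ge_zero])
  have P: "\<bar>\<Prod>i=1..n. 1 + t * \<rho> i\<bar> \<le> (\<Prod>i=1..n. 1 + t * r i)"
    unfolding abs_prod
  proof (rule prod_mono, safe)
    fix i assume "i \<in> {1..n}"
    then show "\<bar>1 + t * \<rho> i\<bar> \<le> 1 + t * r i"
      using Suc.prems st0 by (intro abs_one_plus_mult_le) auto
  qed simp
  have P1: "1 \<le> (\<Prod>i=1..n. 1 + t * r i)"
    by (rule prod_ge_1) (use st0 r0 in auto)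
  have f: "\<bar>1 + s * \<rho> (Suc n)\<bar> \<le> 1 + s * r (Suc n)"
    using rS st0(1) by (rule abs_one_plus_mult_le)
  have A: "\<bar>word_num (s * t) \<rho> n * (1 + s * \<rho> (Suc n))\<bar> \<le> \<bar>word_num (s * t) \<rho> n\<bar> * (1 + s * r (Suc n))"
    unfolding abs_mult by (rule mult_left_mono[OF f]) simp
  have A': "\<bar>word_num (s * t) \<rho> n\<bar> * (1 + s * r (Suc n)) \<le> word_num (s * t) r n * (1 + s * r (Suc n))"
    using M(1) rS st0 by (intro mult_right_mono) auto
  have B: "\<bar>\<rho> (Suc n) * (\<Prod>i=1..n. 1 + t * \<rho> i)\<bar> \<le> \<bar>\<rho> (Suc n)\<bar> * (\<Prod>i=1..n. 1 + t * r i)"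
    unfolding abs_mult by (rule mult_left_mono[OF P]) simp
  have B': "\<bar>\<rho> (Suc n)\<bar> * (\<Prod>i=1..n. 1 + t * r i) \<le> r (Suc n) * (\<Prod>i=1..n. 1 + t * r i)"
    using rS P1 by (intro mult_right_mono) auto
  have C: "\<rho> (Suc n) * word_num (s * t) \<rho> n \<le> \<bar>\<rho> (Suc n)\<bar> * \<bar>word_num (s * t) \<rho> n\<bar>"
    by (metis abs_ge_self abs_mult)
  have st': "0 < s * t" using st by simp
  have D: "word_den (s * t) r (Suc n) < word_den (s * t) \<rho> (Suc n)"
    if "word_den (s * t) r n < word_den (s * t) \<rho> n \<or>
      \<bar>\<rho> (Suc n)\<bar> * \<bar>word_num (s * t) \<rho> n\<bar> < r (Suc n) * word_num (s * t) r n"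
  proof -
    have "\<bar>\<rho> (Suc n)\<bar> * \<bar>word_num (s * t) \<rho> n\<bar> \<le> r (Suc n) * word_num (s * t) r n"
      by (rule mult_mono[OF rS M(1)]) (use rS in auto)
    then have "word_den (s * t) r n + s * t * (\<rho> (Suc n) * word_num (s * t) \<rho> n)
      < word_den (s * t) \<rho> n + s * t * (r (Suc n) * word_num (s * t) r n)"
      using that
    proof (elim disjE, goal_cases)
      case 1
      then have "s * t * (\<rho> (Suc n) * word_num (s * t) \<rho> n) \<le> s * t * (r (Suc n) * word_num (s * t) r n)"
        using C st' by (intro mult_left_mono) auto
      then show ?case using 1 by linarith
    next
      case 2
      then have "s * t * (\<rho> (Suc n) * word_num (s * t) \<rho> n) < s * t * (r (Suc n) * word_num (s * t) r n)"
        using C st' by (intro mult_strict_left_mono) auto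
      then show ?case using M(2) by linarith
    qed
    then show ?thesis by (simp add: algebra_simps)
  qed
  show ?case
  proof (cases "j = Suc n")
    case True
    have "\<bar>\<rho> (Suc n)\<bar> * (\<Prod>i=1..n. 1 + t * r i) < r (Suc n) * (\<Prod>i=1..n. 1 + t * r i)"
      using j(2) True P1 by (intro mult_strict_right_mono) auto
    then have "\<bar>word_num (s * t) \<rho> (Suc n)\<bar> < word_num (s * t) r (Suc n)"
      unfolding word_num_Suc_prod[OF st(1)] using A A' B by linarith
    moreover have "word_den (s * t) r (Suc n) < word_den (s * t) \<rho> (Suc n)"
      if "i \<in> {1..Suc n}" "i \<noteq> j" "0 < r i" for i
    proof (rule D, rule disjI2)
      have "r i \<le> word_num (s * t) r n"
        using that True by (intro word_num_ge[OF st(1) st0 r0]) auto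
      then have "\<bar>\<rho> (Suc n)\<bar> * word_num (s * t) r n < r (Suc n) * word_num (s * t) r n"
        using that j(2) True by (intro mult_strict_right_mono) auto
      then show "\<bar>\<rho> (Suc n)\<bar> * \<bar>word_num (s * t) \<rho> n\<bar> < r (Suc n) * word_num (s * t) r n"
        using mult_left_mono[OF M(1), of "\<bar>\<rho> (Suc n)\<bar>"] by linarith
    qed
    ultimately show ?thesis by blast
  next
    case False
    then have jn: "j \<in> {1..n}" using Suc.prems by auto
    have IH: "\<bar>word_num (s * t) \<rho> n\<bar> < word_num (s * t) r n"
      "\<And>i. i \<in> {1..n} \<Longrightarrow> i \<noteq> j \<Longrightarrow> 0 < r i \<Longrightarrow> word_den (s * t) r n < word_den (s * t) \<rho> n"
      using Suc.IH[OF _ jn] Suc.prems(1) by auto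
    have "0 < 1 + s * r (Suc n)" using rS st0 by (smt (verit) mult_nonneg_nonneg)
    then have "\<bar>word_num (s * t) \<rho> n\<bar> * (1 + s * r (Suc n)) < word_num (s * t) r n * (1 + s * r (Suc n))"
      using IH(1) by (intro mult_strict_right_mono)
    then have "\<bar>word_num (s * t) \<rho> (Suc n)\<bar> < word_num (s * t) r (Suc n)"
      unfolding word_num_Suc_prod[OF st(1)] using A B B' by linarith
    moreover have "word_den (s * t) r (Suc n) < word_den (s * t) \<rho> (Suc n)"
      if i: "i \<in> {1..Suc n}" "i \<noteq> j" "0 < r i" for i
    proof (cases "i = Suc n")
      case True
      show ?thesis
      proof (rule D, rule disjI2)
        have "r (Suc n) * \<bar>word_num (s * t) \<rho> n\<bar> < r (Suc n) * word_num (s * t) r n"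
          using IH(1) i True by (intro mult_strict_left_mono) auto
        then show "\<bar>\<rho> (Suc n)\<bar> * \<bar>word_num (s * t) \<rho> n\<bar> < r (Suc n) * word_num (s * t) r n"
          using mult_right_mono[OF rS, of "\<bar>word_num (s * t) \<rho> n\<bar>"] by linarith
      qed
    next
      case False
      then show ?thesis using IH(2)[of i] i by (intro D) auto
    qed
    ultimately show ?thesis by blast
  qed
qed simp

text \<open>
  \<open>word_sol s t r n j / word_den (s t) r n\<close> is the sum over the words that start with \<open>j\<close>.
\<close>

definition word_sol :: "real \<Rightarrow> real \<Rightarrow> (nat \<Rightarrow> real) \<Rightarrow> nat \<Rightarrow> nat \<Rightarrow> real" where
  "word_sol s t r n j = r j * (\<Prod>i=1..<j. 1 + t * r i) * (\<Prod>i\<in>{j<..n}. 1 + s * r i)"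

lemma word_sol_Suc:
  assumes "j \<in> {1..n}"
  shows "word_sol s t r (Suc n) j = word_sol s t r n j * (1 + s * r (Suc n))"
proof -
  have "{j<..Suc n} = insert (Suc n) {j<..n}" using assms by auto
  then show ?thesis by (simp add: word_sol_def)
qed

lemma word_sol_Suc_self: "word_sol s t r (Suc n) (Suc n) = r (Suc n) * (\<Prod>i=1..n. 1 + t * r i)"
  by (simp add: word_sol_def atLeastLessThanSuc_atLeastAtMost)

lemma sum_word_sol:
  assumes "s + t = 1"
  shows "(\<Sum>j=1..n. word_sol s t r n j) = word_num (s * t) r n"
proof (induction n)
  case (Suc n)
  have "(\<Sum>j=1..n. word_sol s t r (Suc n) j) = (\<Sum>j=1..n. word_sol s t r n j * (1 + s * r (Suc n)))"
    by (rule sum.cong) (auto simp: word_sol_Suc)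
  also have "\<dots> = word_num (s * t) r n * (1 + s * r (Suc n))"
    by (simp only: Suc flip: sum_distrib_right)
  finally show ?case
    unfolding word_num_Suc_prod[OF assms] by (simp add: word_sol_Suc_self)
qed simp

lemma word_sol_system_aux:
  assumes "s + t = 1" "i \<in> {1..n}"
  shows "word_den (s * t) r n + s * (\<Sum>j\<in>{i<..n}. word_sol s t r n j) + t * (\<Sum>j=1..<i. word_sol s t r n j)
    = (\<Prod>j=1..<i. 1 + t * r j) * (\<Prod>j\<in>{i<..n}. 1 + s * r j)"
  using assms(2)
proof (induction n)
  case (Suc n)
  show ?case
  proof (cases "i = Suc n")
    case True
    have "(\<Sum>j=1..<i. word_sol s t r (Suc n) j) = (\<Sum>j=1..n. word_sol s t r n j * (1 + s * r (Suc n)))"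
      unfolding True atLeastLessThanSuc_atLeastAtMost by (intro sum.cong word_sol_Suc) auto
    also have "\<dots> = word_num (s * t) r n * (1 + s * r (Suc n))"
      by (simp only: sum_word_sol[OF assms(1)] flip: sum_distrib_right)
    finally have "(\<Sum>j=1..<i. word_sol s t r (Suc n) j) = word_num (s * t) r n * (1 + s * r (Suc n))" .
    moreover have "(\<Prod>j=1..<i. 1 + t * r j) = word_den (s * t) r n + t * word_num (s * t) r n"
      using True word_den_add_word_num[OF assms(1), of r n] by (simp add: atLeastLessThanSuc_atLeastAtMost)
    ultimately show ?thesis using True by (simp add: algebra_simps)
  next
    case False
    then have i: "i \<in> {1..n}" using Suc.prems by auto
    have ins: "{i<..Suc n} = insert (Suc n) {i<..n}" using i by auto
    have 1: "(\<Sum>j\<in>{i<..Suc n}. word_sol s t r (Suc n) j)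
      = (\<Sum>j\<in>{i<..n}. word_sol s t r n j) * (1 + s * r (Suc n)) + word_sol s t r (Suc n) (Suc n)"
      unfolding ins sum_distrib_right by (subst sum.insert) (auto simp: word_sol_Suc)
    have 2: "(\<Sum>j=1..<i. word_sol s t r (Suc n) j)
      = (\<Sum>j=1..<i. word_sol s t r n j) * (1 + s * r (Suc n))"
      unfolding sum_distrib_right by (rule sum.cong) (use i in \<open>auto simp: word_sol_Suc\<close>)
    have 3: "(\<Prod>j\<in>{i<..Suc n}. 1 + s * r j) = (\<Prod>j\<in>{i<..n}. 1 + s * r j) * (1 + s * r (Suc n))"
      unfolding ins by (subst prod.insert) auto
    show ?thesis
      unfolding 1 2 3 word_sol_Suc_self word_den_add_word_num[OF assms(1), symmetric] mult.assoc[symmetric]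
        Suc.IH[OF i, symmetric]
      by (simp add: algebra_simps)
  qed
qed simp

text \<open>Decomposition by the first run: after a run of i comes nothing, or an ascent of weight s
  to a larger letter, or a descent of weight t to a smaller one. Everything is multiplied by
  \<open>word_den\<close>, so no division occurs.\<close>

lemma word_sol_system:
  assumes "s + t = 1" "i \<in> {1..n}"
  shows "word_sol s t r n i = r i * (word_den (s * t) r n
    + s * (\<Sum>j\<in>{i<..n}. word_sol s t r n j) + t * (\<Sum>j=1..<i. word_sol s t r n j))"
  unfolding word_sol_system_aux[OF assms] by (simp add: word_sol_def)

text \<open>Determines the total of an arbitrary solution by elimination. With the unknown total H
  as a parameter, the tail beyond k is H minus the prefix sum, so the prefix sums follow the
  recursion of \<open>word_num\<close>; at k = n this becomes a linear equation for H.\<close>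

lemma system_sum:
  assumes "s + t = 1"
    and sys: "\<And>i. i \<in> {1..n} \<Longrightarrow>
      y i = r i * (c + s * (\<Sum>j\<in>{i<..n}. y j) + t * (\<Sum>j=1..<i. y j))"
  shows "(\<Sum>j=1..n. y j) * word_den (s * t) r n = c * word_num (s * t) r n"
proof -
  define H where "H = (\<Sum>j=1..n. y j)"
  have "(\<Prod>i=1..k. 1 + s * r i) * (\<Sum>j=1..k. y j) = word_num (s * t) r k * (c + s * H)" if "k \<le> n" for k
    using that
  proof (induction k)
    case (Suc k)
    have "{1..n} = {1..k} \<union> insert (Suc k) {Suc k<..n}" using Suc.prems by auto
    then have "H = (\<Sum>j=1..k. y j) + (\<Sum>j\<in>insert (Suc k) {Suc k<..n}. y j)"
      unfolding H_def by (simp only:) (subst sum.union_disjoint, auto)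
    then have H: "(\<Sum>j\<in>{Suc k<..n}. y j) = H - (\<Sum>j=1..k. y j) - y (Suc k)" by simp
    have "y (Suc k) = r (Suc k) * (c + s * (H - (\<Sum>j=1..k. y j) - y (Suc k)) + t * (\<Sum>j=1..k. y j))"
      using sys[of "Suc k"] Suc.prems unfolding H atLeastLessThanSuc_atLeastAtMost by simp
    then have 1: "(1 + s * r (Suc k)) * ((\<Sum>j=1..k. y j) + y (Suc k))
      = (1 + t * r (Suc k)) * (\<Sum>j=1..k. y j) + r (Suc k) * (c + s * H)"
      by (simp add: algebra_simps)
    have "(\<Prod>i=1..Suc k. 1 + s * r i) * (\<Sum>j=1..Suc k. y j)
      = (\<Prod>i=1..k. 1 + s * r i) * ((1 + s * r (Suc k)) * ((\<Sum>j=1..k. y j) + y (Suc k)))"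
      by simp
    also have "\<dots> = (1 + t * r (Suc k)) * ((\<Prod>i=1..k. 1 + s * r i) * (\<Sum>j=1..k. y j))
      + (\<Prod>i=1..k. 1 + s * r i) * (r (Suc k) * (c + s * H))"
      unfolding 1 by (simp add: algebra_simps)
    also have "\<dots> = ((1 + t * r (Suc k)) * word_num (s * t) r k
        + (word_den (s * t) r k + s * word_num (s * t) r k) * r (Suc k)) * (c + s * H)"
      using Suc by (simp add: word_den_add_rnum'[OF assms(1)] algebra_simps)
    also have "(1 + t * r (Suc k)) * word_num (s * t) r k
        + (word_den (s * t) r k + s * word_num (s * t) r k) * r (Suc k) = word_num (s * t) r (Suc k)"
      unfolding word_num.simps using assms(1) by algebra
    finally show ?case .
  qed simp
  from this[of n] have "(word_den (s * t) r n + s * word_num (s * t) r n) * H = word_num (s * t) r n * (c + s * H)"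
    by (simp add: H_def word_den_add_rnum'[OF assms(1)])
  then show ?thesis unfolding H_def[symmetric] by (simp add: algebra_simps)
qed

section \<open>Coefficients of the Baker--Campbell--Hausdorff series\<close>

lemma nc_mult_one_left [simp]: "nc_mult nc_one f = f"
proof
  fix w
  have "nc_mult nc_one f w = (\<Sum>i\<in>{0}. nc_one (take i w) * f (drop i w))"
    unfolding nc_mult_def by (rule sum.mono_neutral_right) (auto simp: nc_one_def)
  then show "nc_mult nc_one f w = f w" by (simp add: nc_one_def)
qed

lemma nc_mult_one_right [simp]: "nc_mult f nc_one = f"
proof
  fix w
  have "nc_mult f nc_one w = (\<Sum>i\<in>{length w}. f (take i w) * nc_one (drop i w))"
    unfolding nc_mult_def by (rule sum.mono_neutral_right) (auto simp: nc_one_def)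
  then show "nc_mult f nc_one w = f w" by (simp add: nc_one_def)
qed

lemma nc_mult_assoc:
  fixes f g h :: "'a ncfps"
  shows "nc_mult (nc_mult f g) h = nc_mult f (nc_mult g h)"
proof
  fix w :: "'a list"
  let ?n = "length w"
  have "nc_mult (nc_mult f g) h w
    = (\<Sum>i\<le>?n. \<Sum>j\<le>i. f (take j w) * g (take (i - j) (drop j w)) * h (drop i w))"
    unfolding nc_mult_def sum_distrib_right
    by (intro sum.cong refl) (auto simp: drop_take min_absorb2 min_absorb1)
  also have "\<dots> = (\<Sum>(i, j)\<in>(SIGMA i:{..?n}. {..i}).
      f (take j w) * g (take (i - j) (drop j w)) * h (drop i w))"
    by (simp add: sum.Sigma)
  also have "\<dots> = (\<Sum>(j, k)\<in>(SIGMA j:{..?n}. {..?n - j}).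
      f (take j w) * g (take k (drop j w)) * h (drop (j + k) w))"
    by (rule sum.reindex_bij_witness[of _ "\<lambda>(j, k). (j + k, j)" "\<lambda>(i, j). (j, i - j)"]) auto
  also have "\<dots> = (\<Sum>j\<le>?n. \<Sum>k\<le>?n - j. f (take j w) * g (take k (drop j w)) * h (drop (j + k) w))"
    by (simp add: sum.Sigma)
  also have "\<dots> = nc_mult f (nc_mult g h) w"
    by (simp add: nc_mult_def sum_distrib_left mult.assoc add.commute cong: sum.cong)
  finally show "nc_mult (nc_mult f g) h w = nc_mult f (nc_mult g h) w" .
qed

lemma nc_mult_diff_scale_right:
  "nc_mult f (\<lambda>v. g v - c * h v) w = nc_mult f g w - c * nc_mult f h w"
  by (simp add: nc_mult_def sum_subtractf sum_distrib_left algebra_simps)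

lemma nc_mult_diff_left: "nc_mult (\<lambda>v. f v - g v) h w = nc_mult f h w - nc_mult g h w"
  by (simp add: nc_mult_def sum_subtractf algebra_simps)

lemma nc_mult_cong_lists:
  assumes "\<And>v. v \<in> lists S \<Longrightarrow> g v = g' v" "w \<in> lists S"
  shows "nc_mult f g w = nc_mult f g' w"
  unfolding nc_mult_def
  using assms(2) by (intro sum.cong refl arg_cong2[where f = "(*)"] assms(1)) (auto dest: in_set_dropD)

lemma nc_power_commute: "nc_mult (nc_power f k) f = nc_mult f (nc_power f k)"
  by (induction k) (simp_all add: nc_mult_assoc)

text \<open>Substitution of the letter a into a one-variable series; it transfers identities of
  \<open>real fps\<close> to words through \<open>nc_single_mult\<close>.\<close>

definition nc_single :: "'a \<Rightarrow> real fps \<Rightarrow> 'a ncfps" where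
  "nc_single a c w = (if \<forall>x\<in>set w. x = a then fps_nth c (length w) else 0)"

lemma nc_power_var: "nc_power (nc_var a) k w = (if w = replicate k a then 1 else 0)"
proof (induction k arbitrary: w)
  case (Suc k)
  show ?case
  proof (cases w)
    case (Cons x u)
    have "nc_mult (nc_var a) (nc_power (nc_var a) k) w
      = (\<Sum>i\<in>{1}. nc_var a (take i w) * nc_power (nc_var a) k (drop i w))"
      unfolding nc_mult_def
    proof (rule sum.mono_neutral_right)
      show "\<forall>i\<in>{..length w} - {1}. nc_var a (take i w) * nc_power (nc_var a) k (drop i w) = 0"
      proof
        fix i assume "i \<in> {..length w} - {1}"
        then have "length (take i w) \<noteq> 1" by auto
        then have "take i w \<noteq> [a]" by force
        then show "nc_var a (take i w) * nc_power (nc_var a) k (drop i w) = 0"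
          by (simp add: nc_var_def)
      qed
    qed (use Cons in auto)
    then show ?thesis using Cons by (simp add: Suc.IH nc_var_def[of a "[x]"])
  qed (simp add: nc_mult_def nc_var_def)
qed (simp add: nc_one_def)

lemma nc_exp_var: "nc_exp (nc_var a) = nc_single a (fps_exp 1)"
proof
  fix w
  have "nc_exp (nc_var a) w = (\<Sum>k\<in>{length w}. nc_power (nc_var a) k w / fact k)"
    unfolding nc_exp_def by (rule suminf_finite) (auto simp: nc_power_var)
  moreover have "w = replicate (length w) a \<longleftrightarrow> (\<forall>x\<in>set w. x = a)"
    using replicate_eqI[of w "length w" a] by (metis in_set_replicate)
  ultimately show "nc_exp (nc_var a) w = nc_single a (fps_exp 1) w"
    by (simp add: nc_power_var nc_single_def)
qed

lemma nc_single_mult: "nc_mult (nc_single a c) (nc_single a d) = nc_single a (c * d)"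
proof
  fix w
  show "nc_mult (nc_single a c) (nc_single a d) w = nc_single a (c * d) w"
  proof (cases "\<forall>x\<in>set w. x = a")
    case True
    then have sub: "\<forall>x\<in>set (take i w). x = a" "\<forall>x\<in>set (drop i w). x = a" for i
      using set_take_subset[of i w] set_drop_subset[of i w] by blast+
    have single: "nc_single a c (take i w) = fps_nth c (length (take i w))" for i c
      unfolding nc_single_def by (rule if_P[OF sub(1)])
    have "nc_single a d (drop i w) = fps_nth d (length (drop i w))" for i
      unfolding nc_single_def by (rule if_P[OF sub(2)])
    with single have "nc_mult (nc_single a c) (nc_single a d) w
      = (\<Sum>i=0..length w. fps_nth c i * fps_nth d (length w - i))"
      by (simp add: nc_mult_def atMost_atLeast0 min_absorb2)
    then show ?thesis using True by (simp add: nc_single_def fps_mult_nth)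
  next
    case False
    moreover have "set w = set (take i w) \<union> set (drop i w)" for i
      by (simp flip: set_append)
    ultimately have "\<not> (\<forall>x\<in>set (take i w). x = a) \<or> \<not> (\<forall>x\<in>set (drop i w). x = a)" for i
      by blast
    then have "nc_single a c (take i w) * nc_single a d (drop i w) = 0" for i
      by (auto simp: nc_single_def)
    then have "nc_mult (nc_single a c) (nc_single a d) w = 0"
      unfolding nc_mult_def by (intro sum.neutral) blast
    then show ?thesis using False by (auto simp: nc_single_def[of a "c * d"])
  qed
qed

text \<open>Only the cut right after the leading run of a survives: an earlier cut leaves K a word
  starting with a, a later one puts a foreign letter into the left factor.\<close>

lemma nc_single_mult_cut:
  assumes "\<And>v. v \<noteq> [] \<Longrightarrow> hd v = a \<Longrightarrow> K v = 0"
  shows "nc_mult (nc_single a c) K w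
    = fps_nth c (length (takeWhile (\<lambda>x. x = a) w)) * K (dropWhile (\<lambda>x. x = a) w)"
proof -
  let ?m = "length (takeWhile (\<lambda>x. x = a) w)"
  have sum: "nc_mult (nc_single a c) K w = (\<Sum>i\<in>{?m}. nc_single a c (take i w) * K (drop i w))"
    unfolding nc_mult_def
  proof (rule sum.mono_neutral_right)
    show "\<forall>i\<in>{..length w} - {?m}. nc_single a c (take i w) * K (drop i w) = 0"
    proof
      fix i assume i: "i \<in> {..length w} - {?m}"
      show "nc_single a c (take i w) * K (drop i w) = 0"
      proof (cases "i < ?m")
        case True
        then have "w ! i = takeWhile (\<lambda>x. x = a) w ! i" by (rule takeWhile_nth[symmetric])
        then have "w ! i = a" using nth_mem[OF True] by (auto dest: set_takeWhileD)
        moreover have "i < length w" using True length_takeWhile_le[of "\<lambda>x. x = a" w] by linarith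
        ultimately have "K (drop i w) = 0" by (intro assms) (auto simp: hd_drop_conv_nth)
        then show ?thesis by simp
      next
        case False
        then have "?m < i" "?m < length w" using i by auto
        then have "w ! ?m \<noteq> a" "w ! ?m \<in> set (take i w)"
          using nth_length_takeWhile[of "\<lambda>x. x = a" w] by (auto simp: in_set_conv_nth)
        then show ?thesis by (auto simp: nc_single_def)
      qed
    qed
  qed (auto simp: length_takeWhile_le)
  have "take ?m w = takeWhile (\<lambda>x. x = a) w" by (rule takeWhile_eq_take[symmetric])
  then have "\<forall>x\<in>set (take ?m w). x = a" by (auto dest: set_takeWhileD)
  then have "nc_single a c (take ?m w) = fps_nth c (length (take ?m w))"
    unfolding nc_single_def by (rule if_P)
  also have "length (take ?m w) = ?m"
    by (simp add: length_takeWhile_le min_absorb2)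
  finally show ?thesis
    unfolding sum dropWhile_eq_drop by simp
qed

text \<open>
  \<open>run_wt a b \<gamma>\<close> multiplies \<open>\<gamma> i m\<close> over the maximal runs \<open>i\<^sup>m\<close> of a word, \<open>a\<close> over its ascents and
  \<open>b\<close> over its descents; the empty word gets 0.
\<close>

definition step_weight :: "real \<Rightarrow> real \<Rightarrow> ('a::linorder list \<Rightarrow> real) \<Rightarrow> 'a \<Rightarrow> 'a list \<Rightarrow> real" where
  "step_weight a b h i v = (if v = [] then 1 else
     (if i < hd v then a else if hd v < i then b else 0) * h v)"

lemma step_weight_cong [fundef_cong]:
  assumes "a = a'" "b = b'" "i = i'" "v = v'" "v' \<noteq> [] \<Longrightarrow> h v' = h' v'"
  shows "step_weight a b h i v = step_weight a' b' h' i' v'"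
  using assms by (simp add: step_weight_def)

function run_wt :: "real \<Rightarrow> real \<Rightarrow> ('a::linorder \<Rightarrow> nat \<Rightarrow> real) \<Rightarrow> 'a list \<Rightarrow> real" where
  "run_wt a b \<gamma> [] = 0"
| "run_wt a b \<gamma> (i # w) = \<gamma> i (Suc (length (takeWhile (\<lambda>x. x = i) w)))
     * step_weight a b (run_wt a b \<gamma>) i (dropWhile (\<lambda>x. x = i) w)"
  by pat_completeness auto
termination
  by (relation "Wellfounded.measure (\<lambda>(a, b, \<gamma>, w). length w)") (auto simp: le_imp_less_Suc length_dropWhile_le)

lemma run_wt_run:
  assumes "m \<noteq> 0" "v = [] \<or> hd v \<noteq> i"
  shows "run_wt a b \<gamma> (replicate m i @ v) = \<gamma> i m * step_weight a b (run_wt a b \<gamma>) i v"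
proof -
  obtain k where m: "m = Suc k" using assms(1) not0_implies_Suc by blast
  have "takeWhile (\<lambda>x. x = i) v = []" "dropWhile (\<lambda>x. x = i) v = v"
    using assms(2) by (cases v; simp)+
  moreover have "takeWhile (\<lambda>x. x = i) (replicate k i @ v) = replicate k i @ takeWhile (\<lambda>x. x = i) v"
    "dropWhile (\<lambda>x. x = i) (replicate k i @ v) = dropWhile (\<lambda>x. x = i) v"
    by (induction k) auto
  ultimately show ?thesis by (simp add: m)
qed

text \<open>This multiplicativity splits off the powers of x and, later, a whole pattern of signs,
  without leaving the class of run weights.\<close>

lemma run_wt_mult:
  assumes "w \<noteq> []"
  shows "run_wt (a * a') (b * b') (\<lambda>i m. \<gamma> i m * \<gamma>' i m) w = run_wt a b \<gamma> w * run_wt a' b' \<gamma>' w"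
  using assms
proof (induction w rule: length_induct)
  case (1 w)
  then obtain i u where w: "w = i # u" by (cases w) auto
  define v where "v = dropWhile (\<lambda>x. x = i) u"
  have "length v < length w" by (simp add: w v_def le_imp_less_Suc length_dropWhile_le)
  then have "v \<noteq> [] \<Longrightarrow> run_wt (a * a') (b * b') (\<lambda>i m. \<gamma> i m * \<gamma>' i m) v = run_wt a b \<gamma> v * run_wt a' b' \<gamma>' v"
    using 1 by blast
  then show ?case by (simp add: w v_def[symmetric] step_weight_def)
qed

lemma abs_run_wt: "\<bar>run_wt a b \<gamma> w\<bar> = run_wt \<bar>a\<bar> \<bar>b\<bar> (\<lambda>i m. \<bar>\<gamma> i m\<bar>) w"
proof (induction w rule: length_induct)
  case (1 w)
  show ?case
  proof (cases w)
    case (Cons i u)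
    define v where "v = dropWhile (\<lambda>x. x = i) u"
    have "length v < length w" by (simp add: Cons v_def le_imp_less_Suc length_dropWhile_le)
    then have "\<bar>run_wt a b \<gamma> v\<bar> = run_wt \<bar>a\<bar> \<bar>b\<bar> (\<lambda>i m. \<bar>\<gamma> i m\<bar>) v" using 1 by blast
    then show ?thesis by (simp add: Cons v_def[symmetric] step_weight_def abs_mult)
  qed simp
qed

lemma run_wt_nonneg:
  assumes "0 \<le> a" "0 \<le> b" "\<And>i m. 0 \<le> \<gamma> i m"
  shows "0 \<le> run_wt a b \<gamma> w"
  using abs_run_wt[of a b \<gamma> w] assms by simp

lemma run_wt_power:
  assumes "w \<noteq> []"
  shows "run_wt 1 1 (\<lambda>i m. x i ^ m) w = prod_list (map x w)"
  using assms
proof (induction w rule: length_induct)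
  case (1 w)
  then obtain i u where w: "w = i # u" by (cases w) auto
  define v m where "v = dropWhile (\<lambda>x. x = i) u" and "m = length (takeWhile (\<lambda>x. x = i) u)"
  have len: "length v < length w" by (simp add: w v_def le_imp_less_Suc length_dropWhile_le)
  have "takeWhile (\<lambda>x. x = i) u = replicate m i"
    unfolding m_def by (rule replicate_eqI) (auto dest: set_takeWhileD)
  then have "u = replicate m i @ v"
    unfolding v_def by (metis takeWhile_dropWhile_id)
  then have p: "prod_list (map x u) = x i ^ m * prod_list (map x v)"
    by simp
  have hd: "v \<noteq> [] \<Longrightarrow> hd v \<noteq> i" using hd_dropWhile[of "\<lambda>x. x = i" u] by (simp add: v_def)
  have "step_weight 1 1 (run_wt 1 1 (\<lambda>i m. x i ^ m)) i v = prod_list (map x v)"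
  proof (cases "v = []")
    case False
    then have "run_wt 1 1 (\<lambda>i m. x i ^ m) v = prod_list (map x v)" using 1(1) len by blast
    then show ?thesis using False hd by (auto simp: step_weight_def)
  qed (simp add: step_weight_def)
  then show ?case by (simp add: w m_def[symmetric] v_def[symmetric] p)
qed

lemma run_wt_mult_power:
  "run_wt a b (\<lambda>i m. \<gamma> i m * x i ^ m) w = run_wt a b \<gamma> w * prod_list (map x w)"
proof (cases "w = []")
  case False
  then show ?thesis using run_wt_mult[OF False, of a 1 b 1 \<gamma> "\<lambda>i m. x i ^ m"] by (simp add: run_wt_power)
qed simp

text \<open>
  The series of \<open>(A - 1) / (1 + t (A - 1))\<close> at \<open>A = exp X\<close>. Its integral over \<open>t\<close> from 0 to 1 is the logarithm
  of \<open>A\<close>, and the same holds for \<open>A = exp X\<^sub>1 \<dots> exp X\<^sub>n\<close>.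
\<close>

definition res_fps :: "real \<Rightarrow> real fps" where
  "res_fps t = (fps_exp 1 - 1) * inverse (1 + fps_const t * (fps_exp 1 - 1))"

lemma res_fps_mult: "res_fps t * (1 + fps_const t * (fps_exp 1 - 1)) = fps_exp 1 - 1"
  unfolding res_fps_def mult.assoc by (subst inverse_mult_eq_1) auto

lemma res_fps_0 [simp]: "fps_nth (res_fps t) 0 = 0"
  using arg_cong[OF res_fps_mult[of t], of "\<lambda>f. fps_nth f 0"] by simp

lemma res_fps_1 [simp]: "fps_nth (res_fps t) (Suc 0) = 1"
  using arg_cong[OF res_fps_mult[of t], of "\<lambda>f. fps_nth f 1"] by (simp add: fps_mult_nth)

lemma fps_exp_mult_res_fps:
  "fps_exp 1 * (1 - fps_const t * res_fps t) = 1 + fps_const (1 - t) * res_fps t"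
proof -
  have c: "fps_const (1 - t) = 1 - fps_const t" by (simp flip: fps_const_sub)
  have "res_fps t + fps_const t * res_fps t * fps_exp 1 - fps_const t * res_fps t = fps_exp 1 - 1"
    using res_fps_mult[of t] by (simp add: algebra_simps)
  then show ?thesis unfolding c by (simp add: algebra_simps)
qed

text \<open>
  If \<open>F\<close> is the resolvent of \<open>A = exp X\<^sub>1 \<dots> exp X\<^sub>n\<close>, then \<open>A (1 - t F) = 1 + (1 - t) F\<close>. The series
  \<open>shift_series t i\<close> interpolate between \<open>1 + (1 - t) F\<close> for \<open>i = 1\<close> and \<open>1 - t F\<close> for \<open>i = n + 1\<close>, so that
  one exponential is absorbed at a time.
\<close>

definition shift_series :: "real \<Rightarrow> nat \<Rightarrow> nat ncfps" where
  "shift_series t i w = (if w = [] then 1 else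
     (if i \<le> hd w then 1 - t else - t) * run_wt (1 - t) (- t) (\<lambda>_. fps_nth (res_fps t)) w)"

text \<open>The two series differ only on words starting with i, where the factor is - t or 1 - t.
  Both are therefore a one-letter series in i times the same K, and the claim reduces to the
  one-letter identity \<open>fps_exp_mult_res_fps\<close>.\<close>

lemma nc_exp_mult_shift_series: "nc_mult (nc_exp (nc_var i)) (shift_series t (Suc i)) = shift_series t i"
proof -
  define F where "F = run_wt (1 - t) (- t) (\<lambda>_::nat. fps_nth (res_fps t))"
  define K where "K = step_weight (1 - t) (- t) F i"
  \<comment> \<open>The value 0 of \<open>step_weight\<close> at equal letters is what makes K fit
    \<open>nc_single_mult_cut\<close>.\<close>
  have K: "K v = 0" if "v \<noteq> []" "hd v = i" for v
    using that by (simp add: K_def step_weight_def)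
  have cut: "nc_mult (nc_single i (1 + fps_const c * res_fps t)) K w = (if w \<noteq> [] \<and> hd w = i then c * F w else K w)"
    for w c
  proof (cases "w \<noteq> [] \<and> hd w = i")
    case True
    then obtain u where w: "w = i # u" by (cases w) auto
    show ?thesis by (simp add: nc_single_mult_cut[OF K] w) (simp add: F_def K_def)
  next
    case False
    then have "takeWhile (\<lambda>x. x = i) w = []" "dropWhile (\<lambda>x. x = i) w = w"
      by (cases w; simp)+
    then show ?thesis using False by (auto simp: nc_single_mult_cut[OF K])
  qed
  have 1: "shift_series t (Suc i) = nc_mult (nc_single i (1 + fps_const (- t) * res_fps t)) K"
    unfolding fun_eq_iff cut by (auto simp: shift_series_def F_def[symmetric] K_def step_weight_def)
  have 2: "shift_series t i = nc_mult (nc_single i (1 + fps_const (1 - t) * res_fps t)) K"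
    unfolding fun_eq_iff cut by (auto simp: shift_series_def F_def[symmetric] K_def step_weight_def)
  have "fps_exp 1 * (1 + fps_const (- t) * res_fps t) = 1 + fps_const (1 - t) * res_fps t"
    using fps_exp_mult_res_fps[of t] by (simp flip: fps_const_neg)
  then show ?thesis
    unfolding 1 2 nc_exp_var nc_mult_assoc[symmetric] nc_single_mult by simp
qed

lemma nc_exps_mult_shift_series:
  assumes "i \<le> Suc n"
  shows "nc_mult (foldr nc_mult (map (\<lambda>i. nc_exp (nc_var i)) [i..<Suc n]) nc_one) (shift_series t (Suc n)) = shift_series t i"
  using assms
proof (induction rule: inc_induct)
  case (step k)
  then have "[k..<Suc n] = k # [Suc k..<Suc n]" by (simp add: upt_conv_Cons)
  then show ?case using step.IH by (simp add: nc_mult_assoc nc_exp_mult_shift_series del: upt_Suc)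
qed simp

text \<open>On words over 1..n the resolvent equation F = U - t U F holds for U = exp X_1 ... exp
  X_n - 1. Iterating it gives a Neumann series that stops at the length of the word, because U has
  no constant term.\<close>

lemma run_wt_eq_sum_powers:
  fixes t :: real
  defines "U \<equiv> (\<lambda>n v. foldr nc_mult (map (\<lambda>i. nc_exp (nc_var i)) [1..<Suc n]) nc_one v - nc_one v)"
  assumes w: "w \<in> lists {1..n}"
  shows "run_wt (1 - t) (- t) (\<lambda>_. fps_nth (res_fps t)) w
    = (\<Sum>k\<le>length w. (- t) ^ k * nc_power (U n) (Suc k) w)"
proof -
  define A where "A = foldr nc_mult (map (\<lambda>i. nc_exp (nc_var i)) [1..<Suc n]) nc_one"
  define F where "F = run_wt (1 - t) (- t) (\<lambda>_::nat. fps_nth (res_fps t))"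
  have F0: "F [] = 0" by (simp add: F_def)
  have U: "U n = (\<lambda>v. A v - nc_one v)" by (simp add: U_def A_def)
  have AL: "nc_mult A (shift_series t (Suc n)) = shift_series t 1"
    unfolding A_def by (rule nc_exps_mult_shift_series) simp
  have "A [] = 1"
    using fun_cong[OF AL, of "[]"] by (simp add: nc_mult_def shift_series_def)
  then have U0: "U n [] = 0" by (simp add: U nc_one_def)
  have FU: "F v = U n v - t * nc_mult (U n) F v" if v: "v \<in> lists {1..n}" for v
  proof -
    \<comment> \<open>All letters are below n + 1, so this end of the interpolation is 1 - t F; they
      are all at least 1, so the other end is 1 + (1 - t) F.\<close>
    have "shift_series t (Suc n) u = nc_one u - t * F u" if "u \<in> lists {1..n}" for u
    proof (cases "u = []")
      case False
      then have "hd u \<in> {1..n}" using that hd_in_set[of u] by auto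
      then show ?thesis using False by (simp add: shift_series_def F_def[symmetric] nc_one_def)
    qed (simp add: shift_series_def F0 nc_one_def)
    then have "shift_series t 1 v = nc_mult A (\<lambda>u. nc_one u - t * F u) v"
      unfolding AL[symmetric] using v by (rule nc_mult_cong_lists)
    moreover have "shift_series t 1 v = nc_one v + (1 - t) * F v"
      using v by (cases v) (auto simp: shift_series_def F_def nc_one_def)
    ultimately show ?thesis
      by (simp add: U nc_mult_diff_scale_right nc_mult_diff_left algebra_simps)
  qed
  have exp: "F w = (\<Sum>k\<le>m. (- t) ^ k * nc_power (U n) (Suc k) w)
      + (- t) ^ Suc m * nc_mult (nc_power (U n) (Suc m)) F w" for m
  proof (induction m)
    case 0
    then show ?case using FU[OF w] by simp
  next
    case (Suc m)
    have "nc_mult (nc_power (U n) (Suc m)) F w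
      = nc_mult (nc_power (U n) (Suc m)) (\<lambda>v. U n v - t * nc_mult (U n) F v) w"
      using FU w by (rule nc_mult_cong_lists)
    also have "\<dots> = nc_power (U n) (Suc (Suc m)) w - t * nc_mult (nc_power (U n) (Suc (Suc m))) F w"
    proof -
      have "nc_mult (nc_power (U n) (Suc m)) (nc_mult (U n) F) = nc_mult (nc_power (U n) (Suc (Suc m))) F"
        unfolding nc_power.simps(2)[of "U n" "Suc m"] nc_power_commute[symmetric] nc_mult_assoc ..
      then show ?thesis
        unfolding nc_mult_diff_scale_right by (simp only: nc_power.simps(2)[of "U n" "Suc m"] nc_power_commute)
    qed
    finally have eq: "nc_mult (nc_power (U n) (Suc m)) F w
      = nc_power (U n) (Suc (Suc m)) w - t * nc_mult (nc_power (U n) (Suc (Suc m))) F w" .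
    have "(- t) ^ Suc m * (a - t * b) = (- t) ^ Suc m * a + (- t) ^ Suc (Suc m) * b" for a b
      by (simp add: algebra_simps)
    then show ?case unfolding Suc eq sum.atMost_Suc by (simp only: add.assoc)
  qed
  have "nc_mult (nc_power (U n) (Suc (length w))) F w = 0"
    unfolding nc_mult_def by (intro sum.neutral ballI) (simp add: nc_power_eq_0[of "U n"] U0 del: nc_power.simps)
  then show ?thesis using exp[of "length w"] unfolding F_def[symmetric] by (simp only: mult_zero_right add_0_right)
qed

text \<open>Termwise integration of the Neumann series turns (- t)^k into (- 1)^k / (k + 1), the
  coefficients of the logarithm.\<close>

lemma bch_has_integral:
  assumes w: "w \<in> lists {1..n}"
  shows "((\<lambda>t. run_wt (1 - t) (- t) (\<lambda>_. fps_nth (res_fps t)) w) has_integral bch n w) {0..1}"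
proof -
  define U where "U = (\<lambda>v. foldr nc_mult (map (\<lambda>i. nc_exp (nc_var i)) [1..<Suc n]) nc_one v - nc_one v)"
  have eq: "run_wt (1 - t) (- t) (\<lambda>_. fps_nth (res_fps t)) w
    = (\<Sum>k\<le>length w. (- t) ^ k * nc_power U (Suc k) w)" for t
    using run_wt_eq_sum_powers[OF w, of t] by (simp add: U_def)
  have "[] \<in> lists {1..n}" by simp
  from run_wt_eq_sum_powers[OF this, of 0] have "nc_mult U nc_one [] = 0"
    unfolding U_def[symmetric] by simp
  then have U0: "U [] = 0" by simp
  have "bch n w = (\<Sum>k\<le>length w. (- 1) ^ k / real (Suc k) * nc_power U (Suc k) w)"
    unfolding bch_def nc_log_def U_def[symmetric]
    by (rule suminf_finite) (auto simp: nc_power_eq_0[of U] U0 simp del: nc_power.simps)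
  moreover have "((\<lambda>t. (- t) ^ k * c) has_integral (- 1) ^ k / real (Suc k) * c) {0..1}"
    for k and c :: real
  proof -
    define a where "a = (- 1) ^ k / real (Suc k) * c"
    have "((\<lambda>t. (- t) ^ k * c) has_integral (a * 1 ^ Suc k - a * 0 ^ Suc k)) {0..1}"
    proof (rule fundamental_theorem_of_calculus)
      fix t :: real
      have "((\<lambda>t. a * t ^ Suc k) has_field_derivative a * (real (Suc k) * t ^ k)) (at t within {0..1})"
        using DERIV_cmult[OF DERIV_pow[of "Suc k" t "{0..1}"], of a] by simp
      moreover have "a * (real (Suc k) * t ^ k) = (- t) ^ k * c"
        by (simp add: a_def power_minus[of t] del: of_nat_Suc)
      ultimately show "((\<lambda>t. a * t ^ Suc k) has_vector_derivative (- t) ^ k * c) (at t within {0..1})"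
        by (simp add: has_real_derivative_iff_has_vector_derivative)
    qed simp
    then show ?thesis by (simp add: a_def)
  qed
  ultimately show ?thesis unfolding eq by (auto intro!: has_integral_sum)
qed

section \<open>Summation over words\<close>

definition words_from :: "nat \<Rightarrow> nat \<Rightarrow> nat list set" where
  "words_from n i = {w \<in> lists {1..n}. w \<noteq> [] \<and> hd w = i}"

lemma finite_lists_length_le': "finite {w \<in> lists {1..n::nat}. length w \<le> L}"
  using finite_lists_length_le[of "{1..n}" L] by (simp add: lists_eq_set conj_commute)

text \<open>No convergence is known beforehand, so the linear system is used as an inequality: by
  induction on the length bound L, the truncated sums over words starting with i stay below the
  solution v i, which is nonnegative because the denominator is positive.\<close>

lemma run_wt_sum_bounded:
  assumes st: "s + t = 1" "0 \<le> s" "0 \<le> t"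
    and \<gamma>: "\<And>i m. 0 \<le> \<gamma> i m" "\<And>i. i \<in> {1..n} \<Longrightarrow> summable (\<gamma> i)"
    and den: "0 < word_den (s * t) (\<lambda>i. suminf (\<gamma> i)) n"
    and W: "finite W" "W \<subseteq> lists {1..n}"
  shows "sum (run_wt s t \<gamma>) W \<le> word_num (s * t) (\<lambda>i. suminf (\<gamma> i)) n / word_den (s * t) (\<lambda>i. suminf (\<gamma> i)) n"
proof -
  define r where "r i = suminf (\<gamma> i)" for i
  define D where "D = word_den (s * t) r n"
  define v where "v i = word_sol s t r n i / D" for i
  define WL where "WL L i = {w \<in> words_from n i. length w \<le> L}" for L i
  define Y where "Y L i = sum (run_wt s t \<gamma>) (WL L i)" for L i
  have D: "0 < D" using den by (simp add: D_def r_def[abs_def])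
  have r0: "0 \<le> r i" if "i \<in> {1..n}" for i
    unfolding r_def using \<gamma> that by (intro suminf_nonneg) auto
  have v0: "0 \<le> v i" if "i \<in> {1..n}" for i
    unfolding v_def word_sol_def using D r0 that st
    by (intro divide_nonneg_pos mult_nonneg_nonneg prod_nonneg) auto
  have v: "v i = r i * (1 + s * (\<Sum>j\<in>{i<..n}. v j) + t * (\<Sum>j=1..<i. v j))" if "i \<in> {1..n}" for i
    unfolding v_def using word_sol_system[OF st(1) that, of r] D
    by (simp add: D_def[symmetric] field_simps flip: sum_divide_distrib)
  have wt0: "0 \<le> run_wt s t \<gamma> w" for w by (intro run_wt_nonneg st \<gamma>)
  have sw0: "0 \<le> step_weight s t (run_wt s t \<gamma>) i w" for i w
    using st wt0 by (auto simp: step_weight_def)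
  have fin: "finite (WL L i)" for L i
    by (rule finite_subset[OF _ finite_lists_length_le'[of n L]]) (auto simp: WL_def words_from_def)
  have Yv: "\<forall>i\<in>{1..n}. Y L i \<le> v i" for L
  proof (induction L)
    case 0
    have "WL 0 i = {}" for i by (auto simp: WL_def words_from_def)
    then show ?case using v0 by (simp add: Y_def)
  next
    case (Suc L)
    show ?case
    proof
      fix i assume i: "i \<in> {1..n}"
      define V where "V = {u \<in> lists {1..n}. (u = [] \<or> hd u \<noteq> i) \<and> length u \<le> L}"
      have finV: "finite V"
        by (rule finite_subset[OF _ finite_lists_length_le'[of n L]]) (auto simp: V_def)
      \<comment> \<open>Cutting off the nonempty first run leaves length at most L. The product set
        may also contain longer words, which is harmless for nonnegative weights.\<close>
      have sub: "WL (Suc L) i \<subseteq> (\<lambda>(m, u). replicate m i @ u) ` ({1..Suc L} \<times> V)"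
      proof
        fix w assume w: "w \<in> WL (Suc L) i"
        define m u where "m = length (takeWhile (\<lambda>x. x = i) w)" and "u = dropWhile (\<lambda>x. x = i) w"
        have "takeWhile (\<lambda>x. x = i) w = replicate m i"
          unfolding m_def by (rule replicate_eqI) (auto dest: set_takeWhileD)
        then have eq: "w = replicate m i @ u" unfolding u_def by (metis takeWhile_dropWhile_id)
        have hd: "u \<noteq> [] \<Longrightarrow> hd u \<noteq> i" using hd_dropWhile[of "\<lambda>x. x = i" w] by (simp add: u_def)
        have ne: "w \<noteq> []" "hd w = i" "w \<in> lists {1..n}" "length w \<le> Suc L"
          using w by (auto simp: WL_def words_from_def)
        have m: "m \<noteq> 0" using ne eq hd by (cases m) auto
        have len: "m + length u = length w" using arg_cong[OF eq, of length] by simp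
        have "u \<in> lists {1..n}" using ne(3) eq by (metis append_in_lists_conv)
        then have "(m, u) \<in> {1..Suc L} \<times> V" using m len ne hd by (auto simp: V_def)
        then show "w \<in> (\<lambda>(m, u). replicate m i @ u) ` ({1..Suc L} \<times> V)"
          by (intro image_eqI[where x = "(m, u)"]) (simp_all add: eq)
      qed
      have "Y (Suc L) i \<le> sum (run_wt s t \<gamma>) ((\<lambda>(m, u). replicate m i @ u) ` ({1..Suc L} \<times> V))"
        unfolding Y_def using finV by (intro sum_mono2 sub wt0) auto
      also have "\<dots> \<le> sum (run_wt s t \<gamma> \<circ> (\<lambda>(m, u). replicate m i @ u)) ({1..Suc L} \<times> V)"
        using finV by (intro sum_image_le wt0) auto
      also have "\<dots> = (\<Sum>(m, u)\<in>{1..Suc L} \<times> V. \<gamma> i m * step_weight s t (run_wt s t \<gamma>) i u)"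
        by (intro sum.cong refl) (auto simp: V_def run_wt_run run_wt_run[where v = "[]", simplified])
      also have "\<dots> = sum (\<gamma> i) {1..Suc L} * sum (step_weight s t (run_wt s t \<gamma>) i) V"
        unfolding sum_product sum.cartesian_product ..
      also have "\<dots> \<le> r i * sum (step_weight s t (run_wt s t \<gamma>) i) V"
        unfolding r_def using \<gamma> i
        by (intro mult_right_mono sum_le_suminf sum_nonneg sw0) auto
      also have "sum (step_weight s t (run_wt s t \<gamma>) i) V
        = 1 + s * (\<Sum>j\<in>{i<..n}. Y L j) + t * (\<Sum>j=1..<i. Y L j)"
      proof -
        have "w \<in> V \<longleftrightarrow> w \<in> insert [] (\<Union>j\<in>{1..n} - {i}. WL L j)" for w
          by (cases w) (auto simp: V_def WL_def words_from_def)
        then have Veq: "V = insert [] (\<Union>j\<in>{1..n} - {i}. WL L j)" by blast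
        have nil: "[] \<notin> (\<Union>j\<in>{1..n} - {i}. WL L j)" by (auto simp: WL_def words_from_def)
        have sw: "sum (step_weight s t (run_wt s t \<gamma>) i) (WL L j) = (if i < j then s else if j < i then t else 0) * Y L j" for j
          unfolding Y_def sum_distrib_left
          by (intro sum.cong refl) (auto simp: WL_def words_from_def step_weight_def)
        have "sum (step_weight s t (run_wt s t \<gamma>) i) V
          = 1 + sum (step_weight s t (run_wt s t \<gamma>) i) (\<Union>j\<in>{1..n} - {i}. WL L j)"
          unfolding Veq using fin nil by (subst sum.insert) (auto simp: step_weight_def)
        also have "sum (step_weight s t (run_wt s t \<gamma>) i) (\<Union>j\<in>{1..n} - {i}. WL L j)
          = (\<Sum>j\<in>{1..n} - {i}. sum (step_weight s t (run_wt s t \<gamma>) i) (WL L j))"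
          using fin by (intro sum.UNION_disjoint) (auto simp: WL_def words_from_def)
        also have "\<dots> = (\<Sum>j\<in>{i<..n} \<union> {1..<i}. (if i < j then s else if j < i then t else 0) * Y L j)"
          unfolding sw using i by (intro sum.cong) auto
        also have "\<dots> = s * (\<Sum>j\<in>{i<..n}. Y L j) + t * (\<Sum>j=1..<i. Y L j)"
          by (subst sum.union_disjoint) (auto simp: sum_distrib_left)
        finally show ?thesis by simp
      qed
      also have "r i * (1 + s * (\<Sum>j\<in>{i<..n}. Y L j) + t * (\<Sum>j=1..<i. Y L j))
        \<le> r i * (1 + s * (\<Sum>j\<in>{i<..n}. v j) + t * (\<Sum>j=1..<i. v j))"
        using Suc i r0 st by (intro mult_left_mono add_mono sum_mono order_refl) auto
      finally show "Y (Suc L) i \<le> v i" using v[OF i] by simp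
    qed
  qed
  obtain L where L: "\<And>w. w \<in> W \<Longrightarrow> length w \<le> L"
    using W(1) by (metis finite_imageI finite_nat_set_iff_bounded_le image_eqI)
  have "W \<subseteq> insert [] (\<Union>j\<in>{1..n}. WL L j)"
  proof
    fix w assume "w \<in> W"
    then show "w \<in> insert [] (\<Union>j\<in>{1..n}. WL L j)"
      using L[of w] W(2) by (cases w) (auto simp: WL_def words_from_def)
  qed
  then have "sum (run_wt s t \<gamma>) W \<le> sum (run_wt s t \<gamma>) (insert [] (\<Union>j\<in>{1..n}. WL L j))"
    using fin by (intro sum_mono2 wt0) auto
  also have "\<dots> = sum (run_wt s t \<gamma>) (\<Union>j\<in>{1..n}. WL L j)"
    using fin by (subst sum.insert_if) auto
  also have "\<dots> = (\<Sum>j=1..n. Y L j)"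
    unfolding Y_def using fin by (intro sum.UNION_disjoint) (auto simp: WL_def words_from_def)
  also have "\<dots> \<le> (\<Sum>j=1..n. v j)" using Yv by (intro sum_mono) auto
  also have "\<dots> = word_num (s * t) r n / D"
    unfolding v_def sum_divide_distrib[symmetric] sum_word_sol[OF st(1)] ..
  finally show ?thesis by (simp add: D_def r_def[abs_def])
qed

lemma bij_betw_runs:
  "bij_betw (\<lambda>(m, u). replicate m i @ u)
    ({m. m \<noteq> 0} \<times> {u \<in> lists {1..n}. u = [] \<or> hd u \<noteq> i}) (words_from n i)"
  if i: "i \<in> {1..n}"
proof (rule bij_betw_byWitness[where f' = "\<lambda>w. (length (takeWhile (\<lambda>x. x = i) w), dropWhile (\<lambda>x. x = i) w)"])
  have *: "takeWhile (\<lambda>x. x = i) (replicate m i @ u) = replicate m i \<and>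
    dropWhile (\<lambda>x. x = i) (replicate m i @ u) = u" if "u = [] \<or> hd u \<noteq> i" for m u
  proof -
    have "takeWhile (\<lambda>x. x = i) u = []" "dropWhile (\<lambda>x. x = i) u = u"
      using that by (cases u; simp)+
    then show ?thesis by (induction m) auto
  qed
  show "\<forall>a\<in>{m. m \<noteq> 0} \<times> {u \<in> lists {1..n}. u = [] \<or> hd u \<noteq> i}.
     (length (takeWhile (\<lambda>x. x = i) (case a of (m, u) \<Rightarrow> replicate m i @ u)),
      dropWhile (\<lambda>x. x = i) (case a of (m, u) \<Rightarrow> replicate m i @ u)) = a"
    using * by auto
  have repl: "replicate (length (takeWhile (\<lambda>x. x = i) w)) i = takeWhile (\<lambda>x. x = i) w" for w
    by (rule replicate_eqI[symmetric]) (auto dest: set_takeWhileD)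
  then show "\<forall>w\<in>words_from n i. (case (length (takeWhile (\<lambda>x. x = i) w), dropWhile (\<lambda>x. x = i) w)
     of (m, u) \<Rightarrow> replicate m i @ u) = w"
    by simp
  show "(\<lambda>(m, u). replicate m i @ u) ` ({m. m \<noteq> 0} \<times> {u \<in> lists {1..n}. u = [] \<or> hd u \<noteq> i})
    \<subseteq> words_from n i"
    using i by (auto simp: words_from_def hd_append)
  show "(\<lambda>w. (length (takeWhile (\<lambda>x. x = i) w), dropWhile (\<lambda>x. x = i) w)) ` words_from n i
    \<subseteq> {m. m \<noteq> 0} \<times> {u \<in> lists {1..n}. u = [] \<or> hd u \<noteq> i}"
  proof (rule image_subsetI)
    fix w assume w: "w \<in> words_from n i"
    then have "takeWhile (\<lambda>x. x = i) w \<noteq> []" by (cases w) (auto simp: words_from_def)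
    moreover have "dropWhile (\<lambda>x. x = i) w \<in> lists {1..n}"
      using w by (auto simp: words_from_def dest: set_dropWhileD)
    ultimately show "(length (takeWhile (\<lambda>x. x = i) w), dropWhile (\<lambda>x. x = i) w)
      \<in> {m. m \<noteq> 0} \<times> {u \<in> lists {1..n}. u = [] \<or> hd u \<noteq> i}"
      using hd_dropWhile[of "\<lambda>x. x = i" w] by auto
  qed
qed

text \<open>Counterpart of \<open>run_wt_sum_bounded\<close> for signed coefficients: with
  summability given, the sums by first letter satisfy the linear system exactly, and
  \<open>system_sum\<close> yields the total.\<close>

lemma run_wt_infsum:
  assumes st: "s + t = 1"
    and \<gamma>: "\<And>i. \<gamma> i 0 = 0" "\<And>i. i \<in> {1..n} \<Longrightarrow> summable (\<lambda>m. \<bar>\<gamma> i m\<bar>)"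
    and sum: "run_wt s t \<gamma> summable_on lists {1..n}"
  shows "infsum (run_wt s t \<gamma>) (lists {1..n}) * word_den (s * t) (\<lambda>i. suminf (\<gamma> i)) n
    = word_num (s * t) (\<lambda>i. suminf (\<gamma> i)) n"
proof -
  define y where "y i = infsum (run_wt s t \<gamma>) (words_from n i)" for i
  have summ: "run_wt s t \<gamma> summable_on words_from n i" for i
    by (rule summable_on_subset[OF sum]) (auto simp: words_from_def)
  have y: "(run_wt s t \<gamma> has_sum y i) (words_from n i)" for i
    unfolding y_def using summ by (rule has_sum_infsum)
  have disj: "words_from n i \<inter> words_from n j = {}" if "i \<noteq> j" for i j
    using that by (auto simp: words_from_def)
  have sys: "y i = suminf (\<gamma> i) * (1 + s * (\<Sum>j\<in>{i<..n}. y j) + t * (\<Sum>j=1..<i. y j))"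
    if i: "i \<in> {1..n}" for i
  proof -
    define V where "V = {u \<in> lists {1..n}. u = [] \<or> hd u \<noteq> i}"
    define f where "f = step_weight s t (run_wt s t \<gamma>) i"
    have fst: "((\<lambda>(m, u). \<gamma> i m * f u) has_sum y i) ({m. m \<noteq> 0} \<times> V)"
    proof -
      have "((\<lambda>a. run_wt s t \<gamma> (case a of (m, u) \<Rightarrow> replicate m i @ u)) has_sum y i) ({m. m \<noteq> 0} \<times> V)"
        unfolding V_def by (subst has_sum_reindex_bij_betw[OF bij_betw_runs[OF i]]) (rule y)
      then show ?thesis
        by (rule has_sum_cong[THEN iffD1, rotated]) (auto simp: V_def f_def run_wt_run run_wt_run[where v = "[]", simplified])
    qed
    have "w \<in> V \<longleftrightarrow> w \<in> {[]} \<union> (\<Union>j\<in>{1..n} - {i}. words_from n j)" for w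
      by (cases w) (auto simp: V_def words_from_def)
    then have Veq: "V = {[]} \<union> (\<Union>j\<in>{1..n} - {i}. words_from n j)" by blast
    have "(f has_sum ((if i < j then s else if j < i then t else 0) * y j)) (words_from n j)" for j
      by (rule has_sum_cong[THEN iffD1, OF _ has_sum_cmult_right[OF y]])
        (auto simp: words_from_def f_def step_weight_def)
    then have "(f has_sum (\<Sum>j\<in>{1..n} - {i}. (if i < j then s else if j < i then t else 0) * y j))
      (\<Union>j\<in>{1..n} - {i}. words_from n j)"
      using disj by (intro sum_has_sum) auto
    moreover have "(f has_sum 1) {[]}"
      using has_sum_finite[of "{[]}" f] by (simp add: f_def step_weight_def)
    ultimately have "(f has_sum (1 + (\<Sum>j\<in>{1..n} - {i}. (if i < j then s else if j < i then t else 0) * y j))) V"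
      unfolding Veq by (intro has_sum_Un_disjoint) (auto simp: words_from_def)
    moreover have "(\<Sum>j\<in>{1..n} - {i}. (if i < j then s else if j < i then t else 0) * y j)
      = (\<Sum>j\<in>{i<..n} \<union> {1..<i}. (if i < j then s else if j < i then t else 0) * y j)"
      using i by (intro sum.cong) auto
    moreover have "\<dots> = s * (\<Sum>j\<in>{i<..n}. y j) + t * (\<Sum>j=1..<i. y j)"
      by (subst sum.union_disjoint) (auto simp: sum_distrib_left)
    ultimately have fV: "infsum f V = 1 + s * (\<Sum>j\<in>{i<..n}. y j) + t * (\<Sum>j=1..<i. y j)"
      by (simp add: infsumI add.assoc)
    have "summable (\<gamma> i)" using \<gamma>(2)[OF i] by (rule summable_rabs_cancel)
    then have "(\<gamma> i has_sum suminf (\<gamma> i)) UNIV"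
      using \<gamma>(2)[OF i] by (intro norm_summable_imp_has_sum) (auto simp: summable_sums)
    then have "(\<gamma> i has_sum suminf (\<gamma> i)) {m. m \<noteq> 0}"
      by (rule has_sum_cong_neutral[THEN iffD1, rotated -1]) (auto simp: \<gamma>(1))
    then have g: "infsum (\<gamma> i) {m. m \<noteq> 0} = suminf (\<gamma> i)" by (rule infsumI)
    have "y i = infsum (\<lambda>m. infsum (\<lambda>u. \<gamma> i m * f u) V) {m. m \<noteq> 0}"
      using fst by (subst infsum_Sigma'_banach) (auto simp: infsumI dest: has_sum_imp_summable)
    also have "\<dots> = suminf (\<gamma> i) * infsum f V"
      unfolding infsum_cmult_right' infsum_cmult_left' g ..
    finally show ?thesis unfolding fV .
  qed
  have "(run_wt s t \<gamma> has_sum (\<Sum>i=1..n. y i)) (\<Union>i\<in>{1..n}. words_from n i)"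
    using disj by (intro sum_has_sum y) auto
  moreover have "(run_wt s t \<gamma> has_sum 0) {[]}"
    using has_sum_finite[of "{[]}" "run_wt s t \<gamma>"] by simp
  ultimately have "(run_wt s t \<gamma> has_sum (0 + (\<Sum>i=1..n. y i))) ({[]} \<union> (\<Union>i\<in>{1..n}. words_from n i))"
    by (intro has_sum_Un_disjoint) (auto simp: words_from_def)
  moreover have "w \<in> {[]} \<union> (\<Union>i\<in>{1..n}. words_from n i) \<longleftrightarrow> w \<in> lists {1..n}" for w
    by (cases w) (auto simp: words_from_def)
  then have "{[]} \<union> (\<Union>i\<in>{1..n}. words_from n i) = lists {1..n}" by blast
  ultimately have "infsum (run_wt s t \<gamma>) (lists {1..n}) = (\<Sum>i=1..n. y i)"
    by (simp add: infsumI)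
  then show ?thesis using system_sum[OF st sys] by simp
qed

section \<open>The one-letter resolvent series\<close>

text \<open>A zero would make exp z real and nonpositive, hence negative, which forces an odd
  multiple of \<pi> as imaginary part.\<close>

lemma one_plus_mult_exp_neq_0:
  fixes z :: complex
  assumes t: "0 \<le> t" "t \<le> 1" and z: "norm z < pi"
  shows "1 + of_real t * (exp z - 1) \<noteq> 0"
proof
  assume eq: "1 + of_real t * (exp z - 1) = 0"
  have re: "1 + t * (exp (Re z) * cos (Im z) - 1) = 0" and im: "t * (exp (Re z) * sin (Im z)) = 0"
    using arg_cong[OF eq, of Re] arg_cong[OF eq, of Im] by (simp_all add: Re_exp Im_exp)
  have "t \<noteq> 0" using re by auto
  then have "sin (Im z) = 0" using im by simp
  moreover have "\<bar>Im z\<bar> < pi" using z abs_Im_le_cmod[of z] by linarith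
  ultimately have "Im z = 0" by (metis abs_less_iff minus_less_iff sin_eq_0_pi)
  then have "1 - t + t * exp (Re z) = 0" using re by (simp add: algebra_simps)
  moreover have "0 < t * exp (Re z)" using t \<open>t \<noteq> 0\<close> by simp
  ultimately show False using t by linarith
qed

definition res_fun :: "real \<Rightarrow> complex \<Rightarrow> complex" where
  "res_fun t z = (exp z - 1) / (1 + of_real t * (exp z - 1))"

lemma res_fun_holomorphic:
  assumes "0 \<le> t" "t \<le> 1"
  shows "res_fun t holomorphic_on ball 0 pi"
  unfolding res_fun_def[abs_def] using one_plus_mult_exp_neq_0[OF assms]
  by (intro holomorphic_intros) (simp_all add: dist_norm)

lemma res_fun_has_fps_expansion:
  "res_fun t has_fps_expansion Abs_fps (\<lambda>m. complex_of_real (fps_nth (res_fps t) m))"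
proof -
  define H where "H = Abs_fps (\<lambda>m. complex_of_real (fps_nth (res_fps t) m))"
  define V where "V = 1 + fps_const (complex_of_real t) * (fps_exp 1 - 1)"
  have V: "fps_nth V k = complex_of_real (fps_nth (1 + fps_const t * (fps_exp 1 - 1)) k)" for k
    by (simp add: V_def)
  have "H * V = fps_exp 1 - 1"
  proof (rule fps_ext)
    fix m
    have "fps_nth (H * V) m = complex_of_real (fps_nth (res_fps t * (1 + fps_const t * (fps_exp 1 - 1))) m)"
      unfolding fps_mult_nth V by (simp add: H_def del: fps_add_nth fps_mult_left_const_nth)
    then show "fps_nth (H * V) m = fps_nth (fps_exp 1 - 1) m" unfolding res_fps_mult by simp
  qed
  moreover have "fps_nth V 0 \<noteq> 0" by (simp add: V_def)
  ultimately have H: "H = (fps_exp 1 - 1) * inverse V"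
    by (metis (no_types, lifting) inverse_mult_eq_1' mult.assoc mult.right_neutral)
  have "(\<lambda>z. (exp z - 1) * inverse (1 + of_real t * (exp z - 1))) has_fps_expansion H"
    unfolding H V_def by (intro fps_expansion_intros) auto
  then show ?thesis by (simp add: H_def res_fun_def[abs_def] divide_inverse)
qed

lemma res_fps_eq_deriv: "complex_of_real (fps_nth (res_fps t) m) = (deriv ^^ m) (res_fun t) 0 / fact m"
  using fps_nth_fps_expansion[OF res_fun_has_fps_expansion, of t m] by simp

lemma res_fps_sums_res_fun:
  assumes "0 \<le> t" "t \<le> 1" "norm z < pi"
  shows "(\<lambda>m. of_real (fps_nth (res_fps t) m) * z ^ m) sums res_fun t z"
  using holomorphic_power_series[OF res_fun_holomorphic[OF assms(1,2)], of z] assms(3)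
  by (simp add: res_fps_eq_deriv)

text \<open>Cauchy's inequality on the circle of radius \<rho>; compactness of the parameter
  interval makes M independent of t, as the Lipschitz estimates require.\<close>

lemma res_fps_bound:
  assumes \<rho>: "0 < \<rho>" "\<rho> < pi"
  obtains M where "0 \<le> M" "\<And>t m. 0 \<le> t \<Longrightarrow> t \<le> 1 \<Longrightarrow> \<bar>fps_nth (res_fps t) m\<bar> \<le> M / \<rho> ^ m"
proof -
  have nz: "1 + of_real (fst p) * (exp (snd p) - 1) \<noteq> 0" if "p \<in> {0..1} \<times> cball 0 \<rho>" for p :: "real \<times> complex"
    using that \<rho> by (intro one_plus_mult_exp_neq_0) auto
  have "continuous_on ({0..1} \<times> cball 0 \<rho>) (\<lambda>p. res_fun (fst p) (snd p))"
    unfolding res_fun_def using nz by (intro continuous_intros) auto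
  then have "compact ((\<lambda>p. res_fun (fst p) (snd p)) ` ({0..1} \<times> cball 0 \<rho>))"
    by (intro compact_continuous_image compact_Times) auto
  then obtain M where M: "0 < M" "\<And>t z. t \<in> {0..1} \<Longrightarrow> z \<in> cball 0 \<rho> \<Longrightarrow> norm (res_fun t z) \<le> M"
    by (auto dest!: compact_imp_bounded simp: bounded_pos)
  have "\<bar>fps_nth (res_fps t) m\<bar> \<le> M / \<rho> ^ m" if t: "0 \<le> t" "t \<le> 1" for t m
  proof -
    have "norm ((deriv ^^ m) (res_fun t) 0) \<le> fact m * M / \<rho> ^ m"
    proof (rule Cauchy_inequality)
      show "res_fun t holomorphic_on ball 0 \<rho>"
        by (rule holomorphic_on_subset[OF res_fun_holomorphic[OF t]]) (use \<rho> in auto)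
      show "continuous_on (cball 0 \<rho>) (res_fun t)"
        by (rule holomorphic_on_imp_continuous_on, rule holomorphic_on_subset[OF res_fun_holomorphic[OF t]])
          (use \<rho> in auto)
    qed (use M t \<rho> in auto)
    moreover have "\<bar>fps_nth (res_fps t) m\<bar> = norm ((deriv ^^ m) (res_fun t) 0) / fact m"
      using arg_cong[OF res_fps_eq_deriv[of t m], of norm] by (simp add: norm_divide)
    ultimately show ?thesis by (simp add: divide_le_eq mult.commute)
  qed
  then show ?thesis using M(1) that[of M] by force
qed

text \<open>The reciprocal of the resolvent \<open>U / (1 + t U)\<close> is \<open>1 / U + t\<close>.\<close>

lemma res_fps_diff: "res_fps t - res_fps u = fps_const (u - t) * (res_fps t * res_fps u)"
proof -
  define E where "E = fps_exp (1::real) - 1"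
  define V W where "V = 1 + fps_const t * E" and "W = 1 + fps_const u * E"
  have gt: "res_fps t * V = E" and gu: "res_fps u * W = E"
    unfolding V_def W_def E_def by (rule res_fps_mult)+
  have "V * W * (res_fps t - res_fps u) = W * (res_fps t * V) - V * (res_fps u * W)" by algebra
  also have "\<dots> = (fps_const u - fps_const t) * (E * E)"
    unfolding gt gu by (simp add: V_def W_def algebra_simps del: fps_const_sub)
  also have "\<dots> = (fps_const u - fps_const t) * ((res_fps t * V) * (res_fps u * W))"
    unfolding gt gu ..
  also have "\<dots> = V * W * (fps_const (u - t) * (res_fps t * res_fps u))"
    by (simp only: fps_const_sub mult_ac)
  finally have "V * W * (res_fps t - res_fps u) = V * W * (fps_const (u - t) * (res_fps t * res_fps u))" .
  moreover have "fps_nth (V * W) 0 = 1" by (simp add: V_def W_def E_def)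
  then have "V * W \<noteq> 0" by auto
  ultimately show ?thesis by simp
qed

lemma res_fps_deriv:
  "fps_deriv (res_fps t) = (1 + fps_const (1 - t) * res_fps t) * (1 - fps_const t * res_fps t)"
proof -
  define E where "E = fps_exp (1::real) - 1"
  have gt: "res_fps t * (1 + fps_const t * E) = E"
    unfolding E_def by (rule res_fps_mult)
  have dE: "fps_deriv E = fps_exp 1" by (simp add: E_def)
  have "fps_deriv (res_fps t * (1 + fps_const t * E)) = fps_exp 1" unfolding gt dE ..
  then have "fps_deriv (res_fps t) * (1 + fps_const t * E) = fps_exp 1 * (1 - fps_const t * res_fps t)"
    by (simp add: dE algebra_simps)
  also have "\<dots> = 1 + fps_const (1 - t) * res_fps t" by (rule fps_exp_mult_res_fps)
  finally have "fps_deriv (res_fps t) * ((1 + fps_const t * E) * (1 - fps_const t * res_fps t))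
    = (1 + fps_const (1 - t) * res_fps t) * (1 - fps_const t * res_fps t)"
    by (simp add: mult.assoc[symmetric])
  moreover have "(1 + fps_const t * E) * (1 - fps_const t * res_fps t)
      = 1 + fps_const t * (E - res_fps t * (1 + fps_const t * E))"
    by (simp add: algebra_simps)
  ultimately show ?thesis by (simp add: gt)
qed

text \<open>Duplication formula expressing the series at 2 x through the series at x. At t = 1/2,
  where the series is 2 tanh (x / 2), it is the double-argument formula of tanh.\<close>

lemma res_fps_double:
  "Abs_fps (\<lambda>m. 2 ^ m * fps_nth (res_fps t) m) * (1 + fps_const (t * (1 - t)) * res_fps t ^ 2)
    = fps_const 2 * res_fps t + fps_const (1 - 2 * t) * res_fps t ^ 2"
proof -
  define G where "G = res_fps t"
  define G2 where "G2 = Abs_fps (\<lambda>m. 2 ^ m * fps_nth G m)"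
  define X where "X = fps_const 2 * (fps_X :: real fps)"
  have comp: "G2 = fps_compose G X"
    unfolding G2_def X_def by (simp add: fps_compose_linear)
  have X0: "fps_nth X 0 = 0" by (simp add: X_def)
  have e2: "fps_compose (fps_exp (1::real)) X = fps_exp 1 * fps_exp 1"
    unfolding X_def fps_exp_compose_linear by (simp flip: fps_exp_add_mult)
  have "fps_compose (G * (1 + fps_const t * (fps_exp 1 - 1))) X = fps_compose (fps_exp 1 - 1) X"
    unfolding G_def res_fps_mult ..
  then have 1: "G2 * (1 + fps_const t * (fps_exp 1 * fps_exp 1 - 1)) = fps_exp 1 * fps_exp 1 - 1"
    by (simp add: comp fps_compose_mult_distrib[OF X0] fps_compose_add_distrib fps_compose_sub_distrib e2 fps_const_mult_apply_left)
  define c where "c = fps_const t"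
  have c: "fps_const (1 - t) = 1 - c" by (simp add: c_def flip: fps_const_sub)
  have 2: "fps_exp 1 * (1 - c * G) = 1 + (1 - c) * G"
    using fps_exp_mult_res_fps[of t] unfolding G_def c c_def[symmetric] .
  define e where "e = fps_exp (1::real)"
  have 1: "G2 * (1 + c * (e * e - 1)) = e * e - 1" and 2: "e * (1 - c * G) = 1 + (1 - c) * G"
    using 1 2 by (simp_all add: e_def c_def)
  \<comment> \<open>After multiplication by the square of 1 - c G, the exponential occurs only as e
    (1 - c G), which the second identity replaces by 1 + (1 - c) G.\<close>
  have "G2 * ((1 - c * G)\<^sup>2 + c * ((e * (1 - c * G))\<^sup>2 - (1 - c * G)\<^sup>2)) = (e * (1 - c * G))\<^sup>2 - (1 - c * G)\<^sup>2"
    using 1 by algebra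
  then have "G2 * (1 + c * (1 - c) * G ^ 2) = 2 * G + (1 - 2 * c) * G ^ 2"
    unfolding 2 by algebra
  moreover have "fps_const (t * (1 - t)) = c * (1 - c)" "fps_const (1 - 2 * t) = 1 - 2 * c" "fps_const (2::real) = 2"
    by (simp_all add: c_def numeral_fps_const flip: fps_const_sub fps_const_mult)
  ultimately show ?thesis by (simp add: G_def G2_def)
qed

lemma fps_mult_sums:
  fixes f g :: "real fps"
  assumes "summable (\<lambda>m. \<bar>fps_nth f m * x ^ m\<bar>)" "summable (\<lambda>m. \<bar>fps_nth g m * x ^ m\<bar>)"
  shows "(\<lambda>m. fps_nth (f * g) m * x ^ m) sums ((\<Sum>m. fps_nth f m * x ^ m) * (\<Sum>m. fps_nth g m * x ^ m))"
proof -
  have "fps_nth (f * g) m * x ^ m = (\<Sum>i\<le>m. (fps_nth f i * x ^ i) * (fps_nth g (m - i) * x ^ (m - i)))" for m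
    unfolding fps_mult_nth atMost_atLeast0 sum_distrib_right
    by (intro sum.cong refl) (auto simp: algebra_simps simp flip: power_add)
  then show ?thesis
    using Cauchy_product_sums[of "\<lambda>m. fps_nth f m * x ^ m" "\<lambda>m. fps_nth g m * x ^ m"] assms by simp
qed

section \<open>The one-letter majorant with absolute coefficients\<close>

definition abs_res_fps :: "real \<Rightarrow> real fps" where
  "abs_res_fps t = Abs_fps (\<lambda>m. \<bar>fps_nth (res_fps t) m\<bar>)"

definition res_sum :: "real \<Rightarrow> real \<Rightarrow> real" where
  "res_sum t x = (\<Sum>m. \<bar>fps_nth (res_fps t) m\<bar> * x ^ m)"

lemma res_fps_summable:
  assumes t: "0 \<le> t" "t \<le> 1" and x: "0 \<le> x" "x < pi"
  shows "summable (\<lambda>m. \<bar>fps_nth (res_fps t) m\<bar> * x ^ m)"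
proof -
  define \<rho> where "\<rho> = (x + pi) / 2"
  have \<rho>: "0 < \<rho>" "\<rho> < pi" "x < \<rho>" using x by (auto simp: \<rho>_def)
  obtain M where M: "\<And>m. \<bar>fps_nth (res_fps t) m\<bar> \<le> M / \<rho> ^ m"
    using res_fps_bound[OF \<rho>(1,2)] t by metis
  show ?thesis
  proof (rule summable_comparison_test'[where N = 0])
    show "summable (\<lambda>m. M * (x / \<rho>) ^ m)"
      using \<rho> x by (intro summable_mult summable_geometric) auto
    show "norm (\<bar>fps_nth (res_fps t) m\<bar> * x ^ m) \<le> M * (x / \<rho>) ^ m" for m
      using mult_right_mono[OF M[of m], of "x ^ m"] x by (simp add: power_divide)
  qed
qed

lemma res_sum_sums:
  assumes "0 \<le> t" "t \<le> 1" "0 \<le> x" "x < pi"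
  shows "(\<lambda>m. fps_nth (abs_res_fps t) m * x ^ m) sums res_sum t x"
  using res_fps_summable[OF assms] by (simp add: abs_res_fps_def res_sum_def summable_sums)

lemma abs_res_fps_abs_summable:
  assumes "0 \<le> t" "t \<le> 1" "0 \<le> x" "x < pi"
  shows "summable (\<lambda>m. \<bar>fps_nth (abs_res_fps t) m * x ^ m\<bar>)"
  using res_fps_summable[OF assms] assms(3) by (simp add: abs_res_fps_def abs_mult)

lemma res_sum_ge:
  assumes "0 \<le> t" "t \<le> 1" "0 \<le> x" "x < pi"
  shows "x \<le> res_sum t x"
proof -
  have "sum (\<lambda>m. \<bar>fps_nth (res_fps t) m\<bar> * x ^ m) {1} \<le> res_sum t x"
    unfolding res_sum_def using assms by (intro sum_le_suminf res_fps_summable) auto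
  then show ?thesis by simp
qed

lemma res_sum_0 [simp]: "res_sum t 0 = 0"
proof -
  have "(\<lambda>m. \<bar>fps_nth (res_fps t) m\<bar> * 0 ^ m) = (\<lambda>m. 0)"
    by (rule ext) (case_tac m, auto)
  then show ?thesis by (simp add: res_sum_def)
qed

lemma abs_fps_mult_nth_le:
  fixes f g :: "real fps"
  assumes "\<And>m. \<bar>fps_nth f m\<bar> \<le> fps_nth f' m" "\<And>m. \<bar>fps_nth g m\<bar> \<le> fps_nth g' m"
  shows "\<bar>fps_nth (f * g) m\<bar> \<le> fps_nth (f' * g') m"
  unfolding fps_mult_nth
  by (rule order.trans[OF sum_abs], intro sum_mono, unfold abs_mult, intro mult_mono assms)
    (auto intro: order.trans[OF abs_ge_zero assms(1)])

lemma abs_res_fps_square: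
  assumes "0 \<le> t" "t \<le> 1" "0 \<le> x" "x < pi"
  shows "(\<lambda>m. fps_nth (abs_res_fps t * abs_res_fps t) m * x ^ m) sums (res_sum t x)\<^sup>2"
    "summable (\<lambda>m. \<bar>fps_nth (abs_res_fps t * abs_res_fps t) m * x ^ m\<bar>)"
proof -
  show *: "(\<lambda>m. fps_nth (abs_res_fps t * abs_res_fps t) m * x ^ m) sums (res_sum t x)\<^sup>2"
    using fps_mult_sums[OF abs_res_fps_abs_summable[OF assms] abs_res_fps_abs_summable[OF assms]]
      sums_unique[OF res_sum_sums[OF assms]] by (simp add: power2_eq_square)
  have "0 \<le> fps_nth (abs_res_fps t * abs_res_fps t) m" for m
    unfolding fps_mult_nth by (intro sum_nonneg) (simp add: abs_res_fps_def)
  then have "(\<lambda>m. \<bar>fps_nth (abs_res_fps t * abs_res_fps t) m * x ^ m\<bar>) = (\<lambda>m. fps_nth (abs_res_fps t * abs_res_fps t) m * x ^ m)"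
    using assms by (simp add: abs_mult)
  then show "summable (\<lambda>m. \<bar>fps_nth (abs_res_fps t * abs_res_fps t) m * x ^ m\<bar>)"
    using * by (simp add: sums_iff)
qed

lemma res_sum_deriv:
  assumes t: "0 \<le> t" "t \<le> 1" and x: "0 \<le> x" "x < pi"
  obtains D where "(res_sum t has_field_derivative D) (at x)"
    "D \<le> 1 + \<bar>1 - 2 * t\<bar> * res_sum t x + t * (1 - t) * (res_sum t x)\<^sup>2"
proof
  define c where "c m = \<bar>fps_nth (res_fps t) m\<bar>" for m
  define y where "y = (x + pi) / 2"
  have y: "0 \<le> y" "y < pi" "x < y" using x by (auto simp: y_def)
  have sy: "summable (\<lambda>m. c m * y ^ m)"
    unfolding c_def using res_fps_summable[OF t y(1,2)] .
  show "(res_sum t has_field_derivative (\<Sum>m. diffs c m * x ^ m)) (at x)"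
    unfolding res_sum_def[abs_def] c_def[symmetric]
    by (rule termdiffs_strong[OF sy]) (use x y in auto)
  have sd: "summable (\<lambda>m. diffs c m * x ^ m)"
    by (rule termdiff_converges[where K = y]) (use x y powser_inside[OF sy] in auto)
  have le: "diffs c m \<le> (if m = 0 then 1 else 0) + \<bar>1 - 2 * t\<bar> * fps_nth (abs_res_fps t) m
      + t * (1 - t) * fps_nth (abs_res_fps t * abs_res_fps t) m" for m
  proof -
    have c: "fps_const (1 - t) = 1 - fps_const t" by (simp flip: fps_const_sub)
    have c2: "fps_const (1 - 2 * t) = 1 - 2 * fps_const t" "fps_const (t * (1 - t)) = fps_const t * (1 - fps_const t)"
      by (simp_all add: numeral_fps_const flip: fps_const_sub fps_const_mult)
    \<comment> \<open>Expanding the product before taking absolute values leaves |1 - 2 t| on the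
      linear term instead of (1 - t) + t = 1. At t = 1/2 this term vanishes, which gives the strict
      inequality of \<open>res_sum_half_bound\<close>.\<close>
    have "fps_deriv (res_fps t) = 1 + fps_const (1 - 2 * t) * res_fps t
        - fps_const (t * (1 - t)) * (res_fps t * res_fps t)"
      unfolding res_fps_deriv c c2 by algebra
    then have "fps_nth (fps_deriv (res_fps t)) m = (if m = 0 then 1 else 0) + (1 - 2 * t) * fps_nth (res_fps t) m
        - t * (1 - t) * fps_nth (res_fps t * res_fps t) m"
      by simp
    then have "\<bar>real (Suc m) * fps_nth (res_fps t) (Suc m)\<bar> \<le> (if m = 0 then 1 else 0)
      + \<bar>(1 - 2 * t) * fps_nth (res_fps t) m\<bar> + \<bar>t * (1 - t) * fps_nth (res_fps t * res_fps t) m\<bar>"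
      by (auto split: if_splits)
    also have "\<bar>t * (1 - t) * fps_nth (res_fps t * res_fps t) m\<bar> \<le> t * (1 - t) * fps_nth (abs_res_fps t * abs_res_fps t) m"
      unfolding abs_mult[of "t * (1 - t)"] using t
      by (intro mult_mono abs_fps_mult_nth_le) (auto simp: abs_res_fps_def)
    finally show ?thesis by (simp add: diffs_def c_def abs_mult abs_res_fps_def)
  qed
  have "(\<lambda>m. (if m = 0 then 1 else 0) * x ^ m) sums 1"
    using sums_single[of 0 "\<lambda>m. x ^ m"] by (simp add: if_distrib[of "\<lambda>a. a * _"] eq_commute cong: if_cong)
  then have "(\<lambda>m. (if m = 0 then 1 else 0) * x ^ m + \<bar>1 - 2 * t\<bar> * (fps_nth (abs_res_fps t) m * x ^ m)
      + t * (1 - t) * (fps_nth (abs_res_fps t * abs_res_fps t) m * x ^ m)) sums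
      (1 + \<bar>1 - 2 * t\<bar> * res_sum t x + t * (1 - t) * (res_sum t x)\<^sup>2)"
    using res_sum_sums[OF t x] abs_res_fps_square(1)[OF t x] by (intro sums_add sums_mult)
  then show "(\<Sum>m. diffs c m * x ^ m) \<le> 1 + \<bar>1 - 2 * t\<bar> * res_sum t x + t * (1 - t) * (res_sum t x)\<^sup>2"
  proof (rule sums_le[OF _ summable_sums[OF sd], rotated])
    show "diffs c m * x ^ m \<le> (if m = 0 then 1 else 0) * x ^ m + \<bar>1 - 2 * t\<bar> * (fps_nth (abs_res_fps t) m * x ^ m)
      + t * (1 - t) * (fps_nth (abs_res_fps t * abs_res_fps t) m * x ^ m)" for m
      using mult_right_mono[OF le[of m], of "x ^ m"] x by (simp add: algebra_simps)
  qed
qed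

text \<open>Coefficientwise absolute values in \<open>res_fps_double\<close>, once the term with the
  doubled series has been moved to the right. The factor |1 - 2 t|, below 1 for 0 < t < 1, is the
  gain exploited when a letter is split.\<close>

lemma res_sum_double:
  assumes t: "0 \<le> t" "t \<le> 1" and x: "0 \<le> x" "x < pi"
  shows "res_sum t x * (1 - t * (1 - t) * (res_sum t (x / 2))\<^sup>2)
    \<le> 2 * res_sum t (x / 2) + \<bar>1 - 2 * t\<bar> * (res_sum t (x / 2))\<^sup>2"
proof -
  define R where "R = res_sum t (x / 2)"
  have h: "0 \<le> x / 2" "x / 2 < pi" using x by auto
  define A where "A = Abs_fps (\<lambda>m. 2 ^ m * fps_nth (abs_res_fps t) m)"
  define q where "q = t * (1 - t)"
  have q: "0 \<le> q" using t by (simp add: q_def)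
  have A0: "0 \<le> fps_nth A m" for m by (simp add: A_def abs_res_fps_def)
  have As: "(\<lambda>m. fps_nth A m * (x / 2) ^ m) sums res_sum t x"
    using res_sum_sums[OF t x] by (simp add: A_def power_divide)
  then have Asum: "summable (\<lambda>m. \<bar>fps_nth A m * (x / 2) ^ m\<bar>)"
    using A0 x by (simp add: abs_mult sums_iff)
  have sqA: "(\<lambda>m. fps_nth (abs_res_fps t * abs_res_fps t * A) m * (x / 2) ^ m) sums (R\<^sup>2 * res_sum t x)"
    using fps_mult_sums[OF abs_res_fps_square(2)[OF t h] Asum] sums_unique[OF abs_res_fps_square(1)[OF t h]] sums_unique[OF As]
    by (simp add: R_def)
  have le: "fps_nth A m \<le> 2 * fps_nth (abs_res_fps t) m + \<bar>1 - 2 * t\<bar> * fps_nth (abs_res_fps t * abs_res_fps t) m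
    + q * fps_nth (abs_res_fps t * abs_res_fps t * A) m" for m
  proof -
    define G2 where "G2 = Abs_fps (\<lambda>m. 2 ^ m * fps_nth (res_fps t) m)"
    have "G2 = fps_const 2 * res_fps t + fps_const (1 - 2 * t) * (res_fps t * res_fps t)
        - fps_const q * (res_fps t * res_fps t * G2)"
      using res_fps_double[of t] unfolding G2_def q_def by algebra
    then have "fps_nth G2 m = 2 * fps_nth (res_fps t) m + (1 - 2 * t) * fps_nth (res_fps t * res_fps t) m
        - q * fps_nth (res_fps t * res_fps t * G2) m"
      by (metis fps_add_nth fps_sub_nth fps_mult_left_const_nth)
    then have "\<bar>fps_nth G2 m\<bar> \<le> \<bar>2 * fps_nth (res_fps t) m\<bar> + \<bar>(1 - 2 * t) * fps_nth (res_fps t * res_fps t) m\<bar>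
        + \<bar>q * fps_nth (res_fps t * res_fps t * G2) m\<bar>"
      by linarith
    also have "\<dots> \<le> 2 * fps_nth (abs_res_fps t) m + \<bar>1 - 2 * t\<bar> * fps_nth (abs_res_fps t * abs_res_fps t) m
      + q * fps_nth (abs_res_fps t * abs_res_fps t * A) m"
      unfolding abs_mult using q
      by (intro add_mono mult_mono abs_fps_mult_nth_le) (auto simp: abs_res_fps_def G2_def A_def abs_mult)
    finally show ?thesis by (simp add: G2_def A_def abs_res_fps_def abs_mult)
  qed
  have "(\<lambda>m. 2 * (fps_nth (abs_res_fps t) m * (x / 2) ^ m) + \<bar>1 - 2 * t\<bar> * (fps_nth (abs_res_fps t * abs_res_fps t) m * (x / 2) ^ m)
      + q * (fps_nth (abs_res_fps t * abs_res_fps t * A) m * (x / 2) ^ m)) sums (2 * R + \<bar>1 - 2 * t\<bar> * R\<^sup>2 + q * (R\<^sup>2 * res_sum t x))"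
    unfolding R_def using res_sum_sums[OF t h] abs_res_fps_square(1)[OF t h] sqA[unfolded R_def] by (intro sums_add sums_mult)
  then have "res_sum t x \<le> 2 * R + \<bar>1 - 2 * t\<bar> * R\<^sup>2 + q * (R\<^sup>2 * res_sum t x)"
  proof (rule sums_le[OF _ As, rotated])
    show "fps_nth A m * (x / 2) ^ m \<le> 2 * (fps_nth (abs_res_fps t) m * (x / 2) ^ m)
      + \<bar>1 - 2 * t\<bar> * (fps_nth (abs_res_fps t * abs_res_fps t) m * (x / 2) ^ m)
      + q * (fps_nth (abs_res_fps t * abs_res_fps t * A) m * (x / 2) ^ m)" for m
      using mult_right_mono[OF le[of m], of "(x / 2) ^ m"] x by (simp add: algebra_simps)
  qed
  then show ?thesis by (simp add: R_def q_def algebra_simps)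
qed

text \<open>At an imaginary argument the even terms are real and the odd terms are imaginary.\<close>

lemma Re_Im_res_fun_le_res_sum:
  assumes t: "0 \<le> t" "t \<le> 1" and x: "0 \<le> x" "x < pi"
  shows "\<bar>Re (res_fun t (\<i> * of_real x))\<bar> + \<bar>Im (res_fun t (\<i> * of_real x))\<bar> \<le> res_sum t x"
proof -
  define a where "a m = complex_of_real (fps_nth (res_fps t) m) * (\<i> * of_real x) ^ m" for m
  have a: "a sums res_fun t (\<i> * of_real x)"
    unfolding a_def[abs_def] by (rule res_fps_sums_res_fun[OF t]) (use x in \<open>simp add: norm_mult\<close>)
  have na: "\<bar>Re (a m)\<bar> + \<bar>Im (a m)\<bar> = \<bar>fps_nth (res_fps t) m\<bar> * x ^ m" for m
  proof -
    have im: "\<bar>Re (\<i> ^ m)\<bar> + \<bar>Im (\<i> ^ m)\<bar> = 1"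
      by (induction m) auto
    have "a m = complex_of_real (fps_nth (res_fps t) m * x ^ m) * \<i> ^ m"
      by (simp add: a_def power_mult_distrib)
    then have "\<bar>Re (a m)\<bar> + \<bar>Im (a m)\<bar> = \<bar>fps_nth (res_fps t) m * x ^ m\<bar> * (\<bar>Re (\<i> ^ m)\<bar> + \<bar>Im (\<i> ^ m)\<bar>)"
      by (simp add: abs_mult algebra_simps)
    then show ?thesis using im x by (simp add: abs_mult)
  qed
  have sR: "(\<lambda>m. Re (a m)) sums Re (res_fun t (\<i> * of_real x))"
    and sI: "(\<lambda>m. Im (a m)) sums Im (res_fun t (\<i> * of_real x))"
    using a by (auto simp: sums_complex_iff)
  have r: "(\<lambda>m. \<bar>Re (a m)\<bar> + \<bar>Im (a m)\<bar>) sums res_sum t x"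
    unfolding na using res_fps_summable[OF t x] by (simp add: res_sum_def summable_sums)
  have bound: "c * Re (res_fun t (\<i> * of_real x)) + d * Im (res_fun t (\<i> * of_real x)) \<le> res_sum t x"
    if "\<bar>c\<bar> = 1" "\<bar>d\<bar> = 1" for c d
  proof (rule sums_le[OF _ sums_add[OF sums_mult[OF sR] sums_mult[OF sI]] r])
    show "c * Re (a m) + d * Im (a m) \<le> \<bar>Re (a m)\<bar> + \<bar>Im (a m)\<bar>" for m
      using that abs_ge_self[of "c * Re (a m)"] abs_ge_self[of "d * Im (a m)"] by (simp add: abs_mult)
  qed
  show ?thesis
    using bound[of 1 1] bound[of 1 "-1"] bound[of "-1" 1] bound[of "-1" "-1"] by linarith
qed

section \<open>Lipschitz dependence on the parameters\<close>

text \<open>Boundedness is included so that products stay in the class. Lipschitz rather than mere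
  continuity is the point: it makes the denominator vanish at least linearly at a critical point,
  hence the logarithmic divergence.\<close>

definition bdd_lip :: "'a::metric_space set \<Rightarrow> ('a \<Rightarrow> real) \<Rightarrow> bool" where
  "bdd_lip S f \<longleftrightarrow> (\<exists>B L. 0 \<le> B \<and> 0 \<le> L \<and>
    (\<forall>p\<in>S. \<bar>f p\<bar> \<le> B) \<and> (\<forall>p\<in>S. \<forall>q\<in>S. \<bar>f p - f q\<bar> \<le> L * dist p q))"

lemma bdd_lipE:
  assumes "bdd_lip S f"
  obtains B L where "0 \<le> B" "0 \<le> L" "\<And>p. p \<in> S \<Longrightarrow> \<bar>f p\<bar> \<le> B"
    "\<And>p q. p \<in> S \<Longrightarrow> q \<in> S \<Longrightarrow> \<bar>f p - f q\<bar> \<le> L * dist p q"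
  using assms unfolding bdd_lip_def by blast

lemma bdd_lip_const: "bdd_lip S (\<lambda>_. c)"
  unfolding bdd_lip_def by (intro exI[of _ "\<bar>c\<bar>"] exI[of _ 0]) auto

lemma bdd_lip_add:
  assumes "bdd_lip S f" "bdd_lip S g"
  shows "bdd_lip S (\<lambda>p. f p + g p)"
proof -
  obtain B L where f: "0 \<le> B" "0 \<le> L" "\<And>p. p \<in> S \<Longrightarrow> \<bar>f p\<bar> \<le> B"
    "\<And>p q. p \<in> S \<Longrightarrow> q \<in> S \<Longrightarrow> \<bar>f p - f q\<bar> \<le> L * dist p q"
    using assms(1) by (rule bdd_lipE) blast
  obtain B' L' where g: "0 \<le> B'" "0 \<le> L'" "\<And>p. p \<in> S \<Longrightarrow> \<bar>g p\<bar> \<le> B'"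
    "\<And>p q. p \<in> S \<Longrightarrow> q \<in> S \<Longrightarrow> \<bar>g p - g q\<bar> \<le> L' * dist p q"
    using assms(2) by (rule bdd_lipE) blast
  have "\<bar>f p + g p\<bar> \<le> B + B'" if "p \<in> S" for p
    using f(3)[OF that] g(3)[OF that] by linarith
  moreover have "\<bar>f p + g p - (f q + g q)\<bar> \<le> (L + L') * dist p q" if "p \<in> S" "q \<in> S" for p q
    using f(4)[OF that] g(4)[OF that] by (simp add: distrib_right)
  ultimately show ?thesis unfolding bdd_lip_def using f g by (intro exI[of _ "B + B'"] exI[of _ "L + L'"]) auto
qed

lemma bdd_lip_mult:
  assumes "bdd_lip S f" "bdd_lip S g"
  shows "bdd_lip S (\<lambda>p. f p * g p)"
proof -
  obtain B L where f: "0 \<le> B" "0 \<le> L" "\<And>p. p \<in> S \<Longrightarrow> \<bar>f p\<bar> \<le> B"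
    "\<And>p q. p \<in> S \<Longrightarrow> q \<in> S \<Longrightarrow> \<bar>f p - f q\<bar> \<le> L * dist p q"
    using assms(1) by (rule bdd_lipE) blast
  obtain B' L' where g: "0 \<le> B'" "0 \<le> L'" "\<And>p. p \<in> S \<Longrightarrow> \<bar>g p\<bar> \<le> B'"
    "\<And>p q. p \<in> S \<Longrightarrow> q \<in> S \<Longrightarrow> \<bar>g p - g q\<bar> \<le> L' * dist p q"
    using assms(2) by (rule bdd_lipE) blast
  have "\<bar>f p * g p\<bar> \<le> B * B'" if "p \<in> S" for p
    unfolding abs_mult using f g that by (intro mult_mono) auto
  moreover have "\<bar>f p * g p - f q * g q\<bar> \<le> (L * B' + B * L') * dist p q" if "p \<in> S" "q \<in> S" for p q
  proof -
    have "f p * g p - f q * g q = (f p - f q) * g p + f q * (g p - g q)" by (simp add: algebra_simps)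
    then have "\<bar>f p * g p - f q * g q\<bar> \<le> \<bar>f p - f q\<bar> * \<bar>g p\<bar> + \<bar>f q\<bar> * \<bar>g p - g q\<bar>"
      by (metis abs_mult abs_triangle_ineq)
    also have "\<dots> \<le> (L * dist p q) * B' + B * (L' * dist p q)"
      using f g that by (intro add_mono mult_mono) auto
    finally show ?thesis by (simp add: algebra_simps)
  qed
  ultimately show ?thesis
    unfolding bdd_lip_def using f g by (intro exI[of _ "B * B'"] exI[of _ "L * B' + B * L'"]) auto
qed

lemma bdd_lip_diff:
  assumes "bdd_lip S f" "bdd_lip S g"
  shows "bdd_lip S (\<lambda>p. f p - g p)"
  using bdd_lip_add[OF assms(1) bdd_lip_mult[OF bdd_lip_const[of S "-1"] assms(2)]] by simp

lemma bdd_lip_continuous_on: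
  assumes "bdd_lip S f"
  shows "continuous_on S f"
proof -
  obtain B L where "0 \<le> L" "\<And>p q. p \<in> S \<Longrightarrow> q \<in> S \<Longrightarrow> \<bar>f p - f q\<bar> \<le> L * dist p q"
    using assms by (rule bdd_lipE) blast
  then have "L-lipschitz_on S f" by (intro lipschitz_onI) (auto simp: dist_real_def)
  then show ?thesis by (rule lipschitz_on_continuous_on)
qed

lemma bdd_lip_word_den_word_num:
  assumes "bdd_lip S q" "\<And>i. i \<in> {1..n} \<Longrightarrow> bdd_lip S (\<lambda>p. r p i)"
  shows "bdd_lip S (\<lambda>p. word_den (q p) (r p) n) \<and> bdd_lip S (\<lambda>p. word_num (q p) (r p) n)"
  using assms(2)
proof (induction n)
  case (Suc n)
  then have "bdd_lip S (\<lambda>p. word_den (q p) (r p) n)" "bdd_lip S (\<lambda>p. word_num (q p) (r p) n)" "bdd_lip S (\<lambda>p. r p (Suc n))"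
    by auto
  then show ?case using assms(1) by (simp add: bdd_lip_add bdd_lip_mult bdd_lip_diff)
qed (simp add: bdd_lip_const)

lemma bdd_lip_coordinate:
  "bdd_lip ({0..1} \<times> {0..1}) (\<lambda>p::real \<times> real. fst p)" "bdd_lip ({0..1} \<times> {0..1}) (\<lambda>p::real \<times> real. snd p)"
proof -
  have le: "\<bar>fst p - fst q\<bar> \<le> dist p q" "\<bar>snd p - snd q\<bar> \<le> dist p q" for p q :: "real \<times> real"
    using dist_fst_le[of p q] dist_snd_le[of p q] by (simp_all add: dist_real_def)
  show "bdd_lip ({0..1} \<times> {0..1}) (\<lambda>p::real \<times> real. fst p)"
    unfolding bdd_lip_def by (intro exI[of _ 1] conjI ballI) (simp_all add: mem_Times_iff le)
  show "bdd_lip ({0..1} \<times> {0..1}) (\<lambda>p::real \<times> real. snd p)"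
    unfolding bdd_lip_def by (intro exI[of _ 1] conjI ballI) (simp_all add: mem_Times_iff le)
qed

text \<open>Multiplying by X replaces the exponent m - 1 of the mean value bound by m and so avoids
  a separate case m = 0.\<close>

lemma abs_power_diff_le:
  fixes y z :: real
  assumes "\<bar>y\<bar> \<le> X" "\<bar>z\<bar> \<le> X"
  shows "\<bar>y ^ m - z ^ m\<bar> * X \<le> real m * X ^ m * \<bar>y - z\<bar>"
proof (induction m)
  case (Suc m)
  have X: "0 \<le> X" using assms by linarith
  have "y ^ Suc m - z ^ Suc m = y * (y ^ m - z ^ m) + (y - z) * z ^ m" by (simp add: algebra_simps)
  then have "\<bar>y ^ Suc m - z ^ Suc m\<bar> \<le> \<bar>y\<bar> * \<bar>y ^ m - z ^ m\<bar> + \<bar>y - z\<bar> * \<bar>z\<bar> ^ m"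
    by (metis abs_mult abs_triangle_ineq power_abs)
  also have "\<dots> \<le> X * \<bar>y ^ m - z ^ m\<bar> + \<bar>y - z\<bar> * X ^ m"
    using assms by (intro add_mono mult_mono power_mono) auto
  finally have "\<bar>y ^ Suc m - z ^ Suc m\<bar> * X \<le> (X * \<bar>y ^ m - z ^ m\<bar> + \<bar>y - z\<bar> * X ^ m) * X"
    using X by (rule mult_right_mono)
  also have "\<dots> \<le> X * (real m * X ^ m * \<bar>y - z\<bar>) + \<bar>y - z\<bar> * X ^ m * X"
    using mult_left_mono[OF Suc X] by (simp add: algebra_simps)
  finally show ?case by (simp add: algebra_simps)
qed simp

text \<open>Common frame for the absolute coefficients of the majorant and for the coefficients with
  frozen signs: values and increments in t are controlled by those of \<open>res_fps\<close>, which
  is all that the Lipschitz estimate uses.\<close>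

definition coeff_family :: "(real \<Rightarrow> nat \<Rightarrow> real) \<Rightarrow> bool" where
  "coeff_family a \<longleftrightarrow> (\<forall>t m. \<bar>a t m\<bar> \<le> \<bar>fps_nth (res_fps t) m\<bar>) \<and>
    (\<forall>t u m. \<bar>a t m - a u m\<bar> \<le> \<bar>fps_nth (res_fps t) m - fps_nth (res_fps u) m\<bar>)"

lemma coeff_family_summable:
  assumes "coeff_family a" "0 \<le> t" "t \<le> 1" "0 \<le> x" "x < pi"
  shows "summable (\<lambda>m. \<bar>a t m * x ^ m\<bar>)" "summable (\<lambda>m. a t m * x ^ m)"
    "\<bar>\<Sum>m. a t m * x ^ m\<bar> \<le> res_sum t x"
proof -
  have le: "\<bar>a t m * x ^ m\<bar> \<le> \<bar>fps_nth (res_fps t) m\<bar> * x ^ m" for m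
    unfolding abs_mult using assms by (intro mult_mono) (auto simp: coeff_family_def)
  show 1: "summable (\<lambda>m. \<bar>a t m * x ^ m\<bar>)"
    by (rule summable_comparison_test'[OF res_fps_summable[OF assms(2-)], of 0]) (use le in auto)
  then show "summable (\<lambda>m. a t m * x ^ m)" by (rule summable_rabs_cancel)
  show "\<bar>\<Sum>m. a t m * x ^ m\<bar> \<le> res_sum t x"
    unfolding res_sum_def using norm_suminf_le[OF _ res_fps_summable[OF assms(2-)], of "\<lambda>m. a t m * x ^ m"] le by simp
qed

lemma coeff_family_lipschitz:
  assumes a: "coeff_family a" and X: "0 < X" "X < pi"
  obtains L where "0 \<le> L" "\<And>t u y z. t \<in> {0..1} \<Longrightarrow> u \<in> {0..1} \<Longrightarrow> y \<in> {0..X} \<Longrightarrow> z \<in> {0..X} \<Longrightarrow>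
    \<bar>(\<Sum>m. a t m * y ^ m) - (\<Sum>m. a u m * z ^ m)\<bar> \<le> L * (\<bar>t - u\<bar> + \<bar>y - z\<bar>)"
proof -
  define \<rho> where "\<rho> = (X + pi) / 2"
  have \<rho>: "0 < \<rho>" "\<rho> < pi" "X < \<rho>" using X by (auto simp: \<rho>_def)
  obtain M where M: "0 \<le> M" "\<And>t m. 0 \<le> t \<Longrightarrow> t \<le> 1 \<Longrightarrow> \<bar>fps_nth (res_fps t) m\<bar> \<le> M / \<rho> ^ m"
    using res_fps_bound[OF \<rho>(1,2)] by metis
  define S where "S = (\<Sum>m. real (Suc m) * (X / \<rho>) ^ m)"
  have S: "summable (\<lambda>m. real (Suc m) * (X / \<rho>) ^ m)"
    using geometric_deriv_sums[of "X / \<rho>"] X \<rho> by (simp add: sums_iff)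
  have S0: "0 \<le> S" unfolding S_def using S X \<rho> by (intro suminf_nonneg) auto
  \<comment> \<open>By \<open>res_fps_diff\<close> the difference is u - t times a convolution of m
    + 1 products, each of modulus at most M^2 / \<rho>^m.\<close>
  have gd: "\<bar>fps_nth (res_fps t) m - fps_nth (res_fps u) m\<bar> \<le> \<bar>t - u\<bar> * (real (Suc m) * (M\<^sup>2 / \<rho> ^ m))"
    if "t \<in> {0..1}" "u \<in> {0..1}" for t u m
  proof -
    have "fps_nth (res_fps t) m - fps_nth (res_fps u) m = (u - t) * fps_nth (res_fps t * res_fps u) m"
      using arg_cong[OF res_fps_diff[of t u], of "\<lambda>f. fps_nth f m"]
      by (simp only: fps_sub_nth fps_mult_left_const_nth)
    then have "fps_nth (res_fps t) m - fps_nth (res_fps u) m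
      = (u - t) * (\<Sum>i=0..m. fps_nth (res_fps t) i * fps_nth (res_fps u) (m - i))"
      by (simp only: fps_mult_nth)
    moreover have "\<bar>\<Sum>i=0..m. fps_nth (res_fps t) i * fps_nth (res_fps u) (m - i)\<bar> \<le> (\<Sum>i=0..m. M\<^sup>2 / \<rho> ^ m)"
      (is "\<bar>?A\<bar> \<le> _")
    proof (rule order.trans[OF sum_abs sum_mono])
      fix i assume i: "i \<in> {0..m}"
      have "\<bar>fps_nth (res_fps t) i\<bar> * \<bar>fps_nth (res_fps u) (m - i)\<bar> \<le> (M / \<rho> ^ i) * (M / \<rho> ^ (m - i))"
        using M that \<rho> by (intro mult_mono) auto
      also have "\<dots> = M\<^sup>2 / \<rho> ^ m"
        using i by (simp add: power2_eq_square flip: power_add)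
      finally show "\<bar>fps_nth (res_fps t) i * fps_nth (res_fps u) (m - i)\<bar> \<le> M\<^sup>2 / \<rho> ^ m"
        by (simp add: abs_mult)
    qed
    then have "\<bar>?A\<bar> \<le> real (Suc m) * (M\<^sup>2 / \<rho> ^ m)" by simp
    then have "\<bar>t - u\<bar> * \<bar>?A\<bar> \<le> \<bar>t - u\<bar> * (real (Suc m) * (M\<^sup>2 / \<rho> ^ m))"
      by (rule mult_left_mono) simp
    ultimately show ?thesis by (simp only: abs_mult abs_minus_commute[of u t])
  qed
  define L where "L = (M\<^sup>2 + M / X) * S"
  have "\<bar>(\<Sum>m. a t m * y ^ m) - (\<Sum>m. a u m * z ^ m)\<bar> \<le> L * (\<bar>t - u\<bar> + \<bar>y - z\<bar>)"
    if t: "t \<in> {0..1}" "u \<in> {0..1}" and y: "y \<in> {0..X}" "z \<in> {0..X}" for t u y z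
  proof -
    define K where "K = \<bar>t - u\<bar> * M\<^sup>2 + \<bar>y - z\<bar> * (M / X)"
    have trm: "\<bar>a t m * y ^ m - a u m * z ^ m\<bar> \<le> K * (real (Suc m) * (X / \<rho>) ^ m)" for m
    proof -
      have "a t m * y ^ m - a u m * z ^ m = (a t m - a u m) * y ^ m + a u m * (y ^ m - z ^ m)"
        by (simp add: algebra_simps)
      then have "\<bar>a t m * y ^ m - a u m * z ^ m\<bar> \<le> \<bar>a t m - a u m\<bar> * y ^ m + \<bar>a u m\<bar> * \<bar>y ^ m - z ^ m\<bar>"
        using abs_triangle_ineq[of "(a t m - a u m) * y ^ m" "a u m * (y ^ m - z ^ m)"] y
        by (simp add: abs_mult)
      also have "\<dots> \<le> (\<bar>t - u\<bar> * (real (Suc m) * (M\<^sup>2 / \<rho> ^ m))) * X ^ m + (M / \<rho> ^ m) * (real (Suc m) * X ^ m * \<bar>y - z\<bar> / X)"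
      proof (intro add_mono mult_mono)
        show "\<bar>a t m - a u m\<bar> \<le> \<bar>t - u\<bar> * (real (Suc m) * (M\<^sup>2 / \<rho> ^ m))"
          using a by (intro order.trans[OF _ gd[OF t, of m]]) (simp add: coeff_family_def)
        show "y ^ m \<le> X ^ m" using y by (intro power_mono) auto
        show "\<bar>a u m\<bar> \<le> M / \<rho> ^ m"
          using a t by (intro order.trans[OF _ M(2)[of u m]]) (auto simp: coeff_family_def)
        have "\<bar>y ^ m - z ^ m\<bar> * X \<le> real m * X ^ m * \<bar>y - z\<bar>"
          using y by (intro abs_power_diff_le) auto
        also have "\<dots> \<le> real (Suc m) * X ^ m * \<bar>y - z\<bar>"
          using X by (intro mult_right_mono) auto
        finally show "\<bar>y ^ m - z ^ m\<bar> \<le> real (Suc m) * X ^ m * \<bar>y - z\<bar> / X"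
          using X by (simp add: le_divide_eq)
      qed (use M \<rho> X y in auto)
      also have "\<dots> = K * (real (Suc m) * (X / \<rho>) ^ m)"
        unfolding K_def using X \<rho> by (simp add: power_divide field_simps)
      finally show ?thesis .
    qed
    have st: "summable (\<lambda>m. a t m * y ^ m)" "summable (\<lambda>m. a u m * z ^ m)"
      using t y X by (auto intro!: coeff_family_summable(2)[OF a])
    have "\<bar>(\<Sum>m. a t m * y ^ m) - (\<Sum>m. a u m * z ^ m)\<bar> = \<bar>\<Sum>m. a t m * y ^ m - a u m * z ^ m\<bar>"
      using st by (simp add: suminf_diff)
    also have "\<dots> \<le> (\<Sum>m. K * (real (Suc m) * (X / \<rho>) ^ m))"
      using norm_suminf_le[OF _ summable_mult[OF S], of "\<lambda>m. a t m * y ^ m - a u m * z ^ m" K] trm by simp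
    also have "\<dots> = K * S" unfolding S_def using S by (rule suminf_mult)
    also have "\<dots> \<le> L * (\<bar>t - u\<bar> + \<bar>y - z\<bar>)"
    proof -
      have "K \<le> (M\<^sup>2 + M / X) * (\<bar>t - u\<bar> + \<bar>y - z\<bar>)"
        unfolding K_def using M X by (simp add: algebra_simps)
      from mult_right_mono[OF this S0] show ?thesis unfolding L_def by (simp add: ac_simps)
    qed
    finally show ?thesis .
  qed
  moreover have "0 \<le> L" unfolding L_def using S0 M X by simp
  ultimately show ?thesis using that by blast
qed

lemma coeff_family_bdd_lip:
  assumes a: "coeff_family a" and x: "0 \<le> x" "x < pi"
  shows "bdd_lip ({0..1} \<times> {0..1}) (\<lambda>p. \<Sum>m. a (fst p) m * (snd p * x) ^ m)"
proof -
  \<comment> \<open>The Lipschitz estimate needs a positive upper limit even for x = 0; the value 1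
    lies below \<pi>.\<close>
  define X where "X = max 1 x"
  have X: "0 < X" "X < pi" "x \<le> X" using x pi_gt3 by (auto simp: X_def)
  obtain L where L: "0 \<le> L" "\<And>t u y z. t \<in> {0..1} \<Longrightarrow> u \<in> {0..1} \<Longrightarrow> y \<in> {0..X} \<Longrightarrow> z \<in> {0..X} \<Longrightarrow>
    \<bar>(\<Sum>m. a t m * y ^ m) - (\<Sum>m. a u m * z ^ m)\<bar> \<le> L * (\<bar>t - u\<bar> + \<bar>y - z\<bar>)"
    by (rule coeff_family_lipschitz[OF a X(1,2)]) blast
  have in_X: "s * x \<in> {0..X}" if "s \<in> {0..1}" for s
    using that x X(3) mult_mono[of s 1 x X] by auto
  let ?f = "\<lambda>p::real \<times> real. \<Sum>m. a (fst p) m * (snd p * x) ^ m"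
  have lip: "\<bar>?f p - ?f q\<bar> \<le> (L * (1 + X)) * dist p q" if "p \<in> {0..1} \<times> {0..1}" "q \<in> {0..1} \<times> {0..1}" for p q
  proof -
    have "\<bar>?f p - ?f q\<bar> \<le> L * (\<bar>fst p - fst q\<bar> + \<bar>snd p * x - snd q * x\<bar>)"
      using that by (intro L in_X) (auto simp: mem_Times_iff)
    also have "\<dots> \<le> L * (dist p q + dist p q * X)"
    proof (intro mult_left_mono add_mono L)
      show "\<bar>fst p - fst q\<bar> \<le> dist p q" using dist_fst_le[of p q] by (simp add: dist_real_def)
      have "\<bar>snd p * x - snd q * x\<bar> = \<bar>snd p - snd q\<bar> * x"
        using x by (simp add: abs_mult flip: left_diff_distrib)
      also have "\<dots> \<le> dist p q * X"
        using dist_snd_le[of p q] x X by (intro mult_mono) (auto simp: dist_real_def)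
      finally show "\<bar>snd p * x - snd q * x\<bar> \<le> dist p q * X" .
    qed
    finally show ?thesis by (simp add: algebra_simps)
  qed
  have "\<bar>?f p\<bar> \<le> \<bar>?f (0, 0)\<bar> + (L * (1 + X)) * 2" if p: "p \<in> {0..1} \<times> {0..1}" for p
  proof -
    have "dist p (0, 0) \<le> \<bar>fst p\<bar> + \<bar>snd p\<bar>"
      by (cases p) (simp add: dist_Pair_Pair dist_real_def sqrt_sum_squares_le_sum_abs)
    also have "\<dots> \<le> 2" using p by (auto simp: mem_Times_iff)
    finally have "(L * (1 + X)) * dist p (0, 0) \<le> (L * (1 + X)) * 2"
      using L X by (intro mult_left_mono) auto
    then show ?thesis using lip[OF p, of "(0, 0)"] by simp
  qed
  then show ?thesis
    unfolding bdd_lip_def using lip L(1) X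
    by (intro exI[of _ "\<bar>?f (0, 0)\<bar> + (L * (1 + X)) * 2"] exI[of _ "L * (1 + X)"]) auto
qed

lemma coeff_family_abs: "coeff_family (\<lambda>t m. \<bar>fps_nth (res_fps t) m\<bar>)"
  unfolding coeff_family_def by (auto intro: abs_triangle_ineq3)

lemma coeff_family_sign:
  assumes "\<And>m. \<bar>\<epsilon> m\<bar> \<le> 1"
  shows "coeff_family (\<lambda>t m. \<epsilon> m * fps_nth (res_fps t) m)"
  unfolding coeff_family_def
  using assms mult_left_le_one_le[of _ "\<bar>\<epsilon> _\<bar>"] by (auto simp: abs_mult simp flip: right_diff_distrib)

section \<open>Convergence\<close>

definition bch_den :: "nat \<Rightarrow> real \<Rightarrow> (nat \<Rightarrow> real) \<Rightarrow> real" where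
  "bch_den n t x = word_den ((1 - t) * t) (\<lambda>i. res_sum t (x i)) n"

definition bch_num :: "nat \<Rightarrow> real \<Rightarrow> (nat \<Rightarrow> real) \<Rightarrow> real" where
  "bch_num n t x = word_num ((1 - t) * t) (\<lambda>i. res_sum t (x i)) n"

lemma run_wt_abs_eq:
  fixes x :: "nat \<Rightarrow> real"
  assumes "0 \<le> t" "t \<le> 1" "\<And>i. 0 \<le> x i"
  shows "run_wt (1 - t) t (\<lambda>i m. \<bar>fps_nth (res_fps t) m\<bar> * x i ^ m) w
    = \<bar>run_wt (1 - t) (- t) (\<lambda>_. fps_nth (res_fps t)) w\<bar> * prod_list (map x w)"
  unfolding run_wt_mult_power abs_run_wt using assms by simp

lemma run_wt_abs_sum_le:
  assumes t: "0 \<le> t" "t \<le> 1" and x: "\<And>i. 0 \<le> x i" "\<And>i. i \<in> {1..n} \<Longrightarrow> x i < pi"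
    and den: "0 < bch_den n t x" and W: "finite W" "W \<subseteq> lists {1..n}"
  shows "(\<Sum>w\<in>W. run_wt (1 - t) t (\<lambda>i m. \<bar>fps_nth (res_fps t) m\<bar> * x i ^ m) w) \<le> bch_num n t x / bch_den n t x"
proof -
  have "sum (run_wt (1 - t) t (\<lambda>i m. \<bar>fps_nth (res_fps t) m\<bar> * x i ^ m)) W
    \<le> word_num ((1 - t) * t) (\<lambda>i. suminf (\<lambda>m. \<bar>fps_nth (res_fps t) m\<bar> * x i ^ m)) n
      / word_den ((1 - t) * t) (\<lambda>i. suminf (\<lambda>m. \<bar>fps_nth (res_fps t) m\<bar> * x i ^ m)) n"
    by (rule run_wt_sum_bounded)
      (use t x W den in \<open>auto intro: res_fps_summable simp: bch_den_def res_sum_def\<close>)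
  then show ?thesis by (simp add: bch_den_def bch_num_def res_sum_def)
qed

lemma prod_list_map_cong_lists:
  assumes "w \<in> lists A" "\<And>i. i \<in> A \<Longrightarrow> f i = g i"
  shows "prod_list (map f w) = prod_list (map g w)"
  using assms by (intro arg_cong[of _ _ prod_list] map_cong) auto

lemma Gamma_real_cong:
  assumes "\<And>i. i \<in> {1..n} \<Longrightarrow> x i = y i"
  shows "Gamma_real n x = Gamma_real n y"
  unfolding Gamma_real_def
proof (rule infsum_cong)
  fix w assume "w \<in> lists {1..n}"
  then have "prod_list (map x w) = prod_list (map y w)"
    by (rule prod_list_map_cong_lists) (rule assms)
  then show "ennreal (Gamma_abs n w * prod_list (map x w)) = ennreal (Gamma_abs n w * prod_list (map y w))"
    by simp
qed

lemma Gamma_real_eq_SUP: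
  "Gamma_real n x = (SUP W\<in>{W. finite W \<and> W \<subseteq> lists {1..n}}.
     \<Sum>w\<in>W. ennreal (\<bar>bch n w\<bar> * prod_list (map x w)))"
  unfolding Gamma_real_def Gamma_abs_def by (rule nonneg_infsum_complete) simp

lemma prod_list_nonneg:
  fixes x :: "'a \<Rightarrow> real"
  assumes "\<And>i. 0 \<le> x i"
  shows "0 \<le> prod_list (map x w)"
  using assms by (induction w) auto

lemma Gamma_real_partial_sum:
  assumes x: "\<And>i. 0 \<le> x i" and W: "finite W" "W \<subseteq> lists {1..n}"
  shows "ennreal (\<Sum>w\<in>W. \<bar>bch n w\<bar> * prod_list (map x w)) \<le> Gamma_real n x"
proof -
  have "ennreal (\<Sum>w\<in>W. \<bar>bch n w\<bar> * prod_list (map x w))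
    = (\<Sum>w\<in>W. ennreal (\<bar>bch n w\<bar> * prod_list (map x w)))"
    using prod_list_nonneg[of x, OF x] by (intro sum_ennreal[symmetric]) auto
  then show ?thesis
    unfolding Gamma_real_eq_SUP using W by (auto intro!: SUP_upper2[where i = W])
qed

lemma bch_den_continuous:
  assumes "\<And>i. i \<in> {1..n} \<Longrightarrow> 0 \<le> x i" "\<And>i. i \<in> {1..n} \<Longrightarrow> x i < pi"
  shows "continuous_on ({0..1} \<times> {0..1}) (\<lambda>p. bch_den n (fst p) (\<lambda>i. snd p * x i))"
    "continuous_on ({0..1} \<times> {0..1}) (\<lambda>p. bch_num n (fst p) (\<lambda>i. snd p * x i))"
proof -
  have q: "bdd_lip ({0..1} \<times> {0..1}) (\<lambda>p::real \<times> real. (1 - fst p) * fst p)"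
    by (intro bdd_lip_mult bdd_lip_diff bdd_lip_const bdd_lip_coordinate)
  have "bdd_lip ({0..1} \<times> {0..1}) (\<lambda>p. res_sum (fst p) (snd p * x i))" if "i \<in> {1..n}" for i
    using coeff_family_bdd_lip[OF coeff_family_abs, of "x i"] assms that by (simp add: res_sum_def)
  then show "continuous_on ({0..1} \<times> {0..1}) (\<lambda>p. bch_den n (fst p) (\<lambda>i. snd p * x i))"
    "continuous_on ({0..1} \<times> {0..1}) (\<lambda>p. bch_num n (fst p) (\<lambda>i. snd p * x i))"
    unfolding bch_den_def bch_num_def
    using bdd_lip_word_den_word_num[OF q, where r = "\<lambda>p i. res_sum (fst p) (snd p * x i)"]
    by (auto intro!: bdd_lip_continuous_on)
qed

lemma bch_den_ratio_bounded:
  assumes x: "\<And>i. i \<in> {1..n} \<Longrightarrow> 0 \<le> x i" "\<And>i. i \<in> {1..n} \<Longrightarrow> x i < pi"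
    and den: "\<And>t. t \<in> {0..1} \<Longrightarrow> 0 < bch_den n t x"
  obtains C where "\<And>t. t \<in> {0..1} \<Longrightarrow> bch_num n t x / bch_den n t x \<le> C"
proof -
  have p: "continuous_on {0..1} (\<lambda>t::real. (t, 1::real))" "(\<lambda>t. (t, 1)) ` {0..1} \<subseteq> {0..1::real} \<times> {0..1::real}"
    by (auto intro!: continuous_intros)
  have c: "continuous_on {0..1} (\<lambda>t. bch_den n t x)" "continuous_on {0..1} (\<lambda>t. bch_num n t x)"
    using continuous_on_compose2[OF bch_den_continuous(1)[OF x] p] continuous_on_compose2[OF bch_den_continuous(2)[OF x] p]
    by simp_all
  have "continuous_on {0..1} (\<lambda>t. bch_num n t x / bch_den n t x)"
    using den by (intro continuous_on_divide c) force
  then obtain u where "\<forall>t\<in>{0..1}. bch_num n t x / bch_den n t x \<le> bch_num n u x / bch_den n u x"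
    using continuous_attains_sup[of "{0..1::real}" "\<lambda>t. bch_num n t x / bch_den n t x"] by auto
  then show ?thesis using that by blast
qed

lemma Gamma_real_finite:
  assumes x: "\<And>i. 0 \<le> x i" "\<And>i. i \<in> {1..n} \<Longrightarrow> x i < pi"
    and den: "\<And>t. t \<in> {0..1} \<Longrightarrow> 0 < bch_den n t x"
  shows "Gamma_real n x < \<infinity>"
proof -
  obtain C where C: "\<And>t. t \<in> {0..1} \<Longrightarrow> bch_num n t x / bch_den n t x \<le> C"
    by (rule bch_den_ratio_bounded[of n x]) (use x den in auto)
  have "(\<Sum>w\<in>W. \<bar>bch n w\<bar> * prod_list (map x w)) \<le> C" if W: "finite W" "W \<subseteq> lists {1..n}" for W
  proof -
    define F where "F t w = run_wt (1 - t) (- t) (\<lambda>_::nat. fps_nth (res_fps t)) w" for t w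
    \<comment> \<open>Inserting the sign of each coefficient writes the absolute sum as a single
      integral, whose integrand is then majorized for each t.\<close>
    define c where "c w = sgn (bch n w) * prod_list (map x w)" for w
    have "((\<lambda>t. \<Sum>w\<in>W. F t w * c w) has_integral (\<Sum>w\<in>W. bch n w * c w)) {0..1}"
      unfolding F_def using W
      by (intro has_integral_sum has_integral_mult_left bch_has_integral) auto
    moreover have "((\<lambda>t. C) has_integral C) {0..1::real}"
      using has_integral_const_real[of C 0 1] by simp
    moreover have "(\<Sum>w\<in>W. F t w * c w) \<le> C" if t: "t \<in> {0..1}" for t
    proof -
      have "(\<Sum>w\<in>W. F t w * c w) \<le> (\<Sum>w\<in>W. run_wt (1 - t) t (\<lambda>i m. \<bar>fps_nth (res_fps t) m\<bar> * x i ^ m) w)"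
      proof (rule sum_mono)
        fix w
        have "F t w * c w = (F t w * sgn (bch n w)) * prod_list (map x w)" by (simp add: c_def)
        also have "\<dots> \<le> \<bar>F t w\<bar> * prod_list (map x w)"
        proof (rule mult_right_mono)
          have "F t w * sgn (bch n w) \<le> \<bar>F t w\<bar> * \<bar>sgn (bch n w)\<bar>" by (metis abs_ge_self abs_mult)
          also have "\<dots> \<le> \<bar>F t w\<bar>" by (simp add: abs_sgn_eq)
          finally show "F t w * sgn (bch n w) \<le> \<bar>F t w\<bar>" .
        qed (rule prod_list_nonneg[OF x(1)])
        finally show "F t w * c w \<le> run_wt (1 - t) t (\<lambda>i m. \<bar>fps_nth (res_fps t) m\<bar> * x i ^ m) w"
          using t x(1) by (subst run_wt_abs_eq) (auto simp: F_def)
      qed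
      also have "\<dots> \<le> bch_num n t x / bch_den n t x"
        using t x den W by (intro run_wt_abs_sum_le) auto
      finally show ?thesis using C[OF t] by linarith
    qed
    ultimately have "(\<Sum>w\<in>W. bch n w * c w) \<le> C" by (rule has_integral_le)
    then show ?thesis by (simp add: c_def abs_sgn mult.assoc)
  qed
  then have "Gamma_real n x \<le> ennreal C"
    unfolding Gamma_real_eq_SUP
    using prod_list_nonneg[of x, OF x(1)] by (intro SUP_least) (auto simp: sum_ennreal intro!: ennreal_leI)
  then show ?thesis by (simp add: le_less_trans[OF _ ennreal_less_top])
qed

lemma word_den_single:
  assumes "\<And>i. i \<in> {1..n} \<Longrightarrow> i \<noteq> j \<Longrightarrow> r i = 0"
  shows "word_den q r n = 1"
proof -
  have "word_den q r n = 1 \<and> (j \<notin> {1..n} \<longrightarrow> word_num q r n = 0)"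
    using assms
  proof (induction n)
    case (Suc n)
    then show ?case by (cases "j = Suc n") auto
  qed simp
  then show ?thesis by simp
qed

text \<open>Turns the unordered sum into the limit of a sequence, as dominated convergence
  requires.\<close>

lemma has_sum_by_length:
  fixes f :: "nat list \<Rightarrow> real"
  assumes "f summable_on lists {1..n}"
  shows "(\<lambda>k. sum f {w \<in> lists {1..n}. length w \<le> k}) \<longlonglongrightarrow> infsum f (lists {1..n})"
proof -
  have "filterlim (\<lambda>k. {w \<in> lists {1..n}. length w \<le> k}) (finite_subsets_at_top (lists {1..n})) sequentially"
    unfolding filterlim_iff eventually_finite_subsets_at_top
  proof safe
    fix P X
    assume X: "finite X" "X \<subseteq> lists {1..n}"
      and P: "\<forall>Y. finite Y \<and> X \<subseteq> Y \<and> Y \<subseteq> lists {1..n} \<longrightarrow> P Y"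
    obtain L where L: "\<And>w. w \<in> X \<Longrightarrow> length w \<le> L"
      using X(1) by (metis finite_imageI finite_nat_set_iff_bounded_le image_eqI)
    show "\<forall>\<^sub>F k in sequentially. P {w \<in> lists {1..n}. length w \<le> k}"
      using eventually_ge_at_top[of L]
    proof eventually_elim
      case (elim k)
      have "X \<subseteq> {w \<in> lists {1..n}. length w \<le> k}" using X(2) L elim by fastforce
      then show ?case using P finite_lists_length_le'[of n k] by blast
    qed
  qed
  then show ?thesis
    using has_sum_infsum[OF assms] unfolding has_sum_def by (rule filterlim_compose[rotated])
qed

section \<open>Divergence at the critical point\<close>

lemma run_wt_le_1:
  assumes "0 \<le> a" "a \<le> 1" "0 \<le> b" "b \<le> 1" "\<And>i m. 0 \<le> \<gamma> i m" "\<And>i m. \<gamma> i m \<le> 1"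
  shows "run_wt a b \<gamma> w \<le> 1"
proof (induction w rule: length_induct)
  case (1 w)
  show ?case
  proof (cases w)
    case (Cons i u)
    define v where "v = dropWhile (\<lambda>x. x = i) u"
    have "length v < length w" by (simp add: Cons v_def le_imp_less_Suc length_dropWhile_le)
    then have "run_wt a b \<gamma> v \<le> 1" "0 \<le> run_wt a b \<gamma> v" using 1 run_wt_nonneg[of a b \<gamma> v] assms by auto
    then have "step_weight a b (run_wt a b \<gamma>) i v \<le> 1" "0 \<le> step_weight a b (run_wt a b \<gamma>) i v"
      using assms by (auto simp: step_weight_def mult_le_one)
    then show ?thesis using assms by (simp add: Cons v_def[symmetric] mult_le_one)
  qed simp
qed

lemma bch_den_nonneg_limit:
  assumes x: "\<And>i. i \<in> {1..n} \<Longrightarrow> 0 \<le> x i" "\<And>i. i \<in> {1..n} \<Longrightarrow> x i < pi"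
    and sub: "\<And>l. l \<in> {0..<1} \<Longrightarrow> 0 < bch_den n t (\<lambda>i. l * x i)" and t: "t \<in> {0..1}"
  shows "0 \<le> bch_den n t x"
proof (rule LIMSEQ_le_const)
  have lim: "(\<lambda>k. (t, real k / real (Suc k))) \<longlonglongrightarrow> (t, 1)"
    using LIMSEQ_n_over_Suc_n by (intro tendsto_Pair tendsto_const) auto
  have frac: "real k / real (Suc k) \<in> {0..<1}" for k by simp
  have "(\<lambda>k. bch_den n (fst (t, real k / real (Suc k))) (\<lambda>i. snd (t, real k / real (Suc k)) * x i))
    \<longlonglongrightarrow> bch_den n (fst (t, 1 :: real)) (\<lambda>i. snd (t, 1) * x i)"
    by (rule continuous_on_tendsto_compose[OF bch_den_continuous(1)[OF x] lim]) (use t frac in \<open>auto intro: less_imp_le\<close>)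
  then show "(\<lambda>k. bch_den n t (\<lambda>i. (real k / real (Suc k)) * x i)) \<longlonglongrightarrow> bch_den n t x"
    by simp
  show "\<exists>N. \<forall>k\<ge>N. 0 \<le> bch_den n t (\<lambda>i. (real k / real (Suc k)) * x i)"
    using sub frac by (meson less_imp_le)
qed

lemma has_integral_inverse_shift:
  fixes a c h \<kappa> :: real
  assumes "0 < \<kappa>" "0 \<le> h"
  shows "((\<lambda>u. c / (u - a + \<kappa>)) has_integral c * (ln (h + \<kappa>) - ln \<kappa>)) {a..a + h}"
proof -
  have "((\<lambda>u. c / (u - a + \<kappa>)) has_integral c * ln (a + h - a + \<kappa>) - c * ln (a - a + \<kappa>)) {a..a + h}"
  proof (rule fundamental_theorem_of_calculus[where f = "\<lambda>u. c * ln (u - a + \<kappa>)"])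
    fix u assume "u \<in> {a..a + h}"
    then have "0 < u - a + \<kappa>" using assms by auto
    then have "((\<lambda>u. c * ln (u - a + \<kappa>)) has_field_derivative c / (u - a + \<kappa>)) (at u within {a..a + h})"
      by (auto intro!: derivative_eq_intros simp: field_simps)
    then show "((\<lambda>u. c * ln (u - a + \<kappa>)) has_vector_derivative c / (u - a + \<kappa>)) (at u within {a..a + h})"
      by (simp add: has_real_derivative_iff_has_vector_derivative)
  qed (use assms in auto)
  then show ?thesis by (simp add: algebra_simps)
qed

text \<open>
  Test the absolute series against the signs \<open>\<epsilon>\<close> that the one-letter coefficients have at the critical
  parameter \<open>ts\<close>. The signed sum is an integral of \<open>N / d\<close>, which is bounded below because \<open>N > 0\<close>
  wherever \<open>d\<close> vanishes; as \<open>d\<close> is Lipschitz and vanishes at \<open>(ts, 1)\<close>, the integral grows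
  logarithmically when the scale \<open>l\<close> tends to 1.
\<close>

lemma Gamma_real_infinite_critical:
  assumes x0: "\<And>i. 0 \<le> x i" and xpi: "\<And>i. i \<in> {1..n} \<Longrightarrow> x i < pi"
    and sub: "\<And>l t. l \<in> {0..<1} \<Longrightarrow> t \<in> {0..1} \<Longrightarrow> 0 < bch_den n t (\<lambda>i. l * x i)"
    and ts: "ts \<in> {0..1}" "bch_den n ts x = 0"
  shows "Gamma_real n x = \<infinity>"
proof (rule ccontr)
  assume fin: "Gamma_real n x \<noteq> \<infinity>"
  define B where "B = enn2real (Gamma_real n x)"
  have B0: "0 \<le> B" by (simp add: B_def)
  have GB: "Gamma_real n x = ennreal B" using fin by (simp add: B_def less_top)
  have B: "(\<Sum>w\<in>W. \<bar>bch n w\<bar> * prod_list (map x w)) \<le> B" if "finite W" "W \<subseteq> lists {1..n}" for W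
    using Gamma_real_partial_sum[of x W n] x0 that B0 unfolding GB by simp
  define \<epsilon> where "\<epsilon> m = sgn (fps_nth (res_fps ts) m)" for m
  have \<epsilon>1: "\<bar>\<epsilon> m\<bar> \<le> 1" for m by (simp add: \<epsilon>_def abs_sgn_eq)
  define a where "a t m = \<epsilon> m * fps_nth (res_fps t) m" for t m
  have fam: "coeff_family a" unfolding a_def[abs_def] using \<epsilon>1 by (rule coeff_family_sign)
  define \<rho> where "\<rho> t l i = (\<Sum>m. a t m * (l * x i) ^ m)" for t l i
  define d N where "d p = word_den ((1 - fst p) * fst p) (\<rho> (fst p) (snd p)) n"
    and "N p = word_num ((1 - fst p) * fst p) (\<rho> (fst p) (snd p)) n" for p
  define S where "S = {0..1::real} \<times> {0..1::real}"
  have lx: "0 \<le> l * x i" "l * x i < pi" if "l \<in> {0..1}" "i \<in> {1..n}" for l i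
    using that x0[of i] xpi[of i] mult_right_mono[of l 1 "x i"] by auto
  have \<rho>_le: "\<bar>\<rho> t l i\<bar> \<le> res_sum t (l * x i)" if "t \<in> {0..1}" "l \<in> {0..1}" "i \<in> {1..n}" for t l i
    unfolding \<rho>_def using that lx by (intro coeff_family_summable(3)[OF fam]) auto
  have q: "bdd_lip S (\<lambda>p. (1 - fst p) * fst p)"
    unfolding S_def by (intro bdd_lip_mult bdd_lip_diff bdd_lip_const bdd_lip_coordinate)
  have "bdd_lip S (\<lambda>p. \<rho> (fst p) (snd p) i)" if "i \<in> {1..n}" for i
    unfolding S_def \<rho>_def using x0 xpi that by (intro coeff_family_bdd_lip[OF fam]) auto
  then have bdd_lip: "bdd_lip S d" "bdd_lip S N"
    unfolding d_def[abs_def] N_def[abs_def]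
    using bdd_lip_word_den_word_num[OF q, where r = "\<lambda>p. \<rho> (fst p) (snd p)"] by auto
  have bch_den_le: "bch_den n (fst p) (\<lambda>i. snd p * x i) \<le> d p" if "p \<in> S" for p
    unfolding bch_den_def d_def using that \<rho>_le
    by (intro word_den_mono[THEN conjunct2]) (auto simp: S_def)
  have kden0: "0 \<le> bch_den n t x" if "t \<in> {0..1}" for t
    using bch_den_nonneg_limit[OF _ _ _ that, of n x] x0 xpi sub that by auto
  have d_pos: "0 < d (t, l)" if "t \<in> {0..1}" "l \<in> {0..<1}" for t l
    using bch_den_le[of "(t, l)"] sub[OF that(2,1)] that by (auto simp: S_def)
  have d1: "0 \<le> d (t, 1)" if "t \<in> {0..1}" for t
    using bch_den_le[of "(t, 1)"] kden0[OF that] that by (auto simp: S_def)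

  \<comment> \<open>At a zero of d no entry of \<rho> is negative: such an entry would be strictly
    smaller in modulus than its majorant, and strict monotonicity would push \<open>bch_den\<close>
    below 0. With nonnegative entries, d + t N is a product that is at least 1.\<close>
  have crit: "0 < N (t, 1)" if t: "t \<in> {0..1}" and d0: "d (t, 1) = 0" for t
  proof -
    have "t \<noteq> 0" "t \<noteq> 1"
      using d0 by (auto simp: d_def)
    then have t01: "0 < t" "t < 1" using t by auto
    have nonneg: "0 \<le> \<rho> t 1 j" if j: "j \<in> {1..n}" for j
    proof (rule ccontr)
      assume neg: "\<not> 0 \<le> \<rho> t 1 j"
      have xj: "0 < x j"
      proof (rule ccontr)
        assume "\<not> 0 < x j"
        then have "x j = 0" using x0[of j] by simp
        then show False using neg \<rho>_le[OF t _ j, of 1] by simp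
      qed
      \<comment> \<open>The linear coefficient is 1 for every t, so its frozen sign is 1 and the
        term x j is counted positively in both series.\<close>
      have "2 * x j \<le> res_sum t (x j) + \<rho> t 1 j"
      proof -
        have s: "summable (\<lambda>m. \<bar>fps_nth (res_fps t) m\<bar> * x j ^ m)" "summable (\<lambda>m. a t m * x j ^ m)"
          using t xj xpi[OF j] by (auto intro!: res_fps_summable coeff_family_summable(2)[OF fam])
        have nn: "0 \<le> (\<bar>fps_nth (res_fps t) m\<bar> + a t m) * x j ^ m" for m
        proof -
          have "\<bar>a t m\<bar> \<le> \<bar>fps_nth (res_fps t) m\<bar>" using fam by (simp add: coeff_family_def)
          then show ?thesis using xj by (intro mult_nonneg_nonneg) auto
        qed
        have "res_sum t (x j) + \<rho> t 1 j = (\<Sum>m. (\<bar>fps_nth (res_fps t) m\<bar> + a t m) * x j ^ m)"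
          unfolding res_sum_def \<rho>_def using suminf_add[OF s] by (simp add: distrib_right)
        moreover have "sum (\<lambda>m. (\<bar>fps_nth (res_fps t) m\<bar> + a t m) * x j ^ m) {1}
          \<le> (\<Sum>m. (\<bar>fps_nth (res_fps t) m\<bar> + a t m) * x j ^ m)"
          using summable_add[OF s] nn by (intro sum_le_suminf) (auto simp: distrib_right)
        ultimately show ?thesis by (simp add: a_def \<epsilon>_def)
      qed
      then have less: "\<bar>\<rho> t 1 j\<bar> < res_sum t (x j)" using neg xj by linarith
      \<comment> \<open>Without a second positive letter d would equal 1 instead of 0.\<close>
      have "\<exists>i\<in>{1..n}. i \<noteq> j \<and> 0 < res_sum t (x i)"
      proof (rule ccontr)
        assume no: "\<not> ?thesis"
        have "\<rho> t 1 i = 0" if "i \<in> {1..n}" "i \<noteq> j" for i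
          using \<rho>_le[OF t _ that(1), of 1] no that by force
        then have "d (t, 1) = 1" unfolding d_def by (intro word_den_single[of n j]) auto
        then show False using d0 by simp
      qed
      then obtain i where i: "i \<in> {1..n}" "i \<noteq> j" "0 < res_sum t (x i)" by blast
      have "bch_den n t x < d (t, 1)"
        unfolding bch_den_def d_def fst_conv snd_conv
        using word_den_strict_mono[of "1 - t" t n "\<rho> t 1" "\<lambda>i. res_sum t (x i)" j] t01 i j less \<rho>_le[OF t, of 1]
        by auto
      then show False using d0 kden0[OF t] by simp
    qed
    have "d (t, 1) + t * N (t, 1) = (\<Prod>i=1..n. 1 + t * \<rho> t 1 i)"
      unfolding d_def N_def by (simp add: word_den_add_word_num)
    moreover have "1 \<le> (\<Prod>i=1..n. 1 + t * \<rho> t 1 i)"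
      using nonneg t by (intro prod_ge_1) auto
    ultimately have "0 < t * N (t, 1)" using d0 by linarith
    then show ?thesis using t01 by (simp add: zero_less_mult_iff)
  qed

  have cN: "continuous_on S N" and cd: "continuous_on S d" using bdd_lip bdd_lip_continuous_on by auto
  have cS: "compact S" unfolding S_def by (intro compact_Times) auto
  \<comment> \<open>On the compact set where N \<le> 0, d has a positive minimum by
    \<open>crit\<close>, \<open>d1\<close> and \<open>d_pos\<close>; off this set the quotient is
    positive.\<close>
  obtain C where C0: "0 \<le> C" and C: "\<And>t l. t \<in> {0..1} \<Longrightarrow> l \<in> {0..<1} \<Longrightarrow> - C \<le> N (t, l) / d (t, l)"
  proof -
    define Z where "Z = S \<inter> N -` {..0}"
    have "closed Z" unfolding Z_def by (rule continuous_closed_preimage[OF cN compact_imp_closed[OF cS] closed_atMost])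
    then have cZ: "compact Z" using compact_Int_closed[OF cS, of Z] by (simp add: Z_def Int_assoc[symmetric])
    show thesis
    proof (cases "Z = {}")
      case True
      have "- 0 \<le> N (t, l) / d (t, l)" if "t \<in> {0..1}" "l \<in> {0..<1}" for t l
      proof -
        have "(t, l) \<notin> Z" using True by simp
        then have "0 < N (t, l)" using that by (auto simp: Z_def S_def)
        then show ?thesis using d_pos[OF that] by simp
      qed
      then show ?thesis using that[of 0] by blast
    next
      case False
      have ZS: "Z \<subseteq> S" by (auto simp: Z_def)
      obtain p0 where p0: "p0 \<in> Z" "\<And>p. p \<in> Z \<Longrightarrow> d p0 \<le> d p"
        using continuous_attains_inf[OF cZ False continuous_on_subset[OF cd ZS]] by blast
      obtain p1 where p1: "p1 \<in> Z" "\<And>p. p \<in> Z \<Longrightarrow> N p1 \<le> N p"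
        using continuous_attains_inf[OF cZ False continuous_on_subset[OF cN ZS]] by blast
      have "0 < d p0"
      proof -
        obtain t l where p: "p0 = (t, l)" by (cases p0)
        have tl: "t \<in> {0..1}" "l \<in> {0..1}" "N (t, l) \<le> 0" using p0(1) p by (auto simp: Z_def S_def)
        show ?thesis
        proof (cases "l = 1")
          case True
          then show ?thesis using crit[OF tl(1)] d1[OF tl(1)] tl(3) p by fastforce
        next
          case False
          then show ?thesis using d_pos[of t l] tl p by auto
        qed
      qed
      have N1: "N p1 \<le> 0" using p1(1) by (auto simp: Z_def)
      have "- (- N p1 / d p0) \<le> N (t, l) / d (t, l)" if "t \<in> {0..1}" "l \<in> {0..<1}" for t l
      proof (cases "(t, l) \<in> Z")
        case True
        have "N p1 / d p0 \<le> N (t, l) / d p0" using p1(2)[OF True] \<open>0 < d p0\<close> by (intro divide_right_mono) auto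
        also have "\<dots> \<le> N (t, l) / d (t, l)"
          using True \<open>0 < d p0\<close> p0(2)[OF True] by (intro divide_left_mono_neg) (auto simp: Z_def)
        finally show ?thesis by simp
      next
        case False
        then have "0 < N (t, l)" using that by (auto simp: Z_def S_def)
        then have "0 < N (t, l) / d (t, l)" using d_pos[OF that] by simp
        moreover have "- (- N p1 / d p0) \<le> 0" using N1 \<open>0 < d p0\<close> by (simp add: divide_nonpos_pos)
        ultimately show ?thesis by linarith
      qed
      moreover have "0 \<le> - N p1 / d p0" using N1 \<open>0 < d p0\<close> by (intro divide_nonneg_pos) auto
      ultimately show ?thesis using that[of "- N p1 / d p0"] by blast
    qed
  qed

  \<comment> \<open>Below scale 1 the truncated signed word sums are bounded uniformly in t and
    converge to N / d. Each of them integrates to a signed sum of coefficients of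
    \<open>bch n\<close>, which is at most B.\<close>
  have int: "(\<lambda>t. N (t, l) / d (t, l)) integrable_on {0..1}"
    "integral {0..1} (\<lambda>t. N (t, l) / d (t, l)) \<le> B" if l: "l \<in> {0..<1}" for l
  proof -
    define y where "y i = l * x i" for i
    have y0: "0 \<le> y i" for i using l x0 by (simp add: y_def)
    have yx: "y i \<le> x i" for i using l x0[of i] mult_right_mono[of l 1 "x i"] by (simp add: y_def)
    have ypi: "y i < pi" if "i \<in> {1..n}" for i using yx[of i] xpi[OF that] by simp
    have deny: "0 < bch_den n t y" if "t \<in> {0..1}" for t using sub[OF l that] by (simp add: y_def[abs_def])
    obtain K where K: "\<And>t. t \<in> {0..1} \<Longrightarrow> bch_num n t y / bch_den n t y \<le> K"
      by (rule bch_den_ratio_bounded[of n y]) (use y0 ypi deny in auto)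
    \<comment> \<open>The factor - 1 per descent cancels the sign of (- t)^des, and \<epsilon>
      cancels the signs of the run coefficients at \<open>ts\<close>, so F * E equals |F| at t =
      ts.\<close>
    define E where "E = run_wt 1 (- 1) (\<lambda>(_::nat) m. \<epsilon> m)"
    have E1: "\<bar>E w\<bar> \<le> 1" for w
      unfolding E_def abs_run_wt using \<epsilon>1 by (intro run_wt_le_1) auto
    define F where "F t = run_wt (1 - t) (- t) (\<lambda>_::nat. fps_nth (res_fps t))" for t
    define A where "A t = run_wt (1 - t) t (\<lambda>i m. \<bar>fps_nth (res_fps t) m\<bar> * y i ^ m)" for t
    define w' where "w' t = run_wt (1 - t) t (\<lambda>i m. a t m * y i ^ m)" for t
    have w': "w' t w = F t w * (E w * prod_list (map y w))" for t w
    proof (cases "w = []")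
      case False
      have "run_wt (1 - t) t (\<lambda>_::nat. a t) w = E w * F t w"
        using run_wt_mult[OF False, of 1 "1 - t" "-1" "- t" "\<lambda>_ m. \<epsilon> m" "\<lambda>_. fps_nth (res_fps t)"]
        by (simp add: E_def F_def a_def[abs_def])
      then show ?thesis unfolding w'_def run_wt_mult_power by simp
    qed (simp add: w'_def F_def)
    have A: "A t w = \<bar>F t w\<bar> * prod_list (map y w)" if "t \<in> {0..1}" for t w
      unfolding A_def F_def using that y0 by (intro run_wt_abs_eq) auto
    have w'A: "\<bar>w' t w\<bar> \<le> A t w" if "t \<in> {0..1}" for t w
    proof -
      have "\<bar>w' t w\<bar> = \<bar>E w\<bar> * (\<bar>F t w\<bar> * prod_list (map y w))"
        using prod_list_nonneg[of y w, OF y0] by (simp add: w' abs_mult)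
      also have "\<dots> \<le> 1 * (\<bar>F t w\<bar> * prod_list (map y w))"
        using E1 prod_list_nonneg[of y w, OF y0] by (intro mult_right_mono) auto
      finally show ?thesis using A[OF that] by simp
    qed
    have AK: "sum (A t) W \<le> K" if "t \<in> {0..1}" "finite W" "W \<subseteq> lists {1..n}" for t W
    proof -
      have "sum (A t) W \<le> bch_num n t y / bch_den n t y"
        unfolding A_def using that y0 ypi deny by (intro run_wt_abs_sum_le) auto
      then show ?thesis using K[OF that(1)] by linarith
    qed
    have summ: "w' t summable_on lists {1..n}" if t: "t \<in> {0..1}" for t
    proof -
      have "A t summable_on lists {1..n}"
      proof (rule nonneg_bdd_above_summable_on)
        show "bdd_above (sum (A t) ` {W. W \<subseteq> lists {1..n} \<and> finite W})"
          using AK[OF t] by (intro bdd_aboveI2[of _ _ K]) auto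
        show "0 \<le> A t w" for w using w'A[OF t, of w] by linarith
      qed
      then have "(\<lambda>w. norm (w' t w)) summable_on lists {1..n}"
        by (rule Infinite_Sum.abs_summable_on_comparison_test') (use w'A[OF t] in auto)
      then show ?thesis using summable_on_iff_abs_summable_on_real by blast
    qed
    have inf: "infsum (w' t) (lists {1..n}) = N (t, l) / d (t, l)" if t: "t \<in> {0..1}" for t
    proof -
      have "infsum (w' t) (lists {1..n}) * word_den ((1 - t) * t) (\<lambda>i. \<Sum>m. a t m * y i ^ m) n
        = word_num ((1 - t) * t) (\<lambda>i. \<Sum>m. a t m * y i ^ m) n"
        unfolding w'_def
      proof (rule run_wt_infsum)
        show "summable (\<lambda>m. \<bar>a t m * y i ^ m\<bar>)" if "i \<in> {1..n}" for i
          using t y0 ypi[OF that] by (intro coeff_family_summable(1)[OF fam]) auto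
        show "run_wt (1 - t) t (\<lambda>i m. a t m * y i ^ m) summable_on lists {1..n}"
          using summ[OF t] by (simp add: w'_def)
      qed (auto simp: a_def)
      then have "infsum (w' t) (lists {1..n}) * d (t, l) = N (t, l)"
        by (simp add: d_def N_def \<rho>_def[abs_def] y_def)
      then show ?thesis using d_pos[OF t l] by (simp add: field_simps)
    qed
    define W where "W k = {w \<in> lists {1..n}. length w \<le> k}" for k
    have W: "finite (W k)" "W k \<subseteq> lists {1..n}" for k
      using finite_lists_length_le'[of n k] by (auto simp: W_def)
    have hi: "((\<lambda>t. sum (w' t) (W k)) has_integral (\<Sum>w\<in>W k. bch n w * (E w * prod_list (map y w)))) {0..1}" for k
      unfolding w' F_def using W[of k]
      by (intro has_integral_sum has_integral_mult_left bch_has_integral) auto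
    have le: "norm (sum (w' t) (W k)) \<le> K" if "t \<in> {0..1}" for t k
    proof -
      have "norm (sum (w' t) (W k)) \<le> sum (A t) (W k)"
        using w'A[OF that] by (intro sum_norm_le) auto
      then show ?thesis using AK[OF that W] by (rule order.trans)
    qed
    have conv: "(\<lambda>k. sum (w' t) (W k)) \<longlonglongrightarrow> N (t, l) / d (t, l)" if "t \<in> {0..1}" for t
      unfolding W_def inf[OF that, symmetric] using summ[OF that] by (rule has_sum_by_length)
    have hk: "(\<lambda>_. K) integrable_on {0..1::real}" by (rule integrable_const_ivl)
    have intk: "(\<lambda>t. sum (w' t) (W k)) integrable_on {0..1}" for k
      using hi by (rule has_integral_integrable)
    show "(\<lambda>t. N (t, l) / d (t, l)) integrable_on {0..1}"
      by (rule dominated_convergence(1)[OF intk hk le conv])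
    have "(\<lambda>k. integral {0..1} (\<lambda>t. sum (w' t) (W k))) \<longlonglongrightarrow> integral {0..1} (\<lambda>t. N (t, l) / d (t, l))"
      by (rule dominated_convergence(2)[OF intk hk le conv])
    moreover have "integral {0..1} (\<lambda>t. sum (w' t) (W k)) \<le> B" for k
    proof -
      have "integral {0..1} (\<lambda>t. sum (w' t) (W k)) = (\<Sum>w\<in>W k. bch n w * (E w * prod_list (map y w)))"
        using hi by (rule integral_unique)
      also have "\<dots> \<le> (\<Sum>w\<in>W k. \<bar>bch n w\<bar> * prod_list (map x w))"
      proof (rule sum_mono)
        fix w
        have "prod_list (map y w) \<le> prod_list (map x w)"
        proof (induction w)
          case (Cons i w)
          then show ?case using y0 yx[of i] x0 prod_list_nonneg[of y w, OF y0] by (auto intro!: mult_mono)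
        qed simp
        then have "\<bar>E w\<bar> * prod_list (map y w) \<le> 1 * prod_list (map x w)"
          using E1 prod_list_nonneg[of y w, OF y0] by (intro mult_mono) auto
        then have "\<bar>bch n w\<bar> * (\<bar>E w\<bar> * prod_list (map y w)) \<le> \<bar>bch n w\<bar> * prod_list (map x w)"
          by (simp add: mult_left_mono)
        moreover have "bch n w * (E w * prod_list (map y w)) \<le> \<bar>bch n w\<bar> * (\<bar>E w\<bar> * prod_list (map y w))"
          using abs_ge_self[of "bch n w * (E w * prod_list (map y w))"] prod_list_nonneg[of y w, OF y0]
          by (simp add: abs_mult)
        ultimately show "bch n w * (E w * prod_list (map y w)) \<le> \<bar>bch n w\<bar> * prod_list (map x w)"
          by linarith
      qed
      finally show ?thesis using B[OF W] by (rule order.trans)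
    qed
    ultimately show "integral {0..1} (\<lambda>t. N (t, l) / d (t, l)) \<le> B"
      by (intro LIMSEQ_le_const2) auto
  qed

  have \<rho>ts: "\<rho> ts 1 i = res_sum ts (x i)" for i
    unfolding \<rho>_def res_sum_def a_def \<epsilon>_def by (simp add: sgn_mult_abs abs_sgn mult.commute)
  have dts: "d (ts, 1) = 0"
    unfolding d_def using ts(2) by (simp add: bch_den_def \<rho>ts[abs_def])
  \<comment> \<open>The singularity is exploited on an interval to the right of \<open>ts\<close>,
    which must fit into [0,1].\<close>
  have "ts \<noteq> 1"
    using dts by (auto simp: d_def)
  then have ts1: "0 \<le> ts" "ts < 1" using ts(1) by auto
  define \<nu> where "\<nu> = N (ts, 1) / 2"
  have \<nu>: "0 < \<nu>" using crit[OF ts(1) dts] by (simp add: \<nu>_def)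
  obtain LN where LN: "0 \<le> LN" "\<And>p p'. p \<in> S \<Longrightarrow> p' \<in> S \<Longrightarrow> \<bar>N p - N p'\<bar> \<le> LN * dist p p'"
    using bdd_lip(2) by (rule bdd_lipE) blast
  obtain Ld where Ld: "0 \<le> Ld" "\<And>p p'. p \<in> S \<Longrightarrow> p' \<in> S \<Longrightarrow> \<bar>d p - d p'\<bar> \<le> Ld * dist p p'"
    using bdd_lip(1) by (rule bdd_lipE) blast
  define L where "L = LN + Ld + 1"
  have L: "0 < L" using LN Ld by (simp add: L_def)
  \<comment> \<open>Keeps [ts, ts + h] inside [0,1] and, since the points used lie within distance 2
    h of (ts, 1), keeps N above half its critical value.\<close>
  define h where "h = min (1 - ts) (min 1 (\<nu> / (2 * L)))"
  have h: "0 < h" "h \<le> 1 - ts" "h \<le> 1" "h \<le> \<nu> / (2 * L)" using ts1 \<nu> L by (auto simp: h_def)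
  have near: "\<nu> / L / (t - ts + (1 - l)) \<le> N (t, l) / d (t, l)"
    if t: "t \<in> {ts..ts + h}" and l: "l \<in> {1 - h..<1}" for t l
  proof -
    have tl: "(t, l) \<in> S" "(ts, 1) \<in> S" "t \<in> {0..1}" "l \<in> {0..<1}" using t l h ts1 by (auto simp: S_def)
    have "dist (t, l) (ts, 1) \<le> \<bar>t - ts\<bar> + \<bar>l - 1\<bar>"
      by (simp add: dist_Pair_Pair dist_real_def sqrt_sum_squares_le_sum_abs)
    then have dist: "dist (t, l) (ts, 1) \<le> t - ts + (1 - l)" using t l by simp
    have pos: "0 < t - ts + (1 - l)" using t l by simp
    have "\<bar>N (t, l) - N (ts, 1)\<bar> \<le> LN * dist (t, l) (ts, 1)" by (rule LN(2)[OF tl(1,2)])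
    also have "\<dots> \<le> L * (2 * h)"
      using dist t l LN Ld by (intro mult_mono) (auto simp: L_def)
    also have "\<dots> \<le> \<nu>" using h(4) L by (simp add: field_simps)
    finally have "\<bar>N (t, l) - N (ts, 1)\<bar> \<le> \<nu>" .
    moreover have "N (ts, 1) = 2 * \<nu>" by (simp add: \<nu>_def)
    ultimately have N\<nu>: "\<nu> \<le> N (t, l)" by linarith
    have "\<bar>d (t, l) - d (ts, 1)\<bar> \<le> Ld * dist (t, l) (ts, 1)" by (rule Ld(2)[OF tl(1,2)])
    also have "\<dots> \<le> L * (t - ts + (1 - l))"
      using dist LN Ld by (intro mult_mono) (auto simp: L_def)
    finally have dL: "d (t, l) \<le> L * (t - ts + (1 - l))" using dts by simp
    have "\<nu> / (L * (t - ts + (1 - l))) \<le> N (t, l) / d (t, l)"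
      using N\<nu> \<nu> dL d_pos[OF tl(3,4)] by (intro frac_le) auto
    then show ?thesis by simp
  qed
  \<comment> \<open>Solved from \<nu> / L * k = B + C + 1; with \<kappa> = h exp (- k) the
    difference ln (h + \<kappa>) - ln \<kappa> is at least k.\<close>
  define k where "k = (B + C + 1) * L / \<nu>"
  have k: "0 < k" using B0 C0 L \<nu> by (simp add: k_def)
  define \<kappa> where "\<kappa> = h * exp (- k)"
  have \<kappa>: "0 < \<kappa>" "\<kappa> \<le> h" using h k by (auto simp: \<kappa>_def mult_le_cancel_left1)
  define l where "l = 1 - \<kappa>"
  have l: "l \<in> {0..<1}" "l \<in> {1 - h..<1}" using \<kappa> h by (auto simp: l_def)
  define low where "low t = - C + (if t \<in> {ts..ts + h} then \<nu> / L / (t - ts + \<kappa>) else 0)" for t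
  have sub': "{ts..ts + h} \<subseteq> {0..1}" using ts1 h by auto
  have lowi: "(low has_integral (- C + \<nu> / L * (ln (h + \<kappa>) - ln \<kappa>))) {0..1}"
    unfolding low_def[abs_def]
  proof (rule has_integral_add)
    show "((\<lambda>t. - C) has_integral - C) {0..1::real}" using has_integral_const_real[of "- C" 0 1] by simp
    show "((\<lambda>t. if t \<in> {ts..ts + h} then \<nu> / L / (t - ts + \<kappa>) else 0) has_integral \<nu> / L * (ln (h + \<kappa>) - ln \<kappa>)) {0..1}"
      unfolding has_integral_restrict[OF sub'] using \<kappa> h by (intro has_integral_inverse_shift) auto
  qed
  have "- C + \<nu> / L * (ln (h + \<kappa>) - ln \<kappa>) \<le> integral {0..1} (\<lambda>t. N (t, l) / d (t, l))"
  proof (rule has_integral_le[OF lowi integrable_integral[OF int(1)[OF l(1)]]])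
    fix t :: real assume t: "t \<in> {0..1}"
    show "low t \<le> N (t, l) / d (t, l)"
    proof (cases "t \<in> {ts..ts + h}")
      case True
      then show ?thesis using near[OF True l(2)] C0 by (simp add: low_def l_def)
    next
      case False
      then show ?thesis using C[OF t l(1)] by (auto simp: low_def)
    qed
  qed
  also have "\<dots> \<le> B" by (rule int(2)[OF l(1)])
  finally have le: "- C + \<nu> / L * (ln (h + \<kappa>) - ln \<kappa>) \<le> B" .
  have "ln \<kappa> = ln h - k" using h by (simp add: \<kappa>_def ln_mult)
  moreover have "ln h \<le> ln (h + \<kappa>)" using h \<kappa> by simp
  ultimately have "k \<le> ln (h + \<kappa>) - ln \<kappa>" by linarith
  then have "\<nu> / L * k \<le> \<nu> / L * (ln (h + \<kappa>) - ln \<kappa>)" using \<nu> L by (intro mult_left_mono) auto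
  moreover have "\<nu> / L * k = B + C + 1" using \<nu> L by (simp add: k_def)
  ultimately show False using le by linarith
qed

section \<open>Bounds for the critical simplex\<close>

text \<open>By compactness there is a least scale at which some parameter, not necessarily the given
  t, makes the denominator nonpositive. Below it all parameters give positive values, so
  \<open>Gamma_real_infinite_critical\<close> applies at that scale.\<close>

lemma critical_scale:
  assumes x0: "\<And>i. 0 \<le> x i" and xpi: "\<And>i. i \<in> {1..n} \<Longrightarrow> x i < pi"
    and t: "t \<in> {0..1}" "bch_den n t x \<le> 0"
  obtains l where "l \<in> {0..1}" "Gamma_real n (\<lambda>i. l * x i) = \<infinity>"
proof -
  define S where "S = {0..1::real} \<times> {0..1::real}"
  define f where "f p = bch_den n (fst p) (\<lambda>i. snd p * x i)" for p
  have cf: "continuous_on S f" unfolding f_def[abs_def] S_def using x0 xpi by (intro bch_den_continuous) auto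
  have cS: "compact S" unfolding S_def by (intro compact_Times) auto
  define Z where "Z = S \<inter> f -` {..0}"
  have "closed Z" unfolding Z_def
    by (rule continuous_closed_preimage[OF cf compact_imp_closed[OF cS] closed_atMost])
  then have cZ: "compact Z" using compact_Int_closed[OF cS, of Z] by (simp add: Z_def Int_assoc[symmetric])
  have "(t, 1) \<in> Z" using t by (simp add: Z_def S_def f_def)
  then obtain p where p: "p \<in> Z" "\<And>p'. p' \<in> Z \<Longrightarrow> snd p \<le> snd p'"
    using continuous_attains_inf[OF cZ _ continuous_on_snd[OF continuous_on_id]] by fastforce
  obtain ts ls where p_eq: "p = (ts, ls)" by (cases p)
  have tl: "ts \<in> {0..1}" "ls \<in> {0..1}" "bch_den n ts (\<lambda>i. ls * x i) \<le> 0"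
    using p(1) by (auto simp: Z_def S_def f_def p_eq)
  define y where "y i = ls * x i" for i
  have y0: "0 \<le> y i" for i using x0[of i] tl by (simp add: y_def)
  have ypi: "y i < pi" if "i \<in> {1..n}" for i
    using xpi[OF that] x0[of i] tl mult_right_mono[of ls 1 "x i"] by (simp add: y_def)
  have sub: "0 < bch_den n u (\<lambda>i. l * y i)" if l: "l \<in> {0..<1}" and u: "u \<in> {0..1}" for l u
  proof (cases "ls = 0")
    case True
    then have "bch_den n u (\<lambda>i. l * y i) = 1"
      unfolding bch_den_def y_def by (subst word_den_single[of n 0]) auto
    then show ?thesis by simp
  next
    case False
    then have less: "l * ls < ls" "l * ls \<le> 1" using tl l by (auto intro: mult_le_one)
    have "(u, l * ls) \<notin> Z" using p(2)[of "(u, l * ls)"] less p_eq by force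
    then show ?thesis using u l tl less by (auto simp: Z_def S_def f_def y_def mult.assoc)
  qed
  have "0 \<le> bch_den n ts y"
    by (rule bch_den_nonneg_limit) (use y0 ypi sub tl in auto)
  then have "bch_den n ts y = 0" using tl(3) by (simp add: y_def[abs_def])
  then have "Gamma_real n y = \<infinity>"
    by (intro Gamma_real_infinite_critical[where ts = ts]) (use y0 ypi sub tl in auto)
  then show ?thesis using that[OF tl(2)] by (simp add: y_def[abs_def])
qed

text \<open>The source of the strict upper bounds on the radius: a strictly negative denominator
  leaves room for a smaller total.\<close>

lemma bch_den_neg_shrink:
  assumes x0: "\<And>i. 0 \<le> x i" and xpi: "\<And>i. i \<in> {1..n} \<Longrightarrow> x i < pi"
    and t: "t \<in> {0..1}" "bch_den n t x < 0"
  obtains l where "l \<in> {0..<1}" "bch_den n t (\<lambda>i. l * x i) \<le> 0"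
proof -
  have "\<exists>l\<in>{0..<1}. bch_den n t (\<lambda>i. l * x i) \<le> 0"
  proof (rule ccontr)
    assume "\<not> ?thesis"
    then have "0 \<le> bch_den n t x"
      by (intro bch_den_nonneg_limit) (use x0 xpi t in force)+
    then show False using t(2) by simp
  qed
  then show ?thesis using that by blast
qed

section \<open>One-letter estimates and the lower bound 2\<close>

lemma res_sum_exp_bound:
  assumes st: "0 < \<tau>" "\<tau> < \<sigma>" "\<sigma> + \<tau> = 1" and t: "t = \<sigma> \<or> t = \<tau>" and x: "0 \<le> x" "x < pi"
  shows "1 + \<sigma> * res_sum t x \<le> (1 + \<tau> * res_sum t x) * exp ((\<sigma> - \<tau>) * x)"
proof -
  have t01: "0 \<le> t" "t \<le> 1" using st t by auto
  have "1 - \<sigma> = \<tau>" "1 - \<tau> = \<sigma>" using st by auto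
  then have q: "t * (1 - t) = \<sigma> * \<tau>" using t by auto
  have d: "\<bar>1 - 2 * t\<bar> = \<sigma> - \<tau>" using st t by auto
  \<comment> \<open>Separation of variables in r' \<le> (1 + \<sigma> r) (1 + \<tau> r): the
    difference of logarithms is \<sigma> - \<tau> times a primitive of the reciprocal of the
    right-hand side, as a function of r.\<close>
  define f where "f y = ln (1 + \<sigma> * res_sum t y) - ln (1 + \<tau> * res_sum t y) - (\<sigma> - \<tau>) * y" for y
  have pos: "0 < 1 + \<sigma> * res_sum t y" "0 < 1 + \<tau> * res_sum t y" if "0 \<le> y" "y < pi" for y
    using res_sum_ge[OF t01 that] that st by (smt (verit) mult_nonneg_nonneg)+
  have "f x \<le> f 0"
  proof (rule DERIV_nonpos_imp_nonincreasing[OF x(1)])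
    fix y assume y: "0 \<le> y" "y \<le> x"
    then have y': "0 \<le> y" "y < pi" using x by auto
    obtain D where D: "(res_sum t has_field_derivative D) (at y)"
      "D \<le> 1 + \<bar>1 - 2 * t\<bar> * res_sum t y + t * (1 - t) * (res_sum t y)\<^sup>2"
      by (rule res_sum_deriv[OF t01 y'])
    define r where "r = res_sum t y"
    have r: "0 \<le> r" using res_sum_ge[OF t01 y'] y by (simp add: r_def)
    note p = pos[OF y', folded r_def]
    have "(f has_field_derivative (\<sigma> * D / (1 + \<sigma> * r) - \<tau> * D / (1 + \<tau> * r) - (\<sigma> - \<tau>))) (at y)"
      unfolding f_def[abs_def] using p
      by (auto intro!: derivative_eq_intros D(1) simp: r_def mult.commute)
    moreover have "\<sigma> * D / (1 + \<sigma> * r) - \<tau> * D / (1 + \<tau> * r) - (\<sigma> - \<tau>)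
      = (\<sigma> - \<tau>) * (D / ((1 + \<sigma> * r) * (1 + \<tau> * r)) - 1)"
      using p by (simp add: divide_simps) (simp add: algebra_simps)
    moreover have "D \<le> (1 + \<sigma> * r) * (1 + \<tau> * r)"
    proof -
      have "(\<sigma> - \<tau>) * r \<le> (\<sigma> + \<tau>) * r" using st r by (intro mult_right_mono) auto
      then show ?thesis using D(2) unfolding q d r_def[symmetric] by (simp add: power2_eq_square algebra_simps)
    qed
    then have "D / ((1 + \<sigma> * r) * (1 + \<tau> * r)) \<le> 1" using p by simp
    then have "(\<sigma> - \<tau>) * (D / ((1 + \<sigma> * r) * (1 + \<tau> * r)) - 1) \<le> 0"
      using st by (intro mult_nonneg_nonpos) auto
    ultimately show "\<exists>l. (f has_real_derivative l) (at y) \<and> l \<le> 0" by auto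
  qed
  then have "ln (1 + \<sigma> * res_sum t x) \<le> ln (1 + \<tau> * res_sum t x) + (\<sigma> - \<tau>) * x" by (simp add: f_def)
  then have "exp (ln (1 + \<sigma> * res_sum t x)) \<le> exp (ln (1 + \<tau> * res_sum t x) + (\<sigma> - \<tau>) * x)" by simp
  then show ?thesis using pos[OF x] by (simp add: exp_add)
qed

text \<open>Confluent case of \<open>res_sum_exp_bound\<close>: the two linear factors coincide at t
  = 1/2 and the primitive becomes r / (1 + r / 2). Strictness comes from 1 + r^2 / 4 < (1 + r /
  2)^2.\<close>

lemma res_sum_half_bound:
  assumes x: "0 < x" "x < pi"
  shows "res_sum (1/2) x / (1 + res_sum (1/2) x / 2) < x"
proof -
  define f where "f y = res_sum (1/2) y / (1 + res_sum (1/2) y / 2) - y" for y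
  have der: "\<exists>D. (res_sum (1/2) has_field_derivative D) (at y) \<and> D \<le> 1 + (res_sum (1/2) y)\<^sup>2 / 4" if "0 \<le> y" "y < pi" for y
    by (rule res_sum_deriv[of "1/2" y]) (use that in auto)
  have pos: "0 < 1 + res_sum (1/2) y / 2" if "0 \<le> y" "y < pi" for y
    using res_sum_ge[of "1/2" y] that by simp
  have "f x < f 0"
  proof (rule DERIV_neg_imp_decreasing_open[OF x(1)])
    fix y assume y: "0 < y" "y < x"
    then have y': "0 \<le> y" "y < pi" using x by auto
    obtain D where D: "(res_sum (1/2) has_field_derivative D) (at y)" "D \<le> 1 + (res_sum (1/2) y)\<^sup>2 / 4"
      using der[OF y'] by blast
    define r where "r = res_sum (1/2) y"
    have r: "0 < r" using res_sum_ge[of "1/2" y] y y' by (simp add: r_def)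
    have "(f has_field_derivative ((D * (1 + r / 2) - r * (D / 2)) / (1 + r / 2)\<^sup>2 - 1)) (at y)"
      unfolding f_def[abs_def] using r
      by (auto intro!: derivative_eq_intros D(1) simp: r_def power2_eq_square)
    moreover have "D < (1 + r / 2)\<^sup>2"
      using D(2) r unfolding r_def[symmetric] by (simp add: power2_eq_square algebra_simps)
    then have "(D * (1 + r / 2) - r * (D / 2)) / (1 + r / 2)\<^sup>2 - 1 < 0"
      using r by (simp add: algebra_simps)
    ultimately show "\<exists>l. (f has_real_derivative l) (at y) \<and> l < 0" by blast
  next
    have "isCont f y" if "y \<in> {0..x}" for y
    proof -
      have y: "0 \<le> y" "y < pi" using that x by auto
      then have "isCont (res_sum (1/2)) y" using der[OF y] DERIV_isCont by blast
      then show ?thesis unfolding f_def[abs_def] using pos[OF y] by (intro continuous_intros) auto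
    qed
    then show "continuous_on {0..x} f" by (intro continuous_at_imp_continuous_on) auto
  qed
  then show ?thesis by (simp add: f_def)
qed

text \<open>Equivalent to artanh d > d. This is where the constant 2 originates: at total 2 the
  denominator is positive once \<tau> exp (2 (\<sigma> - \<tau>)) < \<sigma>, which is this
  inequality for d = \<sigma> - \<tau>.\<close>

lemma exp_less_ratio:
  fixes d :: real
  assumes "0 < d" "d < 1"
  shows "(1 - d) * exp (2 * d) < 1 + d"
proof -
  define f where "f y = ln (1 + y) - ln (1 - y) - 2 * y" for y :: real
  have "f 0 < f d"
  proof (rule DERIV_pos_imp_increasing_open[OF assms(1)])
    fix y assume y: "0 < y" "y < d"
    then have "(f has_field_derivative (1 / (1 + y) + 1 / (1 - y) - 2)) (at y)"
      unfolding f_def[abs_def] using assms by (auto intro!: derivative_eq_intros)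
    moreover have "1 / (1 + y) + 1 / (1 - y) - 2 = 2 * y\<^sup>2 / ((1 + y) * (1 - y))"
      using y assms by (simp add: divide_simps) (simp add: algebra_simps power2_eq_square)
    moreover have "0 < 2 * y\<^sup>2 / ((1 + y) * (1 - y))" using y assms by simp
    ultimately show "\<exists>l. (f has_real_derivative l) (at y) \<and> 0 < l" by metis
  next
    show "continuous_on {0..d} f"
      unfolding f_def[abs_def] using assms by (intro continuous_intros) auto
  qed
  then have "ln (1 - d) + 2 * d < ln (1 + d)" by (simp add: f_def)
  then have "exp (ln (1 - d) + 2 * d) < exp (ln (1 + d))" by simp
  then show ?thesis using assms by (simp add: exp_add)
qed

text \<open>The two eigenvector identities combined to eliminate \<open>word_num\<close>. For s = t
  both sides vanish, hence the separate treatment of t = 1/2.\<close>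

lemma word_den_difference:
  assumes "s + t = 1"
  shows "(s - t) * word_den (s * t) r n = s * (\<Prod>i=1..n. 1 + t * r i) - t * (\<Prod>i=1..n. 1 + s * r i)"
  unfolding word_den_add_word_num[OF assms, symmetric] word_den_add_rnum'[OF assms, symmetric] by algebra

lemma bch_den_pos_of_sum_le_2:
  assumes x0: "\<And>i. i \<in> {1..n} \<Longrightarrow> 0 \<le> x i" and sum: "(\<Sum>i=1..n. x i) \<le> 2" and t: "t \<in> {0..1}"
  shows "0 < bch_den n t x"
proof -
  have xpi: "x i < pi" if "i \<in> {1..n}" for i
    using member_le_sum[OF that, of x] x0 sum pi_gt3 by force
  define r where "r i = res_sum t (x i)" for i
  have r0: "0 \<le> r i" if "i \<in> {1..n}" for i
    using res_sum_ge[of t "x i"] t x0[OF that] xpi[OF that] by (simp add: r_def)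
  consider "t = 0 \<or> t = 1" | "t = 1/2" | "0 < t" "t < 1" "t \<noteq> 1/2" using t by fastforce
  then show ?thesis
  proof cases
    case 1
    then show ?thesis by (auto simp: bch_den_def)
  next
    case 2
    \<comment> \<open>At the double eigenvalue 1/2, \<open>word_num\<close> is P times the sum of
      the \<theta> i, and \<open>word_den\<close> is P times 1 minus half that sum, so the threshold
      is again 2.\<close>
    define \<theta> where "\<theta> i = r i / (1 + r i / 2)" for i
    define P where "P k = (\<Prod>i=1..k. 1 + 1/2 * r i)" for k
    have Pr: "word_num (1/2 * (1/2)) r k = P k * (\<Sum>i=1..k. \<theta> i)" if "k \<le> n" for k
      using that
    proof (induction k)
      case (Suc k)
      have "1 + r (Suc k) / 2 \<noteq> 0" using r0[of "Suc k"] Suc.prems by auto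
      then have "r (Suc k) = (1 + 1/2 * r (Suc k)) * \<theta> (Suc k)" by (simp add: \<theta>_def)
      moreover have P: "P (Suc k) = P k * (1 + 1/2 * r (Suc k))" by (simp add: P_def)
      ultimately have eq: "r (Suc k) * P k = P (Suc k) * \<theta> (Suc k)"
        by (metis mult.assoc mult.commute)
      have "word_num (1/2 * (1/2)) r (Suc k) = word_num (1/2 * (1/2)) r k * (1 + 1/2 * r (Suc k)) + r (Suc k) * P k"
        unfolding P_def by (rule word_num_Suc_prod) simp
      also have "\<dots> = P (Suc k) * (\<Sum>i=1..k. \<theta> i) + P (Suc k) * \<theta> (Suc k)"
        using Suc by (simp only: eq) (simp add: P)
      also have "\<dots> = P (Suc k) * (\<Sum>i=1..Suc k. \<theta> i)" by (simp add: distrib_left)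
      finally show ?case .
    qed simp
    have \<theta>: "\<theta> i \<le> x i" "0 < x i \<Longrightarrow> \<theta> i < x i" if "i \<in> {1..n}" for i
    proof -
      show *: "0 < x i \<Longrightarrow> \<theta> i < x i"
        unfolding \<theta>_def r_def 2 using res_sum_half_bound[of "x i"] xpi[OF that] by simp
      show "\<theta> i \<le> x i"
      proof (cases "x i = 0")
        case False
        then show ?thesis using * x0[OF that] by simp
      qed (simp add: \<theta>_def r_def)
    qed
    have "(\<Sum>i=1..n. \<theta> i) < 2"
    proof (cases "\<exists>i\<in>{1..n}. 0 < x i")
      case True
      then have "\<exists>i\<in>{1..n}. \<theta> i < x i" using \<theta>(2) by blast
      then have "(\<Sum>i=1..n. \<theta> i) < (\<Sum>i=1..n. x i)"
        using \<theta>(1) by (intro sum_strict_mono_ex1) auto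
      then show ?thesis using sum by simp
    next
      case False
      then have "(\<Sum>i=1..n. \<theta> i) \<le> (\<Sum>i=1..n. 0)"
        using \<theta>(1) x0 by (intro sum_mono) force
      then show ?thesis by simp
    qed
    moreover have "0 < P n" unfolding P_def using r0 by (intro prod_pos) (smt (verit) divide_nonneg_pos mult_nonneg_nonneg)
    moreover have "bch_den n t x = P n - 1/2 * word_num (1/2 * (1/2)) r n"
      using word_den_add_word_num[of "1/2" "1/2" r n] by (simp add: bch_den_def 2 P_def r_def[abs_def])
    then have "bch_den n t x = P n * (1 - (\<Sum>i=1..n. \<theta> i) / 2)"
      unfolding Pr[OF order_refl] by (simp add: algebra_simps)
    ultimately show ?thesis by simp
  next
    case 3
    define \<sigma> \<tau> where "\<sigma> = max t (1 - t)" and "\<tau> = min t (1 - t)"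
    have st: "0 < \<tau>" "\<tau> < \<sigma>" "\<sigma> + \<tau> = 1" "t = \<sigma> \<or> t = \<tau>" "\<sigma> * \<tau> = (1 - t) * t"
      using 3 by (auto simp: \<sigma>_def \<tau>_def max_def min_def)
    define P Q where "P = (\<Prod>i=1..n. 1 + \<tau> * r i)" and "Q = (\<Prod>i=1..n. 1 + \<sigma> * r i)"
    have P: "0 < P" unfolding P_def using r0 st by (intro prod_pos) (smt (verit) mult_nonneg_nonneg)
    \<comment> \<open>The letterwise exponential bounds multiply, so that only the total of the x i
      matters.\<close>
    have "Q \<le> (\<Prod>i=1..n. (1 + \<tau> * r i) * exp ((\<sigma> - \<tau>) * x i))"
      unfolding Q_def
    proof (rule prod_mono, safe)
      fix i assume i: "i \<in> {1..n}"
      show "0 \<le> 1 + \<sigma> * r i" using r0[OF i] st by (smt (verit) mult_nonneg_nonneg)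
      show "1 + \<sigma> * r i \<le> (1 + \<tau> * r i) * exp ((\<sigma> - \<tau>) * x i)"
        unfolding r_def using st x0[OF i] xpi[OF i] by (intro res_sum_exp_bound) auto
    qed
    also have "\<dots> = P * exp ((\<sigma> - \<tau>) * (\<Sum>i=1..n. x i))"
      by (simp add: P_def prod.distrib exp_sum sum_distrib_left)
    also have "\<dots> \<le> P * exp (2 * (\<sigma> - \<tau>))"
      using P st sum mult_left_mono[of "\<Sum>i=1..n. x i" 2 "\<sigma> - \<tau>"] by (intro mult_left_mono) auto
    finally have "\<tau> * Q \<le> P * (\<tau> * exp (2 * (\<sigma> - \<tau>)))" using st by (simp add: ac_simps)
    also have "\<dots> < P * \<sigma>"
    proof -
      have "(1 - (\<sigma> - \<tau>)) * exp (2 * (\<sigma> - \<tau>)) < 1 + (\<sigma> - \<tau>)" using st by (intro exp_less_ratio) auto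
      moreover have "1 - (\<sigma> - \<tau>) = 2 * \<tau>" "1 + (\<sigma> - \<tau>) = 2 * \<sigma>" using st by auto
      ultimately show ?thesis using P by (intro mult_strict_left_mono) auto
    qed
    finally have "0 < (\<sigma> - \<tau>) * word_den (\<sigma> * \<tau>) r n"
      unfolding word_den_difference[OF st(3)] P_def Q_def by (simp add: mult.commute)
    then show ?thesis using st by (simp add: bch_den_def zero_less_mult_iff r_def[abs_def])
  qed
qed

section \<open>The equal-letter point behind the arctan bound\<close>

lemma one_plus_power_ge:
  fixes y :: real
  assumes "0 \<le> y"
  shows "1 + real n * y + real n * (real n - 1) / 2 * y\<^sup>2 \<le> (1 + y) ^ n"
proof (induction n)
  case (Suc n)
  have "1 + real (Suc n) * y + real (Suc n) * (real (Suc n) - 1) / 2 * y\<^sup>2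
    \<le> (1 + real n * y + real n * (real n - 1) / 2 * y\<^sup>2) * (1 + y)"
  proof -
    have "0 \<le> real n * (real n - 1) / 2 * y\<^sup>2 * y"
      using assms by (cases n) auto
    then show ?thesis by (simp add: algebra_simps power2_eq_square add_divide_distrib diff_divide_distrib)
  qed
  also have "\<dots> \<le> (1 + y) ^ n * (1 + y)" using Suc assms by (intro mult_right_mono) auto
  finally show ?case by (simp add: mult.commute)
qed simp

text \<open>With T = 1 / k and \<xi> = 2 arctan T, exp (i \<xi>) = (1 + i T) / (1 - i T), so the
  resolvent at i \<xi> is 2 i T / (1 - i d T). The bound is the sum of the moduli of its real and
  imaginary parts.\<close>

lemma res_sum_arctan_bound:
  assumes k: "1 \<le> k" and d: "0 \<le> d" "d \<le> 1"
  shows "2 * (k + d) / (k\<^sup>2 + d\<^sup>2) \<le> res_sum ((1 - d) / 2) (2 * arctan (1 / k))"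
proof -
  define T where "T = 1 / k"
  define \<xi> where "\<xi> = 2 * arctan T"
  define t where "t = (1 - d) / 2"
  have T: "0 < T" "T \<le> 1" using k by (auto simp: T_def)
  have t: "0 \<le> t" "t \<le> 1" using d by (auto simp: t_def)
  have \<xi>: "0 \<le> \<xi>" "\<xi> < pi" using T arctan_ubound[of T] by (auto simp: \<xi>_def)
  have T2: "0 < 1 + T\<^sup>2" by (smt (verit) zero_le_power2)
  have dT2: "0 < 1 + d\<^sup>2 * T\<^sup>2" by (smt (verit) zero_le_power2 mult_nonneg_nonneg)
  have c: "cos \<xi> = (1 - T\<^sup>2) / (1 + T\<^sup>2)" and s: "sin \<xi> = 2 * T / (1 + T\<^sup>2)"
    using T2 by (simp_all add: \<xi>_def cos_double sin_double cos_arctan sin_arctan power_divide diff_divide_distrib)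
  define e where "e = exp (\<i> * complex_of_real \<xi>)"
  have e: "Re e = (1 - T\<^sup>2) / (1 + T\<^sup>2)" "Im e = 2 * T / (1 + T\<^sup>2)"
    by (simp_all add: e_def Re_exp Im_exp c s)
  define z where "z = Complex (- 2 * d * T\<^sup>2 / (1 + d\<^sup>2 * T\<^sup>2)) (2 * T / (1 + d\<^sup>2 * T\<^sup>2))"
  have nz: "1 + of_real t * (e - 1) \<noteq> 0"
    unfolding e_def using \<xi> by (intro one_plus_mult_exp_neq_0 t) (simp add: norm_mult)
  define A B where "A = 1 + T\<^sup>2" and "B = 1 + d\<^sup>2 * T\<^sup>2"
  have AB: "A \<noteq> 0" "B \<noteq> 0" using T2 dT2 by (auto simp: A_def B_def)
  have t2: "2 * t = 1 - d" by (simp add: t_def)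
  define w where "w = e - 1"
  have w: "Re w = - 2 * T\<^sup>2 / A" "Im w = 2 * T / A"
    using AB(1) by (simp_all add: w_def e A_def field_simps)
  have z: "Re z = - 2 * d * T\<^sup>2 / B" "Im z = 2 * T / B"
    by (simp_all add: z_def B_def)
  have "w = z * (1 + of_real t * w)"
  proof (rule complex_eqI)
    have "- 2 * T\<^sup>2 * B = - 2 * d * T\<^sup>2 * (A - 2 * t * T\<^sup>2) - 2 * T * (2 * t * T)"
      unfolding A_def B_def using t2 by algebra
    then have "Re w = (- 2 * d * T\<^sup>2 * (A - 2 * t * T\<^sup>2) - 2 * T * (2 * t * T)) / (A * B)"
      using AB by (simp only: w) (simp add: divide_simps)
    also have "\<dots> = Re z * (1 + t * Re w) - Im z * (t * Im w)"
      using AB unfolding w z by (simp add: divide_simps)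
    finally show "Re w = Re (z * (1 + of_real t * w))" by simp
    have "2 * T * B = - 2 * d * T\<^sup>2 * (2 * t * T) + 2 * T * (A - 2 * t * T\<^sup>2)"
      unfolding A_def B_def using t2 by algebra
    then have "Im w = (- 2 * d * T\<^sup>2 * (2 * t * T) + 2 * T * (A - 2 * t * T\<^sup>2)) / (A * B)"
      using AB by (simp only: w) (simp add: divide_simps)
    also have "\<dots> = Re z * (t * Im w) + Im z * (1 + t * Re w)"
      using AB unfolding w z by (simp add: divide_simps)
    finally show "Im w = Im (z * (1 + of_real t * w))" by simp
  qed
  then have "e - 1 = z * (1 + of_real t * (e - 1))" by (simp add: w_def)
  then have "res_fun t (\<i> * of_real \<xi>) = z"
    using nz unfolding res_fun_def e_def by (simp add: divide_eq_eq)
  then have "\<bar>Re z\<bar> + \<bar>Im z\<bar> \<le> res_sum t \<xi>"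
    using Re_Im_res_fun_le_res_sum[OF t \<xi>] by simp
  moreover have "\<bar>Re z\<bar> + \<bar>Im z\<bar> = (2 * d * T\<^sup>2 + 2 * T) / (1 + d\<^sup>2 * T\<^sup>2)"
    using dT2 T d by (simp add: z_def abs_mult add_divide_distrib)
  moreover have "(2 * d * T\<^sup>2 + 2 * T) / (1 + d\<^sup>2 * T\<^sup>2) = 2 * (k + d) / (k\<^sup>2 + d\<^sup>2)"
  proof -
    have "2 * d * T\<^sup>2 + 2 * T = 2 * (k + d) / k\<^sup>2" "1 + d\<^sup>2 * T\<^sup>2 = (k\<^sup>2 + d\<^sup>2) / k\<^sup>2"
      using k by (simp_all add: T_def field_simps power2_eq_square)
    then show ?thesis using k by simp
  qed
  ultimately show ?thesis by (simp add: t_def \<xi>_def T_def)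
qed

text \<open>
  At \<open>t = 1/2\<close> the value is exactly 0. Moving to \<open>t = (1 - d) / 2\<close> changes \<open>(1 - t) t\<close> only in the second
  order, whereas the even coefficients, which vanish at \<open>1/2\<close>, contribute to the first order in \<open>d\<close>.
\<close>

lemma bch_den_arctan_neg:
  assumes n: "2 \<le> n"
  obtains t where "t \<in> {0..1}" "bch_den n t (\<lambda>_. 2 * arctan (1 / (real n - 1))) < 0"
proof -
  define k where "k = real n - 1"
  define M where "M = k * (k + 1)"
  \<comment> \<open>Small enough that (1 - d) (1 + 1 / M) still exceeds 1, namely by 1 / (M (M +
    2)).\<close>
  define d where "d = 1 / (M + 2)"
  have k: "1 \<le> k" using n by (simp add: k_def)
  have M: "0 < M" using k by (simp add: M_def)
  have d: "0 < d" "d < 1" using M by (auto simp: d_def)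
  define s t where "s = (1 + d) / 2" and "t = (1 - d) / 2"
  have st: "s + t = 1" "0 \<le> s" "0 \<le> t" "s - t = d" using d by (auto simp: s_def t_def field_simps)
  define \<rho> where "\<rho> = 2 * (k + d) / (k\<^sup>2 + d\<^sup>2)"
  have \<rho>: "0 \<le> \<rho>" using k d by (simp add: \<rho>_def)
  \<comment> \<open>A lower bound for (1 + s \<rho>) / (1 + t \<rho>) - 1 = d \<rho> / (1 + t
    \<rho>), obtained from 1 + t \<rho> \<le> M / (k^2 + d^2).\<close>
  define y where "y = 2 * d * (k + d) / M"
  have y: "0 \<le> y" using k d M by (simp add: y_def)
  have kd: "0 < k\<^sup>2 + d\<^sup>2" using k d by (simp add: add_pos_pos)
  have step: "(1 + t * \<rho>) * (1 + y) \<le> 1 + s * \<rho>"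
  proof -
    define A where "A = k\<^sup>2 + d\<^sup>2"
    have "1 + t * \<rho> = 1 + (1 - d) * (k + d) / A"
      using kd unfolding \<rho>_def t_def A_def[symmetric] by (simp add: field_simps)
    also have "\<dots> = 1 + (1 - d) * (k + d) / (k\<^sup>2 + d\<^sup>2)" by (simp add: A_def)
    also have "\<dots> = (k\<^sup>2 + d\<^sup>2 + (1 - d) * (k + d)) / (k\<^sup>2 + d\<^sup>2)"
      using kd k by (subst add_divide_distrib) simp
    also have "k\<^sup>2 + d\<^sup>2 + (1 - d) * (k + d) = M - d * (k - 1)"
      by (simp add: M_def algebra_simps power2_eq_square)
    finally have "1 + t * \<rho> = (M - d * (k - 1)) / (k\<^sup>2 + d\<^sup>2)" .
    then have "y * (1 + t * \<rho>) = y * (M - d * (k - 1)) / (k\<^sup>2 + d\<^sup>2)" by simp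
    also have "\<dots> \<le> y * M / (k\<^sup>2 + d\<^sup>2)"
      using y kd k d by (intro divide_right_mono mult_left_mono) auto
    also have "\<dots> = d * \<rho>" using M by (simp add: y_def \<rho>_def)
    finally have "y * (1 + t * \<rho>) \<le> d * \<rho>" .
    moreover have "s * \<rho> = t * \<rho> + d * \<rho>" using st(4) by (simp add: algebra_simps)
    ultimately show ?thesis by (simp add: algebra_simps)
  qed
  have t\<rho>: "0 < 1 + t * \<rho>" using st \<rho> by (smt (verit) mult_nonneg_nonneg)
  \<comment> \<open>The linear Bernoulli bound alone gives only 2 d^2 / k in second order, which is
    too little. The quadratic term adds at least 2 d^2 k / (k + 1), and 1 / k + k / (k + 1) = 1 + 1
    / M lies just above the required 1.\<close>
  have yn: "1 + 2 * d + 2 * d\<^sup>2 * (1 + 1 / M) \<le> (1 + y) ^ n"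
  proof -
    have "real n * y = 2 * d + 2 * d\<^sup>2 / k"
      using k M by (simp add: y_def M_def k_def[symmetric] field_simps power2_eq_square) (simp add: k_def algebra_simps)
    moreover have "2 * d\<^sup>2 * k / (k + 1) \<le> real n * (real n - 1) / 2 * y\<^sup>2"
    proof -
      have nM: "real n * (real n - 1) = M" by (simp add: M_def k_def algebra_simps)
      have "2 * d\<^sup>2 * k / (k + 1) = 2 * d\<^sup>2 * k\<^sup>2 / M"
        using k by (simp add: M_def power2_eq_square)
      also have "\<dots> \<le> 2 * d\<^sup>2 * (k + d)\<^sup>2 / M"
        using k d M by (intro divide_right_mono mult_left_mono power_mono) auto
      also have "\<dots> = M / 2 * y\<^sup>2" using M by (simp add: y_def power2_eq_square)
      finally show ?thesis unfolding nM .
    qed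
    moreover have "2 * d\<^sup>2 / k + 2 * d\<^sup>2 * k / (k + 1) = 2 * d\<^sup>2 * (1 + 1 / M)"
    proof -
      have "1 / k + k / (k + 1) = 1 + 1 / M"
        using k by (simp add: M_def divide_simps) (simp add: algebra_simps)
      moreover have "2 * d\<^sup>2 / k + 2 * d\<^sup>2 * k / (k + 1) = 2 * d\<^sup>2 * (1 / k + k / (k + 1))"
        by (simp add: distrib_left)
      ultimately show ?thesis by simp
    qed
    ultimately show ?thesis using one_plus_power_ge[OF y, of n] by linarith
  qed
  have "1 + d < (1 - d) * (1 + 2 * d + 2 * d\<^sup>2 * (1 + 1 / M))"
  proof -
    have "(1 - d) * (1 + 1 / M) = 1 + 1 / (M * (M + 2))"
      using M by (simp add: d_def divide_simps) (simp add: algebra_simps)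
    moreover have "0 < 1 / (M * (M + 2))" using M by simp
    ultimately have "1 < (1 - d) * (1 + 1 / M)" by linarith
    then have "0 < 2 * d\<^sup>2 * ((1 - d) * (1 + 1 / M) - 1)" using d by simp
    moreover have "(1 - d) * (1 + 2 * d + 2 * d\<^sup>2 * (1 + 1 / M)) - (1 + d) = 2 * d\<^sup>2 * ((1 - d) * (1 + 1 / M) - 1)"
      by (simp add: algebra_simps power2_eq_square)
    ultimately show ?thesis by linarith
  qed
  also have "\<dots> \<le> (1 - d) * (1 + y) ^ n" using yn d by (intro mult_left_mono) auto
  finally have "(1 + d) * (1 + t * \<rho>) ^ n < (1 - d) * (1 + y) ^ n * (1 + t * \<rho>) ^ n"
    using t\<rho> by (intro mult_strict_right_mono) auto
  also have "\<dots> = (1 - d) * ((1 + t * \<rho>) * (1 + y)) ^ n" by (simp add: power_mult_distrib)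
  also have "\<dots> \<le> (1 - d) * (1 + s * \<rho>) ^ n"
    using d step t\<rho> y by (intro mult_left_mono power_mono) auto
  finally have "s * (1 + t * \<rho>) ^ n < t * (1 + s * \<rho>) ^ n" by (simp add: s_def t_def)
  then have "d * word_den (s * t) (\<lambda>_. \<rho>) n < 0"
    using word_den_difference[OF st(1), of "\<lambda>_. \<rho>" n] st(4) by simp
  then have neg: "word_den (s * t) (\<lambda>_. \<rho>) n < 0" using d by (simp add: mult_less_0_iff)
  have "\<rho> \<le> res_sum t (2 * arctan (1 / k))"
    unfolding \<rho>_def t_def using k d by (intro res_sum_arctan_bound) auto
  then have "word_den (s * t) (\<lambda>_. res_sum t (2 * arctan (1 / k))) n \<le> word_den (s * t) (\<lambda>_. \<rho>) n"
    using \<rho> by (intro word_den_mono[OF st(1-3), THEN conjunct2]) auto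
  moreover have "1 - t = s" using st by simp
  ultimately have "bch_den n t (\<lambda>_. 2 * arctan (1 / k)) < 0" using neg by (simp add: bch_den_def)
  then show ?thesis using that[of t] st by (simp add: k_def)
qed

section \<open>The cumulative convergence radius\<close>

lemma continuous_on_word_den_word_num:
  assumes "continuous_on S q" "\<And>i. i \<in> {1..n} \<Longrightarrow> continuous_on S (\<lambda>p. r p i)"
  shows "continuous_on S (\<lambda>p. word_den (q p) (r p) n) \<and> continuous_on S (\<lambda>p. word_num (q p) (r p) n)"
  using assms(2)
proof (induction n)
  case (Suc n)
  then have "continuous_on S (\<lambda>p. word_den (q p) (r p) n)" "continuous_on S (\<lambda>p. word_num (q p) (r p) n)"
    "continuous_on S (\<lambda>p. r p (Suc n))"
    by auto
  then show ?case using assms(1) by (auto intro!: continuous_intros)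
qed simp

lemma continuous_on_res_sum:
  assumes "0 < X" "X < pi"
  shows "continuous_on ({0..1} \<times> {0..X}) (\<lambda>p. res_sum (fst p) (snd p))"
proof -
  have "continuous_on ({0..1} \<times> {0..1}) (\<lambda>p. res_sum (fst p) (snd p * X))"
    using bdd_lip_continuous_on[OF coeff_family_bdd_lip[OF coeff_family_abs, of X]] assms by (simp add: res_sum_def)
  moreover have "continuous_on ({0..1} \<times> {0..X}) (\<lambda>p::real \<times> real. (fst p, snd p / X))"
    using assms by (intro continuous_intros) auto
  moreover have "(\<lambda>p. (fst p, snd p / X)) ` ({0..1} \<times> {0..X}) \<subseteq> {0..1} \<times> {0..1}"
    using assms by auto
  ultimately have "continuous_on ({0..1} \<times> {0..X}) (\<lambda>p. res_sum (fst (fst p, snd p / X)) (snd (fst p, snd p / X) * X))"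
    by (rule continuous_on_compose2)
  then show ?thesis using assms by simp
qed

lemma compact_PiE_UNIV:
  fixes S :: "'a \<Rightarrow> 'b::topological_space set"
  assumes "\<And>i. compact (S i)"
  shows "compact (PiE UNIV S)"
proof -
  have "compactin (product_topology (\<lambda>i. euclidean) UNIV) (PiE UNIV S)"
    using assms by (simp add: compactin_PiE)
  then show ?thesis unfolding euclidean_product_topology by simp
qed

lemma bch_den_minimum:
  assumes x0: "\<And>i. 0 \<le> x0 i" and t0: "t0 \<in> {0..1}" "bch_den n t0 x0 \<le> 0"
    and sum0: "(\<Sum>i=1..n. x0 i) < pi"
  obtains x t where "\<And>i. 0 \<le> x i" "t \<in> {0..1}" "bch_den n t x \<le> 0" "(\<Sum>i=1..n. x i) < pi"
    "\<And>y u. (\<And>i. 0 \<le> y i) \<Longrightarrow> u \<in> {0..1} \<Longrightarrow> bch_den n u y \<le> 0 \<Longrightarrow> (\<Sum>i=1..n. x i) \<le> (\<Sum>i=1..n. y i)"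
proof -
  define v0 where "v0 = (\<Sum>i=1..n. x0 i)"
  define X where "X = max 1 v0"
  have X: "0 < X" "X < pi" "v0 \<le> X" using sum0 pi_gt3 by (auto simp: X_def v0_def)
  \<comment> \<open>Coordinates outside 1..n are pinned to 0, so that all functions on the naturals
    in question form a compact product.\<close>
  define S where "S i = (if i \<in> {1..n} then {0..X} else {0 :: real})" for i :: nat
  define K where "K = {0..1::real} \<times> PiE UNIV S"
  have cK: "compact K" unfolding K_def by (intro compact_Times compact_PiE_UNIV) (auto simp: S_def)
  have coord: "continuous_on K (\<lambda>p. snd p i)" for i
    using continuous_on_compose2[OF continuous_on_product_coordinates continuous_on_snd[OF continuous_on_id]]
    by (rule continuous_on_subset) auto
  have cden: "continuous_on K (\<lambda>p. bch_den n (fst p) (snd p))"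
    unfolding bch_den_def
  proof (rule continuous_on_word_den_word_num[THEN conjunct1])
    show "continuous_on K (\<lambda>p. (1 - fst p) * fst p)" by (intro continuous_intros)
    fix i assume i: "i \<in> {1..n}"
    have "continuous_on K (\<lambda>p. (fst p, snd p i))" by (intro continuous_on_Pair coord continuous_intros)
    moreover have "(\<lambda>p. (fst p, snd p i)) ` K \<subseteq> {0..1} \<times> {0..X}"
    proof (rule image_subsetI)
      fix p assume "p \<in> K"
      then have "fst p \<in> {0..1}" "snd p i \<in> S i" unfolding K_def by (auto simp: PiE_def Pi_def)
      then show "(fst p, snd p i) \<in> {0..1} \<times> {0..X}" using i by (simp add: S_def)
    qed
    ultimately have "continuous_on K (\<lambda>p. res_sum (fst (fst p, snd p i)) (snd (fst p, snd p i)))"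
      by (rule continuous_on_compose2[OF continuous_on_res_sum[OF X(1,2)]])
    then show "continuous_on K (\<lambda>p. res_sum (fst p) (snd p i))" by simp
  qed
  define Z where "Z = K \<inter> (\<lambda>p. bch_den n (fst p) (snd p)) -` {..0}"
  have "closed Z" unfolding Z_def
    by (rule continuous_closed_preimage[OF cden compact_imp_closed[OF cK] closed_atMost])
  then have cZ: "compact Z" using compact_Int_closed[OF cK, of Z] by (simp add: Z_def Int_assoc[symmetric])
  define cut where "cut y = (\<lambda>i. if i \<in> {1..n} then y i else 0)" for y :: "nat \<Rightarrow> real"
  have cut: "(u, cut y) \<in> Z" "(\<Sum>i=1..n. cut y i) = (\<Sum>i=1..n. y i)"
    if y: "\<And>i. 0 \<le> y i" "u \<in> {0..1}" "bch_den n u y \<le> 0" "(\<Sum>i=1..n. y i) \<le> v0" for y u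
  proof -
    have "bch_den n u (cut y) = bch_den n u y"
      unfolding bch_den_def by (rule word_den_word_num_cong) (simp add: cut_def)
    moreover have "y i \<le> X" if "i \<in> {1..n}" for i
      using member_le_sum[OF that, of y] y(1,4) X(3) by auto
    ultimately show "(u, cut y) \<in> Z"
      using y by (auto simp: Z_def K_def S_def cut_def)
    show "(\<Sum>i=1..n. cut y i) = (\<Sum>i=1..n. y i)" by (simp add: cut_def)
  qed
  have z0: "(t0, cut x0) \<in> Z" "(\<Sum>i=1..n. cut x0 i) = v0"
    using cut[of x0 t0] x0 t0 by (auto simp: v0_def)
  have "continuous_on Z (\<lambda>p. \<Sum>i=1..n. snd p i)"
    by (intro continuous_on_sum continuous_on_subset[OF coord]) (auto simp: Z_def)
  then obtain p where p: "p \<in> Z" "\<And>p'. p' \<in> Z \<Longrightarrow> (\<Sum>i=1..n. snd p i) \<le> (\<Sum>i=1..n. snd p' i)"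
    using continuous_attains_inf[OF cZ] z0 by blast
  have le: "(\<Sum>i=1..n. snd p i) \<le> v0" using p(2)[OF z0(1)] z0(2) by simp
  show thesis
  proof (rule that[of "snd p" "fst p"])
    show "0 \<le> snd p i" for i
    proof -
      have "snd p i \<in> S i" using p(1) unfolding Z_def K_def by (auto simp: PiE_def Pi_def)
      then show ?thesis by (simp add: S_def split: if_splits)
    qed
    show "fst p \<in> {0..1}" "bch_den n (fst p) (snd p) \<le> 0" using p(1) by (auto simp: Z_def K_def)
    show "(\<Sum>i=1..n. snd p i) < pi" using le sum0 by (simp add: v0_def)
    \<comment> \<open>Competitors with a total above v0 lose at once; this covers all those with an
      entry of \<pi> or more, where \<open>res_sum\<close> need not come from a convergent
      series.\<close>
    show "(\<Sum>i=1..n. snd p i) \<le> (\<Sum>i=1..n. y i)"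
      if "\<And>i. 0 \<le> y i" "u \<in> {0..1}" "bch_den n u y \<le> 0" for y u
    proof (cases "(\<Sum>i=1..n. y i) \<le> v0")
      case True
      then show ?thesis using p(2)[OF cut(1)[OF that True]] cut(2)[OF that True] by simp
    next
      case False
      then show ?thesis using le by simp
    qed
  qed
qed

text \<open>Below the minimal total the denominator is positive for every parameter, so the series
  is finite. Conversely some scale l \<le> 1 of the minimizer diverges, and the lower bound just
  shown forces its total to equal the minimum.\<close>

lemma cum_radius_eq:
  assumes x0: "\<And>i. 0 \<le> x i" and t: "t \<in> {0..1}" "bch_den n t x \<le> 0"
    and less_pi: "(\<Sum>i=1..n. x i) < pi"
    and min: "\<And>y u. (\<And>i. 0 \<le> y i) \<Longrightarrow> u \<in> {0..1} \<Longrightarrow> bch_den n u y \<le> 0 \<Longrightarrow> (\<Sum>i=1..n. x i) \<le> (\<Sum>i=1..n. y i)"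
  shows "cum_radius n = (\<Sum>i=1..n. x i)"
  unfolding cum_radius_def
proof (rule Least_equality)
  have lower: "(\<Sum>i=1..n. x i) \<le> s" if s: "s \<in> divergence_sums n" for s
  proof (rule ccontr)
    assume less: "\<not> (\<Sum>i=1..n. x i) \<le> s"
    obtain y where y: "s = (\<Sum>i=1..n. y i)" "\<And>i. i \<in> {1..n} \<Longrightarrow> 0 \<le> y i" "Gamma_real n y = \<infinity>"
      using s by (auto simp: divergence_sums_def)
    define z where "z i = (if i \<in> {1..n} then y i else 0)" for i
    have z0: "0 \<le> z i" for i using y(2) by (simp add: z_def)
    have zs: "(\<Sum>i=1..n. z i) = s" by (simp add: z_def y(1))
    have "z i < pi" if "i \<in> {1..n}" for i
      using member_le_sum[OF that, of z] z0 zs less less_pi by simp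
    moreover have "0 < bch_den n u z" if "u \<in> {0..1}" for u
      using min[of z u] z0 that zs less by force
    ultimately have "Gamma_real n z < \<infinity>" using z0 by (intro Gamma_real_finite) auto
    moreover have "Gamma_real n z = Gamma_real n y" by (rule Gamma_real_cong) (simp add: z_def)
    ultimately show False using y(3) by simp
  qed
  then show "\<And>s. s \<in> divergence_sums n \<Longrightarrow> (\<Sum>i=1..n. x i) \<le> s" .
  have xpi: "x i < pi" if "i \<in> {1..n}" for i
    using member_le_sum[OF that, of x] x0 less_pi by simp
  obtain l where l: "l \<in> {0..1}" "Gamma_real n (\<lambda>i. l * x i) = \<infinity>"
    by (rule critical_scale[of x n t]) (use x0 xpi t in auto)
  have mem: "l * (\<Sum>i=1..n. x i) \<in> divergence_sums n"
    unfolding divergence_sums_def sum_distrib_left using l x0 by auto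
  have "0 \<le> (\<Sum>i=1..n. x i)" using x0 by (intro sum_nonneg) auto
  then have "l * (\<Sum>i=1..n. x i) \<le> (\<Sum>i=1..n. x i)" using l by (simp add: mult_left_le_one_le)
  then have "l * (\<Sum>i=1..n. x i) = (\<Sum>i=1..n. x i)" using lower[OF mem] by (rule antisym)
  then show "(\<Sum>i=1..n. x i) \<in> divergence_sums n" using mem by metis
qed

text \<open>Keeps the comparison point where the one-letter series converge. Equality holds at n =
  2; from n = 3 on, arctan u \<le> u and 2 n / (n - 1) \<le> 3 suffice.\<close>

lemma arctan_bound_le_pi:
  assumes "2 \<le> n"
  shows "real n * (2 * arctan (1 / (real n - 1))) \<le> pi"
proof (cases "n = 2")
  case True
  then show ?thesis by (simp add: arctan_one)
next
  case False
  then have n: "3 \<le> real n" using assms by simp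
  have "arctan (1 / (real n - 1)) \<le> 1 / (real n - 1)" using n by (intro arctan_le_self) auto
  then have "real n * (2 * arctan (1 / (real n - 1))) \<le> real n * (2 * (1 / (real n - 1)))"
    by (intro mult_left_mono) auto
  also have "\<dots> \<le> 3" using n by (simp add: field_simps)
  finally show ?thesis using pi_gt3 by linarith
qed

lemma cum_radius_minimizer:
  assumes n: "2 \<le> n"
  obtains x t where "\<And>i. 0 \<le> x i" "t \<in> {0..1}" "bch_den n t x \<le> 0" "(\<Sum>i=1..n. x i) = cum_radius n"
    "cum_radius n < pi" "cum_radius n < 2 * real n * arctan (1 / (real n - 1))"
    "\<And>y u. (\<And>i. 0 \<le> y i) \<Longrightarrow> u \<in> {0..1} \<Longrightarrow> bch_den n u y \<le> 0 \<Longrightarrow> cum_radius n \<le> (\<Sum>i=1..n. y i)"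
proof -
  define \<xi> where "\<xi> = 2 * arctan (1 / (real n - 1))"
  have \<xi>: "0 < \<xi>" using n by (simp add: \<xi>_def)
  have n\<xi>: "real n * \<xi> \<le> pi" unfolding \<xi>_def by (rule arctan_bound_le_pi[OF n])
  have "1 * \<xi> < real n * \<xi>" using n \<xi> by (intro mult_strict_right_mono) auto
  then have \<xi>pi: "\<xi> < pi" using n\<xi> by simp
  obtain t0 where t0: "t0 \<in> {0..1}" "bch_den n t0 (\<lambda>_. \<xi>) < 0"
    unfolding \<xi>_def by (rule bch_den_arctan_neg[OF n])
  \<comment> \<open>Shrinking the strictly negative point brings its total strictly below both the
    arctan bound and \<pi>, also for n = 2.\<close>
  obtain l where l: "l \<in> {0..<1}" "bch_den n t0 (\<lambda>_. l * \<xi>) \<le> 0"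
    by (rule bch_den_neg_shrink[of "\<lambda>_. \<xi>" n t0]) (use \<xi> \<xi>pi t0 in auto)
  have s: "(\<Sum>i=1..n. l * \<xi>) = l * (real n * \<xi>)" by simp
  have lt: "l * (real n * \<xi>) < real n * \<xi>"
    using mult_strict_right_mono[of l 1 "real n * \<xi>"] l \<xi> n by simp
  have lpi: "(\<Sum>i=1..n. l * \<xi>) < pi" using lt n\<xi> unfolding s by linarith
  obtain x t where x: "\<And>i. 0 \<le> x i" "t \<in> {0..1}" "bch_den n t x \<le> 0" "(\<Sum>i=1..n. x i) < pi"
    "\<And>y u. (\<And>i. 0 \<le> y i) \<Longrightarrow> u \<in> {0..1} \<Longrightarrow> bch_den n u y \<le> 0 \<Longrightarrow> (\<Sum>i=1..n. x i) \<le> (\<Sum>i=1..n. y i)"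
    by (rule bch_den_minimum[of "\<lambda>_. l * \<xi>" t0 n]) (use l \<xi> t0 lpi in auto)
  have C: "cum_radius n = (\<Sum>i=1..n. x i)" by (rule cum_radius_eq) (use x in auto)
  have "cum_radius n \<le> (\<Sum>i=1..n. l * \<xi>)"
    unfolding C by (rule x(5)) (use l \<xi> t0 in auto)
  then have "cum_radius n < real n * \<xi>" using lt s by linarith
  then have "cum_radius n < 2 * real n * arctan (1 / (real n - 1))" by (simp add: \<xi>_def mult_ac)
  then show ?thesis using that[of x t] x C by auto
qed

lemma cum_radius_gt_2:
  assumes "2 \<le> n"
  shows "2 < cum_radius n"
proof (rule ccontr)
  assume le: "\<not> 2 < cum_radius n"
  obtain x t where x: "\<And>i. 0 \<le> x i" "t \<in> {0..1}" "bch_den n t x \<le> 0" "(\<Sum>i=1..n. x i) = cum_radius n"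
    by (rule cum_radius_minimizer[OF assms]) blast
  have "0 < bch_den n t x" by (rule bch_den_pos_of_sum_le_2) (use x le in auto)
  then show False using x(3) by simp
qed

section \<open>Strict monotonicity by splitting a letter\<close>

lemma word_den_tail:
  assumes "m \<le> n" "\<And>i. i \<in> {m<..n} \<Longrightarrow> r i = 0"
  shows "word_den q r n = word_den q r m"
  using assms by (induction n rule: dec_induct) auto

text \<open>
  Splitting a letter of size \<open>x\<close> into two halves: the two values \<open>R\<close> act like a single letter of value
  \<open>(2 R + R\<^sup>2) / (1 - q R\<^sup>2)\<close>, while the doubling formula bounds the original value \<open>r\<close> by
  \<open>(2 R + d R\<^sup>2) / (1 - q R\<^sup>2)\<close> with \<open>d < 1\<close>.
\<close>

lemma word_den_split_letter:
  fixes q D N r R d :: real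
  assumes q: "0 < q" and D: "0 < D" and N: "0 \<le> N" and crit: "D - q * r * N \<le> 0"
    and R: "0 < R" and d: "d < 1" and double: "r * (1 - q * R\<^sup>2) \<le> 2 * R + d * R\<^sup>2"
  shows "D - q * R * N - q * R * (N + R * (N + D)) < 0"
proof -
  have "N \<noteq> 0" using crit D by auto
  then have N0: "0 < N" using N by simp
  have eq: "D - q * R * N - q * R * (N + R * (N + D)) = D * (1 - q * R\<^sup>2) - q * N * (2 * R + R\<^sup>2)"
    by (simp add: algebra_simps power2_eq_square)
  have qN: "0 < q * N" using q N0 by simp
  show ?thesis
  proof (cases "0 < 1 - q * R\<^sup>2")
    case True
    have "d * R\<^sup>2 < 1 * R\<^sup>2" using d R by (intro mult_strict_right_mono) auto
    then have "r * (1 - q * R\<^sup>2) < 2 * R + R\<^sup>2" using double by simp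
    then have "q * N * (r * (1 - q * R\<^sup>2)) < q * N * (2 * R + R\<^sup>2)" using qN by (rule mult_strict_left_mono)
    moreover have "(D - q * r * N) * (1 - q * R\<^sup>2) \<le> 0" using crit True by (intro mult_nonpos_nonneg) auto
    ultimately show ?thesis unfolding eq by (simp add: algebra_simps)
  next
    case False
    then have "D * (1 - q * R\<^sup>2) \<le> 0" using D by (intro mult_nonneg_nonpos) auto
    moreover have "0 < 2 * R + R\<^sup>2" using R by (simp add: add_pos_pos)
    then have "0 < q * N * (2 * R + R\<^sup>2)" by (rule mult_pos_pos[OF qN])
    ultimately show ?thesis unfolding eq by linarith
  qed
qed

lemma cum_radius_Suc_less:
  assumes n: "2 \<le> n"
  shows "cum_radius (Suc n) < cum_radius n"
proof -
  obtain x t where x: "\<And>i. 0 \<le> x i" "t \<in> {0..1}" "bch_den n t x \<le> 0" "(\<Sum>i=1..n. x i) = cum_radius n"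
    "cum_radius n < pi"
    by (rule cum_radius_minimizer[OF n]) blast
  have min': "cum_radius (Suc n) \<le> (\<Sum>i=1..Suc n. y i)"
    if "\<And>i. 0 \<le> y i" "u \<in> {0..1}" "bch_den (Suc n) u y \<le> 0" for y u
    by (rule cum_radius_minimizer[of "Suc n"]) (use n that in auto)
  have xpi: "x i < pi" if "i \<in> {1..n}" for i
    using member_le_sum[OF that, of x] x(1,4,5) by simp
  define q where "q = (1 - t) * t"
  define r where "r i = res_sum t (x i)" for i
  have r0: "0 \<le> r i" if "i \<in> {1..n}" for i
    using res_sum_ge[of t "x i"] x(1)[of i] x(2) xpi[OF that] by (simp add: r_def)
  have D: "word_den q r n \<le> 0" using x(3) by (simp add: bch_den_def q_def r_def[abs_def])
  have "t \<noteq> 0" "t \<noteq> 1" using D by (auto simp: q_def)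
  then have t: "0 < t" "t < 1" and q: "0 < q" using x(2) by (auto simp: q_def)
  \<comment> \<open>The first prefix with nonpositive denominator: the prefix before it has a
    positive one, as \<open>word_den_split_letter\<close> requires, and discarding the later letters
    does not raise the total.\<close>
  define j where "j = (LEAST j. word_den q r j \<le> 0)"
  have j: "word_den q r j \<le> 0" "j \<le> n"
    unfolding j_def using D by (rule LeastI, rule Least_le)
  have j_min: "0 < word_den q r i" if "i < j" for i
    using not_less_Least[of i "\<lambda>j. word_den q r j \<le> 0"] that by (simp add: j_def not_le)
  obtain m where m: "j = Suc m" using j(1) by (cases j) auto
  have Dm: "0 < word_den q r m" using j_min m by simp
  have Nm: "0 \<le> word_num q r m"
    using word_den_mono[of "1 - t" t m r r] r0 j(2) m t by (auto simp: q_def)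
  have crit: "word_den q r m - q * r j * word_num q r m \<le> 0" using j(1) by (simp add: m)
  have xj: "0 < x j"
  proof (rule ccontr)
    assume "\<not> 0 < x j"
    then have "x j = 0" using x(1)[of j] by simp
    then show False using crit Dm by (simp add: r_def)
  qed
  have jn: "j \<in> {1..n}" using j(2) m by simp
  define R where "R = res_sum t (x j / 2)"
  have h: "0 \<le> x j / 2" "x j / 2 < pi" using xj xpi[OF jn] by auto
  have R: "0 < R" using res_sum_ge[of t "x j / 2"] h x(2) xj by (simp add: R_def)
  have dbl: "r j * (1 - q * R\<^sup>2) \<le> 2 * R + \<bar>1 - 2 * t\<bar> * R\<^sup>2"
    using res_sum_double[of t "x j"] x(2) xj xpi[OF jn] by (simp add: r_def R_def q_def mult.commute)
  have neg: "word_den q r m - q * R * word_num q r m - q * R * (word_num q r m + R * (word_num q r m + word_den q r m)) < 0"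
    using word_den_split_letter[OF q Dm Nm crit R _ dbl] t by auto
  \<comment> \<open>Discarding the letters after j frees position j + 1 for the second half; since j
    \<le> n, it lies within 1..n + 1.\<close>
  define y where "y i = (if i < j then x i else if i = j \<or> i = Suc j then x j / 2 else 0)" for i
  define r' where "r' i = res_sum t (y i)" for i
  have r': "r' i = r i" if "i \<in> {1..m}" for i using that by (simp add: r'_def r_def y_def m)
  have "word_den q r' (Suc n) = word_den q r' (Suc (Suc m))"
    using j(2) m by (intro word_den_tail) (auto simp: r'_def y_def)
  also have "\<dots> < 0"
    using neg word_den_word_num_cong[of m r' r q] r' by (simp add: m) (simp add: r'_def y_def m R_def)
  finally have "bch_den (Suc n) t y < 0" by (simp add: bch_den_def q_def r'_def[abs_def])
  moreover have y0: "0 \<le> y i" for i using x(1) by (simp add: y_def)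
  moreover have ypi: "y i < pi" if "i \<in> {1..Suc n}" for i
    using that xpi[OF jn] xpi[of i] xj j(2) by (auto simp: y_def)
  ultimately obtain l where l: "l \<in> {0..<1}" "bch_den (Suc n) t (\<lambda>i. l * y i) \<le> 0"
    using bch_den_neg_shrink[of y "Suc n" t] x(2) by blast
  have sumy: "(\<Sum>i=1..Suc n. y i) \<le> cum_radius n"
  proof -
    have "{1..Suc n} = {1..m} \<union> {j, Suc j} \<union> {Suc j<..Suc n}" using j(2) m by auto
    then have "(\<Sum>i=1..Suc n. y i) = (\<Sum>i\<in>{1..m}. y i) + (y j + y (Suc j)) + (\<Sum>i\<in>{Suc j<..Suc n}. y i)"
      by (simp only:) (subst sum.union_disjoint; force simp: m)+
    also have "\<dots> = (\<Sum>i=1..m. x i) + x j"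
    proof -
      have "(\<Sum>i\<in>{1..m}. y i) = (\<Sum>i=1..m. x i)" by (rule sum.cong) (auto simp: y_def m)
      moreover have "(\<Sum>i\<in>{Suc j<..Suc n}. y i) = 0" by (rule sum.neutral) (auto simp: y_def)
      ultimately show ?thesis by (simp add: y_def)
    qed
    also have "\<dots> = (\<Sum>i=1..j. x i)" by (simp add: m)
    also have "\<dots> \<le> (\<Sum>i=1..n. x i)" using j(2) x(1) by (intro sum_mono2) auto
    finally show ?thesis using x(4) by simp
  qed
  have "cum_radius (Suc n) \<le> (\<Sum>i=1..Suc n. l * y i)"
    by (rule min'[where u = t]) (use y0 l x(2) in auto)
  also have "\<dots> = l * (\<Sum>i=1..Suc n. y i)" by (simp only: sum_distrib_left)
  also have "\<dots> \<le> l * cum_radius n" using sumy l by (intro mult_left_mono) auto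
  also have "\<dots> < cum_radius n" using cum_radius_gt_2[OF n] l by simp
  finally show ?thesis .
qed

theorem theorem3p23:
  shows "(\<forall>n::nat. n \<ge> 2 \<longrightarrow>
           2 < cum_radius n \<and> cum_radius n < 2 * real n * arctan (1 / (real n - 1)))
       \<and> (\<forall>m n::nat. 2 \<le> m \<longrightarrow> m < n \<longrightarrow> cum_radius n < cum_radius m)"
proof (intro conjI allI impI)
  fix n :: nat assume n: "2 \<le> n"
  show "2 < cum_radius n" by (rule cum_radius_gt_2[OF n])
  show "cum_radius n < 2 * real n * arctan (1 / (real n - 1))"
    by (rule cum_radius_minimizer[OF n])
next
  fix m n :: nat assume m: "2 \<le> m" and "m < n"
  then have "Suc m \<le> n" by simp
  then show "cum_radius n < cum_radius m"
  proof (induction n rule: dec_induct)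
    case base
    show ?case by (rule cum_radius_Suc_less[OF m])
  next
    case (step n)
    then show ?case using cum_radius_Suc_less[of n] m by simp
  qed
qed

end
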